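(* Let $X$ be a finite-dimensional (real) normed space, let $F$ be a locally Lipschitz set-valued map assigning to each point of $X$ a nonempty compact subset of $X$, and let $h : X \to \mathbb{R}^p$ be continuous. Suppose that the system $$\dot{x}(t) \in F(x(t)), \qquad y(t) = h(x(t)),$$ is forward complete. Then the system is output-globally asymptotically stable (oGAS) if and only if it satisfies the uniform output-global asymptotic stability condition (oUGAS).
   Context: Norms on $X$ and $\mathbb{R}^p$ are denoted $|\cdot|$. The Hausdorff distance between nonempty closed sets $K,L\subseteq X$ is $d_H(K,L):=\max\{\sup_{\xi\in K}d(\xi,L),\ \sup_{\eta\in L}d(\eta,K)\}$, where $d(\xi,K)=\inf_{\eta\in K}|\xi-\eta|$. $F$ is locally Lipschitz if every $\xi\in X$ has a neighbourhood $U$ and a constant $k_U$ such that $d_H(F(\eta),F(\zeta))\le k_U|\eta-\zeta|$ for all $\eta,\zeta\in U$. $B(0,\kappa)$ is the closed ball of radius $\kappa$ centred at $0$ in $X$. A solution on an interval $\mathcal{I}\subseteq[0,\infty)$ is a function $x:\mathcal{I}\to X$, absolutely continuous on compact subintervals, with $\dot x(t)\in F(x(t))$ for almost every $t\in\mathcal{I}$. A solution $x:[0,T)\to X$, $0<T\le\infty$, is maximal if either $T=\infty$ or there is no solution $y:[0,T_+]\to X$ with $T_+>T$ and $y(t)=x(t)$ for all $t\in[0,T)$. The system is forward complete if every maximal solution is defined on $[0,\infty)$. For $C\subseteq X$, $\mathbf{S}(C)$ is the set of maximal solutions with $x(0)\in C$; $\mathbf{S}(\xi):=\mathbf{S}(\{\xi\})$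 and $\mathbf{S}:=\mathbf{S}(X)$. For a solution $x(\cdot)$, $y(t)$ denotes $h(x(t))$. Output stability: for all $\varepsilon>0$ there exists $\delta>0$ such that for all $\xi\in X$ with $|h(\xi)|\le\delta$ and all $x(\cdot)\in\mathbf{S}(\xi)$, $|y(t)|\le\varepsilon$ for all $t\ge0$. (oGAS): the system is output-globally asymptotically stable if output stability holds and, for every $x(\cdot)\in\mathbf{S}$, $\lim_{t\to\infty}|y(t)|=0$. (oUGAS): the system satisfies the uniform output-global asymptotic stability condition if output stability holds and, for all $\kappa>0$ and $\varepsilon>0$, there exists $T=T(\varepsilon,\kappa)>0$ such that for all $x(\cdot)\in\mathbf{S}(B(0,\kappa))$, $|y(t)|\le\varepsilon$ for all $t\ge T$. *)

theory Defs
  imports "HOL-Analysis.Analysis"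
begin

text \<open>
  The state space is a type of class \<open>real_normed_vector\<close>, whose class norm is the given norm; finite
  dimension is an explicit hypothesis where needed. The output space is \<open>real ^ 'p\<close> with an
  arbitrary norm \<open>N\<close>, which need not be the Euclidean one.
\<close>

definition is_norm :: "('b::real_vector \<Rightarrow> real) \<Rightarrow> bool" where
  "is_norm N \<longleftrightarrow>
     (\<forall>y. 0 \<le> N y) \<and>
     (\<forall>y. N y = 0 \<longleftrightarrow> y = 0) \<and>
     (\<forall>c y. N (c *\<^sub>R y) = \<bar>c\<bar> * N y) \<and>
     (\<forall>y z. N (y + z) \<le> N y + N z)"

text \<open>
  Real-valued suprema: meaningful for nonempty bounded sets, and only used for nonempty
  compact ones.
\<close>

definition hausdorff_dist :: "'a::metric_space set \<Rightarrow> 'a set \<Rightarrow> real" where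
  "hausdorff_dist K L = max (SUP x\<in>K. infdist x L) (SUP y\<in>L. infdist y K)"

definition locally_lipschitz_map :: "('a::metric_space \<Rightarrow> 'a set) \<Rightarrow> bool" where
  "locally_lipschitz_map F \<longleftrightarrow>
     (\<forall>x. \<exists>U k. open U \<and> x \<in> U \<and>
        (\<forall>y\<in>U. \<forall>z\<in>U. hausdorff_dist (F y) (F z) \<le> k * dist y z))"

text \<open>
  The usual epsilon-delta definition; the finite families of non-overlapping compact
  intervals \<open>k = {Inf k..Sup k}\<close> are the divisions of subsets of \<open>{a..b}\<close>.
\<close>

definition abs_continuous_on_interval ::
    "real \<Rightarrow> real \<Rightarrow> (real \<Rightarrow> 'a::real_normed_vector) \<Rightarrow> bool" where
  "abs_continuous_on_interval a b x \<longleftrightarrow>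
     (\<forall>\<epsilon>>0. \<exists>\<delta>>0. \<forall>\<D> S. \<D> division_of S \<and> S \<subseteq> {a..b} \<and> (\<Sum>k\<in>\<D>. Sup k - Inf k) < \<delta>
        \<longrightarrow> (\<Sum>k\<in>\<D>. norm (x (Sup k) - x (Inf k))) < \<epsilon>)"

text \<open>
  A function on an interval \<open>I\<close> is represented by a total function of which only the values
  on \<open>I\<close> matter.
\<close>

definition solution_on ::
    "('a::real_normed_vector \<Rightarrow> 'a set) \<Rightarrow> real set \<Rightarrow> (real \<Rightarrow> 'a) \<Rightarrow> bool" where
  "solution_on F I x \<longleftrightarrow>
     is_interval I \<and> I \<subseteq> {0..} \<and>
     (\<forall>a b. a \<le> b \<and> {a..b} \<subseteq> I \<longrightarrow> abs_continuous_on_interval a b x) \<and>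
     (AE t in lebesgue. t \<in> I \<longrightarrow> (\<exists>v\<in>F (x t). (x has_vector_derivative v) (at t within I)))"

definition maximal_solution ::
    "('a::real_normed_vector \<Rightarrow> 'a set) \<Rightarrow> ereal \<Rightarrow> (real \<Rightarrow> 'a) \<Rightarrow> bool" where
  "maximal_solution F T x \<longleftrightarrow>
     0 < T \<and> solution_on F {t. 0 \<le> t \<and> ereal t < T} x \<and>
     (T = \<infinity> \<or>
      \<not> (\<exists>T' y. T < ereal T' \<and> solution_on F {0..T'} y \<and>
            (\<forall>t. 0 \<le> t \<and> ereal t < T \<longrightarrow> y t = x t)))"

definition forward_complete :: "('a::real_normed_vector \<Rightarrow> 'a set) \<Rightarrow> bool" where
  "forward_complete F \<longleftrightarrow> (\<forall>T x. maximal_solution F T x \<longrightarrow> T = \<infinity>)"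

text \<open>
  The domain \<open>[0, T)\<close> is not recorded in \<open>max_solutions\<close>. The stability notions below evaluate
  maximal solutions at all \<open>t \<ge> 0\<close> and are thus meant for forward complete systems, where the
  domain is always \<open>[0, \<infinity>)\<close>.
\<close>

definition max_solutions ::
    "('a::real_normed_vector \<Rightarrow> 'a set) \<Rightarrow> 'a set \<Rightarrow> (real \<Rightarrow> 'a) set" where
  "max_solutions F C = {x. (\<exists>T. maximal_solution F T x) \<and> x 0 \<in> C}"

definition output_stable ::
    "('b \<Rightarrow> real) \<Rightarrow> ('a::real_normed_vector \<Rightarrow> 'a set) \<Rightarrow> ('a \<Rightarrow> 'b) \<Rightarrow> bool" where
  "output_stable N F h \<longleftrightarrow>
     (\<forall>\<epsilon>>0. \<exists>\<delta>>0. \<forall>\<xi>. N (h \<xi>) \<le> \<delta> \<longrightarrow>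
        (\<forall>x\<in>max_solutions F {\<xi>}. \<forall>t\<ge>0. N (h (x t)) \<le> \<epsilon>))"

definition oGAS ::
    "('b \<Rightarrow> real) \<Rightarrow> ('a::real_normed_vector \<Rightarrow> 'a set) \<Rightarrow> ('a \<Rightarrow> 'b) \<Rightarrow> bool" where
  "oGAS N F h \<longleftrightarrow>
     output_stable N F h \<and>
     (\<forall>x\<in>max_solutions F UNIV. ((\<lambda>t. N (h (x t))) \<longlongrightarrow> 0) at_top)"

definition oUGAS ::
    "('b \<Rightarrow> real) \<Rightarrow> ('a::real_normed_vector \<Rightarrow> 'a set) \<Rightarrow> ('a \<Rightarrow> 'b) \<Rightarrow> bool" where
  "oUGAS N F h \<longleftrightarrow>
     output_stable N F h \<and>
     (\<forall>\<kappa>>0. \<forall>\<epsilon>>0. \<exists>T>0. \<forall>x\<in>max_solutions F (cball 0 \<kappa>). \<forall>t\<ge>T. N (h (x t)) \<le> \<epsilon>)"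

end

theory Submission
  imports Defs
begin

text \<open>
  Every initial state lies in some ball, so oUGAS implies oGAS. For the converse, output stability
  reduces the claim to a uniform hitting time: given \<open>\<kappa>\<close> and \<open>\<delta>\<close>, there is an \<open>n\<close> such that every
  solution starting in the ball of radius \<open>\<kappa>\<close> has an output of norm below \<open>\<delta>\<close> at some time in
  \<open>[0, n]\<close>; if \<open>\<delta>\<close> is taken from output stability for \<open>\<epsilon>\<close>, the output stays within \<open>\<epsilon>\<close> from then on.
  If there is no such \<open>n\<close>, there are solutions \<open>y n\<close> from the ball whose output has norm at least
  \<open>\<delta>\<close> on all of \<open>[0, n]\<close>. The task is to turn them into one solution whose output has norm at least
  \<open>\<delta> / 2\<close> for ever, which contradicts oGAS.

  The values of \<open>F\<close> need not be convex, so a limit of the \<open>y n\<close> is in general not a solution, and no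
  solution with a prescribed initial state can be expected to stay near such a limit on an infinite
  interval, because errors grow with time. The remedy is to leave the initial state free and to
  propagate errors backwards. For suitable times \<open>0 = t 0 < t 1 < \<dots>\<close> and a nested sequence of
  subsequences, \<open>y n (t k)\<close> converges to some \<open>\<xi> k\<close> for every \<open>k\<close>
  (\<open>limit_points_along_solutions\<close>). On \<open>[t k, t (k + 1)]\<close> one picks a single \<open>y n\<close> that starts very
  close to \<open>\<xi> k\<close> and ends very close to \<open>\<xi> (k + 1)\<close>, and replaces it by a polygon leading exactly from
  \<open>\<xi> k\<close> to \<open>\<xi> (k + 1)\<close> (\<open>polygonal_approximation\<close>, \<open>near_solution_piece\<close>). The polygons fit
  together to an approximate solution on the union of the intervals, with errors on the \<open>k\<close>-th piece
  that can be prescribed after all \<open>t\<close>, \<open>\<xi>\<close> and local Lipschitz constants are known.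

  A Filippov iteration makes this approximate solution exact: each velocity is replaced by a
  nearest one that is admissible for the present curve, and the resulting change of position is
  integrated backwards from the right end of the time axis, so that the tiny errors of late pieces
  are passed on to earlier ones and never the other way round. With pieces that are no longer
  than \<open>1/16\<close> of the inverse of the local Lipschitz constant, and tolerances \<open>\<gamma> k\<close> that at least halve from
  one piece to the next, every step halves the error on all pieces at once (\<open>correction_exists\<close>).
  All velocities of the iteration are step functions. They converge uniformly on each piece, hence
  the limit curve is differentiable off a countable set and solves the inclusion there
  (\<open>exact_pieces\<close>).

  The length of the \<open>k\<close>-th piece is inversely proportional to the Lipschitz constant of \<open>F\<close> near
  \<open>\<xi> k\<close>. If the times \<open>t k\<close> were bounded, these lengths would tend to \<open>0\<close>, so \<open>\<xi> k\<close> would be unbounded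
  and the exact solution would explode in finite time, against forward completeness. Therefore
  \<open>t k\<close> tends to infinity and the exact solution lives on \<open>[0, \<infinity>)\<close>
  (\<open>persistent_lower_bound_solution\<close>).
\<close>

section \<open>Compactness in finite-dimensional normed spaces\<close>

text \<open>
  Induction on the spanning set. The distance \<open>d\<close> of a new vector \<open>b\<close> from the span of the others is
  positive, because by induction that span is closed; it bounds the \<open>b\<close>-coordinates of a bounded
  sequence by its norms divided by \<open>d\<close>, so a subsequence can be chosen along which the coordinate
  converges, and the induction hypothesis applies to the rest.
\<close>
lemma bounded_seq_subseq_in_span:
  fixes B :: "'a::real_normed_vector set"
  assumes "finite B"
  shows "\<forall>X::nat \<Rightarrow> 'a. bounded (range X) \<and> range X \<subseteq> span B \<longrightarrow>
           (\<exists>l\<in>span B. \<exists>r. strict_mono (r::nat\<Rightarrow>nat) \<and> (\<lambda>n. X (r n)) \<longlonglongrightarrow> l)"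
  using assms
proof (induction B)
  case empty
  have "\<exists>l\<in>span {}. \<exists>r. strict_mono (r::nat\<Rightarrow>nat) \<and> (\<lambda>n. X (r n)) \<longlonglongrightarrow> l"
    if "range X \<subseteq> span {}" for X :: "nat \<Rightarrow> 'a"
  proof -
    have "X n = 0" for n using that by auto
    then have "(\<lambda>n. X (id n)) \<longlonglongrightarrow> 0" by simp
    then show ?thesis using strict_mono_id by (metis span_zero)
  qed
  then show ?case by blast
next
  case (insert b B)
  show ?case
  proof (cases "b \<in> span B")
    case True
    then show ?thesis using insert.IH by (simp add: span_redundant)
  next
    case False
    have closed: "closed (span B)"
      unfolding closed_sequential_limits
    proof (intro allI impI)
      fix X l assume X: "(\<forall>n::nat. X n \<in> span B) \<and> X \<longlonglongrightarrow> l"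
      then obtain l' r where l': "l' \<in> span B" "strict_mono (r::nat\<Rightarrow>nat)" "(\<lambda>n. X (r n)) \<longlonglongrightarrow> l'"
        using insert.IH convergent_imp_bounded[of X l] by blast
      have "(\<lambda>n. X (r n)) \<longlonglongrightarrow> l"
        using X l'(2) LIMSEQ_subseq_LIMSEQ[of X l r] by (simp add: o_def)
      then show "l \<in> span B" using l' LIMSEQ_unique by blast
    qed
    define d where "d = infdist b (span B)"
    have ne: "span B \<noteq> {}" using span_zero by blast
    have d: "d > 0"
      using False closed ne in_closed_iff_infdist_zero[of "span B" b] infdist_nonneg[of b "span B"]
      unfolding d_def by force
    have coef: "\<bar>c\<bar> * d \<le> norm (c *\<^sub>R b + s)" if "s \<in> span B" for c s
    proof (cases "c = 0")
      case False
      have "- (1/c) *\<^sub>R s \<in> span B" using that by (rule span_scale)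
      then have "d \<le> dist b (- (1/c) *\<^sub>R s)" unfolding d_def by (rule infdist_le)
      then have "\<bar>c\<bar> * d \<le> \<bar>c\<bar> * norm (b + (1/c) *\<^sub>R s)"
        by (intro mult_left_mono) (auto simp: dist_norm)
      also have "\<dots> = norm (c *\<^sub>R (b + (1/c) *\<^sub>R s))" by simp
      also have "c *\<^sub>R (b + (1/c) *\<^sub>R s) = c *\<^sub>R b + s" using False by (simp add: scaleR_add_right)
      finally show ?thesis .
    qed auto
    show ?thesis
    proof (intro allI impI)
      fix X :: "nat \<Rightarrow> 'a" assume X: "bounded (range X) \<and> range X \<subseteq> span (insert b B)"
      then have "\<forall>n. \<exists>c. X n - c *\<^sub>R b \<in> span B" by (auto simp: span_insert)
      then obtain c where c: "\<And>n. X n - c n *\<^sub>R b \<in> span B" by metis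
      obtain M where M: "\<And>n. norm (X n) \<le> M" using X by (auto simp: bounded_iff)
      have "\<bar>c n\<bar> \<le> M / d" for n
        using coef[OF c[of n], of "c n"] M[of n] d by (simp add: field_simps)
      then have bc: "bounded (range c)" by (auto simp: bounded_iff)
      then obtain l r where r: "strict_mono (r::nat\<Rightarrow>nat)" "(\<lambda>n. c (r n)) \<longlonglongrightarrow> l"
        using bounded_imp_convergent_subsequence[of c] by (auto simp: o_def)
      obtain M' where M': "\<And>n. \<bar>c n\<bar> \<le> M'" using bc by (auto simp: bounded_iff)
      have "norm (X n - c n *\<^sub>R b) \<le> M + M' * norm b" for n
        using norm_triangle_ineq4[of "X n" "c n *\<^sub>R b"] M[of n] M'[of n]
          mult_right_mono[OF M'[of n], of "norm b"] by auto
      then have "bounded (range (\<lambda>n. X (r n) - c (r n) *\<^sub>R b))" by (auto simp: bounded_iff)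
      then obtain m r' where r': "m \<in> span B" "strict_mono (r'::nat\<Rightarrow>nat)"
          "(\<lambda>n. X (r (r' n)) - c (r (r' n)) *\<^sub>R b) \<longlonglongrightarrow> m"
        using insert.IH[rule_format, of "\<lambda>n. X (r n) - c (r n) *\<^sub>R b"] c by auto
      have "(\<lambda>n. c (r (r' n))) \<longlonglongrightarrow> l"
        using LIMSEQ_subseq_LIMSEQ[OF r(2) r'(2)] by (simp add: o_def)
      then have "(\<lambda>n. (X (r (r' n)) - c (r (r' n)) *\<^sub>R b) + c (r (r' n)) *\<^sub>R b) \<longlonglongrightarrow> m + l *\<^sub>R b"
        by (intro tendsto_intros r')
      moreover have "m + l *\<^sub>R b \<in> span (insert b B)"
        using r'(1) by (auto simp: span_insert intro!: exI[of _ l])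
      moreover have "strict_mono (\<lambda>n. r (r' n))" using r(1) r'(2) by (auto simp: strict_mono_def)
      ultimately show "\<exists>l\<in>span (insert b B). \<exists>r. strict_mono (r::nat\<Rightarrow>nat) \<and> (\<lambda>n. X (r n)) \<longlonglongrightarrow> l"
        by (intro bexI[of _ "m + l *\<^sub>R b"] exI[of _ "\<lambda>n. r (r' n)"]) auto
    qed
  qed
qed

section \<open>Bounds for the right-hand side on balls\<close>

lemma nearest_point_exists:
  fixes K :: "'a::metric_space set"
  assumes "compact K" "K \<noteq> {}"
  shows "\<exists>w\<in>K. dist v w = infdist v K"
proof -
  obtain w where w: "w \<in> K" "\<And>u. u \<in> K \<Longrightarrow> dist v w \<le> dist v u"
    using continuous_attains_inf[OF assms, of "dist v"] continuous_on_dist[OF continuous_on_const continuous_on_id] by metis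
  have "dist v w \<le> infdist v K" using w assms(2) by (auto simp: infdist_def intro!: cINF_greatest)
  then show ?thesis using w(1) infdist_le[OF w(1), of v] by force
qed

lemma infdist_le_hausdorff_dist:
  fixes K L :: "'a::metric_space set"
  assumes "compact K" "x \<in> K"
  shows "infdist x L \<le> hausdorff_dist K L"
proof -
  have "compact ((\<lambda>x. infdist x L) ` K)"
    by (intro compact_continuous_image assms continuous_intros)
  then have "bdd_above ((\<lambda>x. infdist x L) ` K)" by (simp add: bounded_imp_bdd_above compact_imp_bounded)
  then have "infdist x L \<le> (SUP x\<in>K. infdist x L)" by (rule cSUP_upper2) (use assms in auto)
  then show ?thesis unfolding hausdorff_dist_def by simp
qed

locale lipschitz_inclusion =
  fixes F :: "'a::real_normed_vector \<Rightarrow> 'a set"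
  assumes finite_dim: "\<exists>B::'a set. finite B \<and> span B = UNIV"
    and nonempty: "F \<xi> \<noteq> {}"
    and compact: "compact (F \<xi>)"
    and loc_lip: "locally_lipschitz_map F"
begin

lemma bounded_seq_subseq:
  fixes X :: "nat \<Rightarrow> 'a"
  assumes "bounded (range X)"
  obtains l r where "strict_mono (r::nat\<Rightarrow>nat)" "(\<lambda>n. X (r n)) \<longlonglongrightarrow> l"
  using finite_dim bounded_seq_subseq_in_span assms by (metis UNIV_I subsetI)

lemma Cauchy_limit:
  fixes X :: "nat \<Rightarrow> 'a"
  assumes "Cauchy X"
  obtains l where "X \<longlonglongrightarrow> l"
proof -
  obtain l r where r: "strict_mono (r::nat\<Rightarrow>nat)" "(\<lambda>n. X (r n)) \<longlonglongrightarrow> l"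
    using bounded_seq_subseq cauchy_imp_bounded[OF assms] by metis
  then have "X \<longlonglongrightarrow> l"
    using Cauchy_converges_subseq[OF assms r(1), of l] by (simp add: o_def)
  then show ?thesis by (rule that)
qed

lemma compact_cball: "compact (cball (0::'a) R)"
  unfolding compact_def
proof (intro allI impI)
  fix X :: "nat \<Rightarrow> 'a" assume X: "\<forall>n. X n \<in> cball 0 R"
  then have "bounded (range X)" by (auto simp: bounded_iff)
  then obtain l r where r: "strict_mono (r::nat\<Rightarrow>nat)" "(\<lambda>n. X (r n)) \<longlonglongrightarrow> l"
    by (rule bounded_seq_subseq)
  have "l \<in> cball 0 R"
    by (rule closed_sequentially[OF closed_cball _ r(2)]) (use X in auto)
  then show "\<exists>l\<in>cball 0 R. \<exists>r. strict_mono (r::nat\<Rightarrow>nat) \<and> (X \<circ> r) \<longlonglongrightarrow> l"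
    using r by (auto simp: o_def)
qed

lemma local_infdist_bound:
  obtains U k where "open U" "\<xi> \<in> U" "k > 0"
    "\<And>y z v. y \<in> U \<Longrightarrow> z \<in> U \<Longrightarrow> v \<in> F y \<Longrightarrow> infdist v (F z) \<le> k * dist y z"
proof -
  obtain U k where U: "open U" "\<xi> \<in> U"
      "\<And>y z. y \<in> U \<Longrightarrow> z \<in> U \<Longrightarrow> hausdorff_dist (F y) (F z) \<le> k * dist y z"
    using loc_lip unfolding locally_lipschitz_map_def by meson
  show ?thesis
  proof (rule that[OF U(1,2)])
    show "max k 1 > 0" by simp
    fix y z v assume a: "y \<in> U" "z \<in> U" "v \<in> F y"
    have "infdist v (F z) \<le> k * dist y z"
      using infdist_le_hausdorff_dist[OF compact a(3)] U(3)[OF a(1,2)] by (rule order_trans)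
    also have "\<dots> \<le> max k 1 * dist y z" by (intro mult_right_mono) auto
    finally show "infdist v (F z) \<le> max k 1 * dist y z" .
  qed
qed

text \<open>Near \<open>\<xi>\<close>, every velocity is within a fixed distance of the bounded set \<open>F \<xi>\<close>.\<close>
lemma locally_bounded_velocities:
  obtains U C where "open U" "\<xi> \<in> U" "\<And>y v. y \<in> U \<Longrightarrow> v \<in> F y \<Longrightarrow> norm v \<le> C"
proof -
  obtain U k where U: "open U" "\<xi> \<in> U" "k > 0"
    "\<And>y z v. y \<in> U \<Longrightarrow> z \<in> U \<Longrightarrow> v \<in> F y \<Longrightarrow> infdist v (F z) \<le> k * dist y z"
    using local_infdist_bound[of \<xi>] by metis
  obtain C where C: "\<And>w. w \<in> F \<xi> \<Longrightarrow> norm w \<le> C"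
    using compact_imp_bounded[OF compact, of \<xi>] by (auto simp: bounded_iff)
  show ?thesis
  proof (rule that)
    show "open (U \<inter> ball \<xi> 1)" "\<xi> \<in> U \<inter> ball \<xi> 1" using U by auto
    fix y v assume y: "y \<in> U \<inter> ball \<xi> 1" "v \<in> F y"
    obtain w where w: "w \<in> F \<xi>" "dist v w = infdist v (F \<xi>)"
      using nearest_point_exists[OF compact nonempty] by metis
    have "dist v w \<le> k * dist y \<xi>" using U(4)[of y \<xi> v] U(2) y w by auto
    also have "\<dots> \<le> k * 1" using y U(3) by (intro mult_left_mono) (auto simp: dist_commute)
    finally show "norm v \<le> C + k" using C[OF w(1)] norm_triangle_sub[of v w] by (simp add: dist_norm)
  qed
qed

lemma velocities_bounded_on_cball:
  obtains M where "M > 0" "\<And>y v. norm y \<le> R \<Longrightarrow> v \<in> F y \<Longrightarrow> norm v \<le> M"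
proof -
  have "\<exists>M. \<forall>y v. norm y \<le> R \<longrightarrow> v \<in> F y \<longrightarrow> norm v \<le> M"
  proof (rule ccontr)
    assume "\<not> ?thesis"
    then have "\<forall>n::nat. \<exists>y v. norm y \<le> R \<and> v \<in> F y \<and> norm v > real n" by (metis not_le)
    then obtain y v where yv: "\<And>n::nat. norm (y n) \<le> R \<and> v n \<in> F (y n) \<and> norm (v n) > real n" by metis
    have "bounded (range y)" using yv by (auto simp: bounded_iff)
    then obtain l r where r: "strict_mono (r::nat\<Rightarrow>nat)" "(\<lambda>n. y (r n)) \<longlonglongrightarrow> l"
      by (rule bounded_seq_subseq)
    obtain U C where U: "open U" "l \<in> U" "\<And>y v. y \<in> U \<Longrightarrow> v \<in> F y \<Longrightarrow> norm v \<le> C"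
      using locally_bounded_velocities[of l] by metis
    have "eventually (\<lambda>n. y (r n) \<in> U) sequentially" by (rule topological_tendstoD[OF r(2) U(1,2)])
    moreover have "eventually (\<lambda>n. real n > C) sequentially"
      by (metis eventually_at_top_dense filterlim_at_top_dense filterlim_real_sequentially)
    ultimately have "eventually (\<lambda>n. y (r n) \<in> U \<and> real n > C) sequentially" by eventually_elim auto
    then obtain n where n: "y (r n) \<in> U" "real n > C" using eventually_happens by force
    have "norm (v (r n)) \<le> C" using U(3) n(1) yv by blast
    moreover have "norm (v (r n)) > real (r n)" using yv by blast
    ultimately show False using n(2) seq_suble[OF r(1), of n] by simp
  qed
  then obtain M where "\<And>y v. norm y \<le> R \<Longrightarrow> v \<in> F y \<Longrightarrow> norm v \<le> M" by blast
  then show ?thesis by (intro that[of "max M 1"]) (auto intro: order_trans max.coboundedI1)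
qed

text \<open>
  Otherwise there are pairs of points in the ball that violate the estimate with constants tending
  to infinity. Velocities are bounded on the ball, so the two points of a pair approach each other,
  and a limit point of the pairs contradicts the Lipschitz property in a neighbourhood of it.
\<close>
lemma lipschitz_on_cball:
  obtains L where "L > 0"
    "\<And>y z v. norm y \<le> R \<Longrightarrow> norm z \<le> R \<Longrightarrow> v \<in> F y \<Longrightarrow> infdist v (F z) \<le> L * dist y z"
proof -
  obtain M where M: "M > 0" "\<And>y v. norm y \<le> R \<Longrightarrow> v \<in> F y \<Longrightarrow> norm v \<le> M"
    using velocities_bounded_on_cball[of R] by metis
  have "\<exists>L. \<forall>y z v. norm y \<le> R \<longrightarrow> norm z \<le> R \<longrightarrow> v \<in> F y \<longrightarrow> infdist v (F z) \<le> L * dist y z"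
  proof (rule ccontr)
    assume "\<not> ?thesis"
    then have "\<forall>n::nat. \<exists>y z v. norm y \<le> R \<and> norm z \<le> R \<and> v \<in> F y \<and> infdist v (F z) > real n * dist y z"
      by (metis not_le)
    then obtain y z v where yzv: "\<And>n::nat. norm (y n) \<le> R \<and> norm (z n) \<le> R \<and> v n \<in> F (y n) \<and>
         infdist (v n) (F (z n)) > real n * dist (y n) (z n)" by metis
    have "bounded (range y)" using yzv by (auto simp: bounded_iff)
    then obtain l r where r: "strict_mono (r::nat\<Rightarrow>nat)" "(\<lambda>n. y (r n)) \<longlonglongrightarrow> l"
      by (rule bounded_seq_subseq)
    have le: "real n * dist (y n) (z n) \<le> 2 * M" for n
    proof -
      obtain w where w: "w \<in> F (z n)" using nonempty by blast
      have "infdist (v n) (F (z n)) \<le> dist (v n) w" by (rule infdist_le[OF w])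
      also have "\<dots> \<le> norm (v n) + norm w" by (simp add: dist_norm norm_triangle_ineq4)
      also have "\<dots> \<le> 2 * M" using M(2)[of "y n" "v n"] M(2)[of "z n" w] w yzv[of n] by linarith
      finally show ?thesis using yzv[of n] by linarith
    qed
    have "(\<lambda>n. dist (y (r n)) (z (r n))) \<longlonglongrightarrow> 0"
    proof (rule tendsto_sandwich[OF _ _ tendsto_const])
      show "eventually (\<lambda>n. dist (y (r n)) (z (r n)) \<le> 2 * M / real n) sequentially"
        using eventually_gt_at_top[of 0]
      proof eventually_elim
        case (elim n)
        have "real n * dist (y (r n)) (z (r n)) \<le> real (r n) * dist (y (r n)) (z (r n))"
          using seq_suble[OF r(1), of n] by (intro mult_right_mono) auto
        also have "\<dots> \<le> 2 * M" by (rule le)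
        finally show ?case using elim by (simp add: field_simps)
      qed
      show "(\<lambda>n. 2 * M / real n) \<longlonglongrightarrow> 0" by (rule lim_const_over_n)
    qed auto
    then have "(\<lambda>n. y (r n) - z (r n)) \<longlonglongrightarrow> 0" by (simp add: dist_norm tendsto_norm_zero_iff)
    from tendsto_diff[OF r(2) this] have "(\<lambda>n. z (r n)) \<longlonglongrightarrow> l" by simp
    obtain U k where U: "open U" "l \<in> U" "k > 0"
      "\<And>y z v. y \<in> U \<Longrightarrow> z \<in> U \<Longrightarrow> v \<in> F y \<Longrightarrow> infdist v (F z) \<le> k * dist y z"
      using local_infdist_bound[of l] by metis
    have "eventually (\<lambda>n. y (r n) \<in> U) sequentially" "eventually (\<lambda>n. z (r n) \<in> U) sequentially"
      by (rule topological_tendstoD[OF r(2) U(1,2)],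
          rule topological_tendstoD[OF \<open>(\<lambda>n. z (r n)) \<longlonglongrightarrow> l\<close> U(1,2)])
    moreover have "eventually (\<lambda>n. real n > k) sequentially"
      by (metis eventually_at_top_dense filterlim_at_top_dense filterlim_real_sequentially)
    ultimately have "eventually (\<lambda>n. y (r n) \<in> U \<and> z (r n) \<in> U \<and> real n > k) sequentially"
      by eventually_elim auto
    then obtain n where n: "y (r n) \<in> U" "z (r n) \<in> U" "real n > k" using eventually_happens by force
    have "infdist (v (r n)) (F (z (r n))) \<le> k * dist (y (r n)) (z (r n))" using U(4) n yzv by blast
    also have "\<dots> \<le> real (r n) * dist (y (r n)) (z (r n))"
      using seq_suble[OF r(1), of n] n(3) by (intro mult_right_mono) auto
    finally show False using yzv[of "r n"] by linarith
  qed
  then obtain L where L: "\<And>y z v. norm y \<le> R \<Longrightarrow> norm z \<le> R \<Longrightarrow> v \<in> F y \<Longrightarrow> infdist v (F z) \<le> L * dist y z"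
    by blast
  show ?thesis
  proof (rule that[of "max L 1"])
    fix y z v :: 'a assume "norm y \<le> R" "norm z \<le> R" "v \<in> F y"
    then have "infdist v (F z) \<le> L * dist y z" by (rule L)
    also have "\<dots> \<le> max L 1 * dist y z" by (intro mult_right_mono) auto
    finally show "infdist v (F z) \<le> max L 1 * dist y z" .
  qed simp
qed

text \<open>
  One constant serves both as a bound on the speed and as a Lipschitz constant. Being at least \<open>1\<close>, it
  can be divided by and can absorb further constants.
\<close>
definition lip_bound :: "real \<Rightarrow> real \<Rightarrow> bool" where
  "lip_bound R L \<longleftrightarrow> L \<ge> 1 \<and> (\<forall>y v. norm y \<le> R \<longrightarrow> v \<in> F y \<longrightarrow> norm v \<le> L) \<and>
     (\<forall>y z v. norm y \<le> R \<longrightarrow> norm z \<le> R \<longrightarrow> v \<in> F y \<longrightarrow> infdist v (F z) \<le> L * dist y z)"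

lemma lip_bound_exists: "\<exists>L. lip_bound R L"
proof -
  obtain M where M: "M > 0" "\<And>y v. norm y \<le> R \<Longrightarrow> v \<in> F y \<Longrightarrow> norm v \<le> M"
    using velocities_bounded_on_cball[of R] by metis
  obtain L where L: "L > 0"
    "\<And>y z v. norm y \<le> R \<Longrightarrow> norm z \<le> R \<Longrightarrow> v \<in> F y \<Longrightarrow> infdist v (F z) \<le> L * dist y z"
    using lipschitz_on_cball[of R] by metis
  have "norm v \<le> M + L + 1" if "norm y \<le> R" "v \<in> F y" for y v :: 'a using M(2)[OF that] L(1) by linarith
  moreover have "infdist v (F z) \<le> (M + L + 1) * dist y z" if "norm y \<le> R" "norm z \<le> R" "v \<in> F y" for y z v :: 'a
    using L(2)[OF that] M(1) mult_right_mono[of L "M+L+1" "dist y z"] by force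
  ultimately show ?thesis using M(1) L(1) unfolding lip_bound_def by (intro exI[of _ "M+L+1"]) auto
qed

lemma lip_bound_infdist:
  assumes "lip_bound R L" "norm y \<le> R" "norm z \<le> R"
  shows "infdist v (F z) \<le> infdist v (F y) + L * dist y z"
proof -
  obtain w where w: "w \<in> F y" "dist v w = infdist v (F y)"
    using nearest_point_exists[OF compact nonempty] by metis
  have "infdist v (F z) \<le> infdist w (F z) + dist v w" by (rule infdist_triangle)
  moreover have "infdist w (F z) \<le> L * dist y z" using assms w(1) unfolding lip_bound_def by blast
  ultimately show ?thesis using w(2) by linarith
qed

end

section \<open>Step functions and their primitives\<close>

text \<open>
  On a compact interval these are the functions that are constant on the open pieces of a finite
  partition. The one-sided local form makes closure under pointwise operations immediate, without
  common refinements of partitions.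
\<close>
definition steplike :: "real set \<Rightarrow> (real \<Rightarrow> 'b) \<Rightarrow> bool" where
  "steplike J v \<longleftrightarrow> (\<forall>t\<in>J. (\<exists>c. \<forall>\<^sub>F s in at_right t. v s = c) \<and> (\<exists>c. \<forall>\<^sub>F s in at_left t. v s = c))"

lemma steplike_const: "steplike J (\<lambda>s. c)"
  unfolding steplike_def by auto

lemma steplike_comp2:
  assumes "steplike J u" "steplike J w"
  shows "steplike J (\<lambda>s. f (u s) (w s))"
  unfolding steplike_def
proof (intro ballI conjI)
  fix t assume t: "t \<in> J"
  obtain c d where "\<forall>\<^sub>F s in at_right t. u s = c" "\<forall>\<^sub>F s in at_right t. w s = d"
    using assms t unfolding steplike_def by blast
  then have "\<forall>\<^sub>F s in at_right t. f (u s) (w s) = f c d" by eventually_elim auto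
  then show "\<exists>c. \<forall>\<^sub>F s in at_right t. f (u s) (w s) = c" by blast
  obtain c d where "\<forall>\<^sub>F s in at_left t. u s = c" "\<forall>\<^sub>F s in at_left t. w s = d"
    using assms t unfolding steplike_def by blast
  then have "\<forall>\<^sub>F s in at_left t. f (u s) (w s) = f c d" by eventually_elim auto
  then show "\<exists>c. \<forall>\<^sub>F s in at_left t. f (u s) (w s) = c" by blast
qed

lemma steplike_floor:
  fixes a g :: real
  assumes "g > 0"
  shows "steplike J (\<lambda>s. \<lfloor>(s - a) / g\<rfloor>)"
  unfolding steplike_def
proof (intro ballI conjI exI)
  fix t :: real
  define m where "m = \<lfloor>(t - a) / g\<rfloor>"
  have m: "of_int m * g \<le> t - a" "t - a < (of_int m + 1) * g"
    using floor_divide_lower[OF assms, of "t - a"] floor_divide_upper[OF assms, of "t - a"]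
    unfolding m_def by auto
  have "\<forall>\<^sub>F s in at_right t. s \<in> {t<..<a + (of_int m + 1) * g}"
    by (rule eventually_at_right_real) (use m in auto)
  then show "\<forall>\<^sub>F s in at_right t. \<lfloor>(s - a) / g\<rfloor> = m"
  proof eventually_elim
    case (elim s)
    then have "of_int m * g \<le> s - a" "s - a < (of_int m + 1) * g" using m by auto
    then show ?case using assms by (intro floor_unique) (auto simp: field_simps)
  qed
  define n where "n = \<lceil>(t - a) / g\<rceil> - 1"
  have n: "of_int n * g < t - a" "t - a \<le> (of_int n + 1) * g"
    using ceiling_divide_lower[OF assms, of "t - a"] ceiling_divide_upper[OF assms, of "t - a"]
    unfolding n_def by auto
  have "\<forall>\<^sub>F s in at_left t. s \<in> {a + of_int n * g<..<t}"
    by (rule eventually_at_left_real) (use n in auto)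
  then show "\<forall>\<^sub>F s in at_left t. \<lfloor>(s - a) / g\<rfloor> = n"
  proof eventually_elim
    case (elim s)
    then have "of_int n * g \<le> s - a" "s - a < (of_int n + 1) * g" using n by auto
    then show ?case using assms by (intro floor_unique) (auto simp: field_simps)
  qed
qed

lemma steplike_less: "steplike J (\<lambda>s::real. s < v)"
  unfolding steplike_def
proof (intro ballI conjI)
  fix t :: real
  show "\<exists>c. \<forall>\<^sub>F s in at_right t. (s < v) = c"
  proof (cases "t < v")
    case True
    have "\<forall>\<^sub>F s in at_right t. s \<in> {t<..<v}" by (rule eventually_at_right_real[OF True])
    then have "\<forall>\<^sub>F s in at_right t. (s < v) = True" by eventually_elim auto
    then show ?thesis by blast
  next
    case False
    have "\<forall>\<^sub>F s in at_right t. s \<in> {t<..<t+1}" by (rule eventually_at_right_real) simp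
    then have "\<forall>\<^sub>F s in at_right t. (s < v) = False" by eventually_elim (use False in auto)
    then show ?thesis by blast
  qed
  show "\<exists>c. \<forall>\<^sub>F s in at_left t. (s < v) = c"
  proof (cases "v < t")
    case True
    have "\<forall>\<^sub>F s in at_left t. s \<in> {v<..<t}" by (rule eventually_at_left_real[OF True])
    then have "\<forall>\<^sub>F s in at_left t. (s < v) = False" by eventually_elim auto
    then show ?thesis by blast
  next
    case False
    have "\<forall>\<^sub>F s in at_left t. s \<in> {t-1<..<t}" by (rule eventually_at_left_real) simp
    then have "\<forall>\<^sub>F s in at_left t. (s < v) = True" by eventually_elim (use False in auto)
    then show ?thesis by blast
  qed
qed

lemma eventually_at_not_in_finite:
  fixes t :: real
  assumes "finite S"
  shows "\<forall>\<^sub>F s in at t within T. s \<notin> S"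
proof -
  have "open (- (S - {t}))" using assms by (intro open_Compl finite_imp_closed) auto
  then have "\<forall>\<^sub>F s in at t within T. s \<in> - (S - {t}) \<and> s \<noteq> t"
    unfolding eventually_at_topological by (intro exI[of _ "- (S - {t})"]) auto
  then show ?thesis by eventually_elim auto
qed

lemma steplike_change_finite:
  assumes "finite S" "\<And>s. s \<notin> S \<Longrightarrow> v' s = v s" "steplike J v"
  shows "steplike J v'"
  unfolding steplike_def
proof (intro ballI conjI)
  fix t assume t: "t \<in> J"
  obtain c where "\<forall>\<^sub>F s in at_right t. v s = c" using assms t unfolding steplike_def by blast
  with eventually_at_not_in_finite[OF assms(1)] have "\<forall>\<^sub>F s in at_right t. v' s = c"
    by eventually_elim (use assms(2) in auto)
  then show "\<exists>c. \<forall>\<^sub>F s in at_right t. v' s = c" by blast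
  obtain c where "\<forall>\<^sub>F s in at_left t. v s = c" using assms t unfolding steplike_def by blast
  with eventually_at_not_in_finite[OF assms(1)] have "\<forall>\<^sub>F s in at_left t. v' s = c"
    by eventually_elim (use assms(2) in auto)
  then show "\<exists>c. \<forall>\<^sub>F s in at_left t. v' s = c" by blast
qed

lemma steplike_sum:
  assumes "finite P" "\<And>i. i \<in> P \<Longrightarrow> steplike J (v i)"
  shows "steplike J (\<lambda>s. \<Sum>i\<in>P. v i s)"
  using assms
proof (induction P)
  case (insert i P)
  then show ?case using steplike_comp2[of J "v i" "\<lambda>s. \<Sum>i\<in>P. v i s" "(+)"] by simp
qed (simp add: steplike_const)

text \<open>
  Bisection: primitives on adjacent intervals are joined after shifting the right one by a constant,
  and near any point a step function takes one value to the left and one to the right, so that a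
  primitive with a single kink can be written down. Carrying the Lipschitz estimate along
  gives the mean value inequality for the primitive at the same time.
\<close>
lemma steplike_primitive:
  fixes v :: "real \<Rightarrow> 'b::real_normed_vector"
  assumes "a \<le> b" and step: "steplike {a..b} v" and bnd: "\<And>t. t \<in> {a..b} \<Longrightarrow> norm (v t) \<le> \<rho>"
  shows "\<exists>e S. finite S \<and> (\<forall>t\<in>{a<..<b} - S. (e has_vector_derivative v t) (at t)) \<and>
           (\<forall>s\<in>{a..b}. \<forall>t\<in>{a..b}. norm (e s - e t) \<le> \<rho> * \<bar>s - t\<bar>)"
proof -
  define Q where "Q u w e S \<longleftrightarrow> finite S \<and> (\<forall>t\<in>{u<..<w} - S. (e has_vector_derivative v t) (at t)) \<and>
           (\<forall>s\<in>{u..w}. \<forall>t\<in>{u..w}. s \<le> t \<longrightarrow> norm (e s - e t) \<le> \<rho> * (t - s))"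
    for u w and e :: "real \<Rightarrow> 'b" and S
  have \<rho>: "\<rho> \<ge> 0" using order_trans[OF norm_ge_zero bnd[of a]] assms(1) by auto
  have "a \<le> a \<and> b \<le> b \<longrightarrow> (\<exists>e S. Q a b e S)"
  proof (rule Bolzano[OF assms(1), of "\<lambda>u w. a \<le> u \<and> w \<le> b \<longrightarrow> (\<exists>e S. Q u w e S)"])
    fix u m w
    assume trans: "a \<le> u \<and> m \<le> b \<longrightarrow> (\<exists>e S. Q u m e S)" "a \<le> m \<and> w \<le> b \<longrightarrow> (\<exists>e S. Q m w e S)"
      "u \<le> m" "m \<le> w"
    show "a \<le> u \<and> w \<le> b \<longrightarrow> (\<exists>e S. Q u w e S)"
    proof
      assume "a \<le> u \<and> w \<le> b"
      then obtain e1 S1 e2 S2 where e1: "Q u m e1 S1" and e2: "Q m w e2 S2" using trans by force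
      define e where "e s = (if s \<le> m then e1 s else e2 s - e2 m + e1 m)" for s
      have "Q u w e (insert m (S1 \<union> S2))"
        unfolding Q_def
      proof (intro conjI ballI impI)
        show "finite (insert m (S1 \<union> S2))" using e1 e2 unfolding Q_def by auto
        fix t assume t: "t \<in> {u<..<w} - insert m (S1 \<union> S2)"
        show "(e has_vector_derivative v t) (at t)"
        proof (cases "t < m")
          case True
          have "(e1 has_vector_derivative v t) (at t)" using e1 t True unfolding Q_def by auto
          then show ?thesis
            by (rule has_vector_derivative_transform_within_open[of _ _ _ "{..<m}"])
               (use True in \<open>auto simp: e_def\<close>)
        next
          case False
          have "((\<lambda>s. e2 s - e2 m + e1 m) has_vector_derivative v t) (at t)"
            using e2 t False unfolding Q_def by (auto intro!: derivative_eq_intros)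
          then show ?thesis
            by (rule has_vector_derivative_transform_within_open[of _ _ _ "{m<..}"])
               (use False t in \<open>auto simp: e_def\<close>)
        qed
      next
        fix s t assume st: "s \<in> {u..w}" "t \<in> {u..w}" "s \<le> t"
        consider "t \<le> m" | "m < s" | "s \<le> m" "m < t" by linarith
        then show "norm (e s - e t) \<le> \<rho> * (t - s)"
        proof cases
          case 1 then show ?thesis using e1 st unfolding Q_def e_def by auto
        next
          case 2 then show ?thesis using e2 st unfolding Q_def e_def by auto
        next
          case 3
          have "norm (e1 s - e1 m) \<le> \<rho> * (m - s)" "norm (e2 m - e2 t) \<le> \<rho> * (t - m)"
            using e1 e2 st 3 trans unfolding Q_def by auto
          then have "norm ((e1 s - e1 m) + (e2 m - e2 t)) \<le> \<rho> * (m - s) + \<rho> * (t - m)"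
            by (rule norm_triangle_mono)
          also have "\<dots> = \<rho> * (t - s)" by (simp add: algebra_simps)
          finally show ?thesis using 3 by (simp add: e_def algebra_simps)
        qed
      qed
      then show "\<exists>e S. Q u w e S" by blast
    qed
  next
    fix x assume local: "a \<le> x" "x \<le> b"
    then obtain c d where c: "\<forall>\<^sub>F s in at_right x. v s = c" and d: "\<forall>\<^sub>F s in at_left x. v s = d"
      using step unfolding steplike_def by fastforce
    obtain p where p: "p > x" "\<And>s. x < s \<Longrightarrow> s < p \<Longrightarrow> v s = c"
      using c unfolding eventually_at_right_field by blast
    obtain q where q: "q < x" "\<And>s. q < s \<Longrightarrow> s < x \<Longrightarrow> v s = d"
      using d unfolding eventually_at_left_field by blast
    have "\<exists>e S. Q u w e S" if u: "u \<le> x" "x \<le> w" "w - u < min (p - x) (x - q)" "a \<le> u" "w \<le> b" for u w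
    proof -
      \<comment> \<open>if \<open>x\<close> is an end point of \<open>[u, w]\<close>, the bound \<open>\<rho>\<close> may fail for the value on the outer side\<close>
      define D where "D = (if u < x then d else 0)"
      define C where "C = (if x < w then c else 0)"
      have "norm D \<le> \<rho>"
      proof (cases "u < x")
        case True
        have "v ((u + x) / 2) = d" by (rule q(2)) (use u True in auto)
        then show ?thesis using bnd[of "(u+x)/2"] u local True by (auto simp: D_def)
      qed (use \<rho> in \<open>simp add: D_def\<close>)
      have "norm C \<le> \<rho>"
      proof (cases "x < w")
        case True
        have "v ((w + x) / 2) = c" by (rule p(2)) (use u True in auto)
        then show ?thesis using bnd[of "(w+x)/2"] u local True by (auto simp: C_def)
      qed (use \<rho> in \<open>simp add: C_def\<close>)
      define e where "e s = (if s \<le> x then (s - x) *\<^sub>R D else (s - x) *\<^sub>R C)" for s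
      have sc: "norm (r *\<^sub>R D) \<le> \<rho> * r" "norm (r *\<^sub>R C) \<le> \<rho> * r" if "r \<ge> 0" for r
        using \<open>norm D \<le> \<rho>\<close> \<open>norm C \<le> \<rho>\<close> that by (auto simp: mult.commute[of \<rho>] mult_left_mono)
      have "Q u w e {x}"
        unfolding Q_def
      proof (intro conjI ballI impI)
        fix t assume t: "t \<in> {u<..<w} - {x}"
        show "(e has_vector_derivative v t) (at t)"
        proof (cases "t < x")
          case True
          have "v t = D" using q(2)[of t] t True u by (auto simp: D_def)
          then have "((\<lambda>s. (s - x) *\<^sub>R D) has_vector_derivative v t) (at t)"
            by (auto intro!: derivative_eq_intros)
          then show ?thesis
            by (rule has_vector_derivative_transform_within_open[of _ _ _ "{..<x}"])
               (use True in \<open>auto simp: e_def\<close>)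
        next
          case False
          have "v t = C" using p(2)[of t] t False u by (auto simp: C_def)
          then have "((\<lambda>s. (s - x) *\<^sub>R C) has_vector_derivative v t) (at t)"
            by (auto intro!: derivative_eq_intros)
          then show ?thesis
            by (rule has_vector_derivative_transform_within_open[of _ _ _ "{x<..}"])
               (use False t in \<open>auto simp: e_def\<close>)
        qed
      next
        fix s t assume st: "s \<in> {u..w}" "t \<in> {u..w}" "s \<le> t"
        consider "t \<le> x" | "x < s" | "s \<le> x" "x < t" by linarith
        then show "norm (e s - e t) \<le> \<rho> * (t - s)"
        proof cases
          case 1
          then have "e s - e t = - ((t - s) *\<^sub>R D)" using st by (simp add: e_def algebra_simps)
          then show ?thesis using sc(1)[of "t - s"] st by simp
        next
          case 2
          then have "e s - e t = - ((t - s) *\<^sub>R C)" using st by (simp add: e_def algebra_simps)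
          then show ?thesis using sc(2)[of "t - s"] st by simp
        next
          case 3
          then have "e s - e t = - ((x - s) *\<^sub>R D + (t - x) *\<^sub>R C)" by (simp add: e_def algebra_simps)
          then have "norm (e s - e t) \<le> \<rho> * (x - s) + \<rho> * (t - x)"
            using norm_triangle_mono[OF sc(1)[of "x - s"] sc(2)[of "t - x"]] 3 by (simp only: norm_minus_cancel)
          then show ?thesis by (simp add: algebra_simps)
        qed
      qed simp
      then show ?thesis by blast
    qed
    then show "\<exists>d>0. \<forall>u w. u \<le> x \<and> x \<le> w \<and> w - u < d \<longrightarrow> a \<le> u \<and> w \<le> b \<longrightarrow> (\<exists>e S. Q u w e S)"
      using p(1) q(1) by (intro exI[of _ "min (p - x) (x - q)"]) auto
  qed
  then obtain e S where e: "Q a b e S" by blast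
  have "norm (e s - e t) \<le> \<rho> * \<bar>s - t\<bar>" if "s \<in> {a..b}" "t \<in> {a..b}" for s t
  proof (cases "s \<le> t")
    case True then show ?thesis using e that unfolding Q_def by (metis abs_minus_commute abs_of_nonneg diff_ge_0_iff_ge)
  next
    case False
    then have "norm (e t - e s) \<le> \<rho> * (s - t)" using e that unfolding Q_def by auto
    then show ?thesis using False by (simp add: norm_minus_commute)
  qed
  then show ?thesis using e unfolding Q_def by blast
qed

section \<open>Absolutely continuous curves and polygons\<close>

text \<open>
  The gauge behind the fundamental theorem of calculus for absolutely continuous functions. At tags
  outside the null set \<open>E\<close> it enforces the linear approximation of \<open>y\<close>. At tags in \<open>E\<close> it keeps the
  intervals inside an open set of measure less than \<open>\<delta>\<close> that contains \<open>E\<close>. The last conclusion turns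
  sums over the tagged intervals with tags in \<open>E\<close> into sums over the division which they form, the form in
  which absolute continuity is stated.
\<close>
lemma fine_division_off_null_set:
  fixes y g :: "real \<Rightarrow> 'b::real_normed_vector"
  assumes null: "E \<in> null_sets lebesgue"
    and der: "\<And>t. t \<in> {a..b} - E \<Longrightarrow> (y has_vector_derivative g t) (at t within {a..b})"
    and "\<epsilon> > 0" "\<delta> > 0"
  obtains p where "p tagged_division_of {a..b}"
    "\<forall>t K. (t, K) \<in> p \<longrightarrow> K \<subseteq> ball t \<epsilon>"
    "\<forall>t K s. (t, K) \<in> p \<longrightarrow> t \<notin> E \<longrightarrow> s \<in> K \<longrightarrow> norm (y s - y t - (s - t) *\<^sub>R g t) \<le> \<epsilon> * \<bar>s - t\<bar>"
    "(snd ` {i\<in>p. fst i \<in> E}) division_of \<Union>(snd ` {i\<in>p. fst i \<in> E})"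
    "(\<Sum>k\<in>snd ` {i\<in>p. fst i \<in> E}. Sup k - Inf k) < \<delta>"
    "\<forall>f. (\<forall>u. f {u..u} = 0) \<longrightarrow> (\<Sum>(t,K)\<in>{i\<in>p. fst i \<in> E}. f K) = (\<Sum>k\<in>snd ` {i\<in>p. fst i \<in> E}. (f k :: real))"
proof -
  have "E \<in> sets lebesgue" using null by auto
  then obtain U where U: "open U" "E \<subseteq> U" "U - E \<in> lmeasurable" "emeasure lebesgue (U - E) < ennreal \<delta>"
    using sets_lebesgue_outer_open[OF _ \<open>\<delta> > 0\<close>] by metis
  have emU: "emeasure lebesgue U < ennreal \<delta>"
    using emeasure_Diff_null_set[OF null, of U] U(1,4) by (simp add: borel_open)
  have Um: "U \<in> lmeasurable" using U(1) emU by (intro fmeasurableI) (auto intro: borel_open order_less_le_trans)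
  have mU: "measure lebesgue U < \<delta>"
    using emU emeasure_eq_measure2[OF Um] \<open>\<delta> > 0\<close> by (simp add: ennreal_less_iff)
  have "\<exists>r>0. \<forall>s\<in>{a..b}. \<bar>s - t\<bar> < r \<longrightarrow> norm (y s - y t - (s - t) *\<^sub>R g t) \<le> \<epsilon> * \<bar>s - t\<bar>"
    if "t \<in> {a..b} - E" for t
    using der[OF that] \<open>\<epsilon> > 0\<close> unfolding has_vector_derivative_def has_derivative_within_alt by (simp only: real_norm_def)
  then obtain r where r: "\<And>t. t \<in> {a..b} - E \<Longrightarrow> r t > 0"
    "\<And>t s. t \<in> {a..b} - E \<Longrightarrow> s \<in> {a..b} \<Longrightarrow> \<bar>s - t\<bar> < r t \<Longrightarrow> norm (y s - y t - (s - t) *\<^sub>R g t) \<le> \<epsilon> * \<bar>s - t\<bar>"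
    by metis
  define \<gamma> where "\<gamma> t = (if t \<in> E then U \<inter> ball t \<epsilon> else if t \<in> {a..b} then ball t (min \<epsilon> (r t)) else ball t \<epsilon>)" for t
  have "gauge \<gamma>" unfolding gauge_def \<gamma>_def using U(1,2) r(1) \<open>\<epsilon> > 0\<close> by auto
  then obtain p where p: "p tagged_division_of {a..b}" "\<gamma> fine p"
    by (rule fine_division_exists_real)
  let ?q = "{i\<in>p. fst i \<in> E}"
  have K: "t \<in> K" "K \<subseteq> {a..b}" "\<exists>u v. K = {u..v}" "K \<subseteq> \<gamma> t" if "(t, K) \<in> p" for t K
  proof -
    show "t \<in> K" "K \<subseteq> {a..b}" by (rule tagged_division_ofD(2,3)[OF p(1) that])+
    show "\<exists>u v. K = {u..v}" using tagged_division_ofD(4)[OF p(1) that] by (metis cbox_interval)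
    show "K \<subseteq> \<gamma> t" by (rule fineD[OF p(2) that])
  qed
  have "?q tagged_partial_division_of {a..b}"
  proof (rule tagged_partial_division_subset)
    show "p tagged_partial_division_of {a..b}" using p(1) unfolding tagged_division_of_def by blast
  qed blast
  then have q: "?q tagged_division_of \<Union>(snd ` ?q)"
    by (rule tagged_partial_division_of_Union_self)
  then have D: "(snd ` ?q) division_of \<Union>(snd ` ?q)" by (rule division_of_tagged_division)
  have "(\<Sum>k\<in>snd ` ?q. Sup k - Inf k) = (\<Sum>k\<in>snd ` ?q. measure lebesgue k)"
  proof (rule sum.cong[OF refl])
    fix k assume k: "k \<in> snd ` ?q"
    then obtain t where t: "(t, k) \<in> p" by auto
    obtain u v where uv: "k = {u..v}" using K(3)[OF t] by blast
    then show "Sup k - Inf k = measure lebesgue k" using K(1)[OF t] by auto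
  qed
  also have "\<dots> = measure lebesgue (\<Union>(snd ` ?q))" using content_division[OF D] by simp
  also have "\<dots> \<le> measure lebesgue U"
  proof (rule measure_mono_fmeasurable)
    show "\<Union>(snd ` ?q) \<subseteq> U" using K(4) unfolding \<gamma>_def by fastforce
    show "\<Union>(snd ` ?q) \<in> sets lebesgue" using D lmeasurable_division by (blast intro: fmeasurableD)
  qed (rule Um)
  finally have small: "(\<Sum>k\<in>snd ` ?q. Sup k - Inf k) < \<delta>" using mU by simp
  have sums: "(\<Sum>(t,K)\<in>?q. f K) = (\<Sum>k\<in>snd ` ?q. f k)" if f: "\<forall>u. f {u..u} = 0"
    for f :: "real set \<Rightarrow> real"
  proof -
    let ?f = "\<lambda>K. if K = {} then 0 else f K"
    have ne: "K' \<noteq> {}" if "(t, K') \<in> p" for t K' using K(1)[OF that] by blast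
    have "(\<Sum>(t,K)\<in>?q. ?f K) = (\<Sum>k\<in>snd ` ?q. ?f k)"
    proof (rule sum.over_tagged_division_lemma[OF q])
      fix u v :: real assume uv: "box u v = {}"
      show "?f (cbox u v) = 0"
      proof (cases "u = v")
        case True then show ?thesis using f by (simp add: cbox_interval)
      next
        case False then show ?thesis using uv by (simp add: box_real)
      qed
    qed
    moreover have "(\<Sum>(t,K)\<in>?q. ?f K) = (\<Sum>(t,K)\<in>?q. f K)" using ne by (intro sum.cong) auto
    moreover have "(\<Sum>k\<in>snd ` ?q. ?f k) = (\<Sum>k\<in>snd ` ?q. f k)" using ne by (intro sum.cong) auto
    ultimately show ?thesis by simp
  qed
  have fine: "K' \<subseteq> ball t \<epsilon>" if "(t, K') \<in> p" for t K'
    using K(4)[OF that] by (auto simp: \<gamma>_def split: if_splits)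
  have good: "norm (y s - y t - (s - t) *\<^sub>R g t) \<le> \<epsilon> * \<bar>s - t\<bar>"
    if "(t, K') \<in> p" "t \<notin> E" "s \<in> K'" for t K' s
  proof (rule r(2))
    show "t \<in> {a..b} - E" "s \<in> {a..b}" using K(1,2)[OF that(1)] that by auto
    then have "s \<in> ball t (min \<epsilon> (r t))" using K(4)[OF that(1)] that by (auto simp: \<gamma>_def)
    then show "\<bar>s - t\<bar> < r t" by (simp add: dist_real_def abs_minus_commute)
  qed
  show ?thesis by (rule that[OF p(1) _ _ D small]) (use fine good sums in blast)+
qed

text \<open>
  In a fine division, the intervals with tags outside \<open>E\<close> contribute at most \<open>M\<close> times their length, up to
  a small error, and those with tags in \<open>E\<close> contribute little by absolute continuity.
\<close>
lemma AC_increment_le_derivative_bound: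
  fixes y g :: "real \<Rightarrow> 'b::real_normed_vector"
  assumes "a \<le> b" and AC: "abs_continuous_on_interval a b y"
    and null: "E \<in> null_sets lebesgue"
    and der: "\<And>t. t \<in> {a..b} - E \<Longrightarrow> (y has_vector_derivative g t) (at t within {a..b})"
    and M: "\<And>t. t \<in> {a..b} - E \<Longrightarrow> norm (g t) \<le> M" "M \<ge> 0"
  shows "norm (y b - y a) \<le> M * (b - a)"
proof (rule field_le_epsilon)
  fix e :: real assume "e > 0"
  obtain \<delta> where \<delta>: "\<delta> > 0" "\<And>\<D> S. \<D> division_of S \<Longrightarrow> S \<subseteq> {a..b} \<Longrightarrow> (\<Sum>k\<in>\<D>. Sup k - Inf k) < \<delta>
      \<Longrightarrow> (\<Sum>k\<in>\<D>. norm (y (Sup k) - y (Inf k))) < e / 2"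
    using AC \<open>e > 0\<close> unfolding abs_continuous_on_interval_def by (meson half_gt_zero)
  define \<epsilon> where "\<epsilon> = e / (2 * (b - a + 1))"
  have \<epsilon>: "\<epsilon> > 0" "\<epsilon> * (b - a) \<le> e / 2"
    using \<open>e > 0\<close> \<open>a \<le> b\<close> by (auto simp: \<epsilon>_def field_simps)
  obtain p where p: "p tagged_division_of {a..b}"
    and fine: "\<forall>t K. (t, K) \<in> p \<longrightarrow> K \<subseteq> ball t \<epsilon>"
    and good: "\<forall>t K s. (t, K) \<in> p \<longrightarrow> t \<notin> E \<longrightarrow> s \<in> K \<longrightarrow> norm (y s - y t - (s - t) *\<^sub>R g t) \<le> \<epsilon> * \<bar>s - t\<bar>"
    and D: "(snd ` {i\<in>p. fst i \<in> E}) division_of \<Union>(snd ` {i\<in>p. fst i \<in> E})"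
    and small: "(\<Sum>k\<in>snd ` {i\<in>p. fst i \<in> E}. Sup k - Inf k) < \<delta>"
    and sums: "\<forall>f. (\<forall>u. f {u..u} = 0) \<longrightarrow> (\<Sum>(t,K)\<in>{i\<in>p. fst i \<in> E}. f K) = (\<Sum>k\<in>snd ` {i\<in>p. fst i \<in> E}. (f k :: real))"
    by (rule fine_division_off_null_set[OF null der \<epsilon>(1) \<delta>(1)])
  let ?q = "{i\<in>p. fst i \<in> E}"
  have fin: "finite p" using p by blast
  have K: "t \<in> K" "K \<subseteq> {a..b}" "\<exists>u v. K = {u..v}" if "(t, K) \<in> p" for t K
    using tagged_division_ofD(2,3)[OF p that] tagged_division_ofD(4)[OF p that]
    by (auto simp: cbox_interval simp del: atLeastatMost_subset_iff)
  have bad: "norm (\<Sum>(t,K)\<in>?q. y (Sup K) - y (Inf K)) \<le> e / 2"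
  proof -
    have "norm (\<Sum>(t,K)\<in>?q. y (Sup K) - y (Inf K)) \<le> (\<Sum>(t,K)\<in>?q. norm (y (Sup K) - y (Inf K)))"
      by (rule sum_norm_le) auto
    also have "\<dots> = (\<Sum>k\<in>snd ` ?q. norm (y (Sup k) - y (Inf k)))" by (rule sums[rule_format]) simp
    also have "\<dots> < e / 2" by (rule \<delta>(2)[OF D _ small]) (use K(2) in fastforce)
    finally show ?thesis by simp
  qed
  have "norm (\<Sum>(t,K)\<in>p - ?q. y (Sup K) - y (Inf K)) \<le> (\<Sum>(t,K)\<in>p - ?q. (M + \<epsilon>) * (Sup K - Inf K))"
  proof (rule sum_norm_le)
    fix i assume "i \<in> p - ?q"
    then obtain t K where i: "i = (t, K)" and tK: "(t, K) \<in> p" and tE: "t \<notin> E" by (cases i) auto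
    obtain u v where uv: "K = {u..v}" using K(3)[OF tK] by blast
    have t: "u \<le> t" "t \<le> v" "t \<in> {a..b} - E" using K(1,2)[OF tK] uv tE by auto
    have 1: "norm (y v - y t - (v - t) *\<^sub>R g t) \<le> \<epsilon> * (v - t)"
      "norm (y u - y t - (u - t) *\<^sub>R g t) \<le> \<epsilon> * (t - u)"
      using good[rule_format, OF tK tE, of v] good[rule_format, OF tK tE, of u] t uv by auto
    have 2: "norm ((v - u) *\<^sub>R g t) \<le> M * (v - u)"
      using M(1)[OF t(3)] t by (simp add: mult.commute[of M] mult_left_mono)
    have "y v - y u = (y v - y t - (v - t) *\<^sub>R g t) - (y u - y t - (u - t) *\<^sub>R g t) + (v - u) *\<^sub>R g t"
      by (simp add: algebra_simps)
    then have "norm (y v - y u) \<le> (\<epsilon> * (v - t) + \<epsilon> * (t - u)) + M * (v - u)"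
      using norm_triangle_mono[OF order_trans[OF norm_triangle_ineq4 add_mono[OF 1]] 2] by (simp only:)
    then show "norm (case i of (t, K) \<Rightarrow> y (Sup K) - y (Inf K))
        \<le> (case i of (t, K) \<Rightarrow> (M + \<epsilon>) * (Sup K - Inf K))"
      using uv t i by (simp add: algebra_simps)
  qed
  also have "\<dots> \<le> (\<Sum>(t,K)\<in>p. (M + \<epsilon>) * (Sup K - Inf K))"
  proof (rule sum_mono2[OF fin])
    fix i assume "i \<in> p - (p - ?q)"
    then obtain t K where i: "i = (t, K)" "(t, K) \<in> p" by (cases i) auto
    obtain u v where "K = {u..v}" using K(3)[OF i(2)] by blast
    then show "0 \<le> (case i of (t, K) \<Rightarrow> (M + \<epsilon>) * (Sup K - Inf K))"
      using i K(1)[OF i(2)] M(2) \<epsilon>(1) by auto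
  qed auto
  also have "\<dots> = (M + \<epsilon>) * (\<Sum>(t,K)\<in>p. Sup K - Inf K)"
    by (simp add: sum_distrib_left case_prod_beta)
  also have "(\<Sum>(t,K)\<in>p. Sup K - Inf K) = b - a"
    using additive_tagged_division_1[OF \<open>a \<le> b\<close> p, of "\<lambda>x. x"] by simp
  finally have gd: "norm (\<Sum>(t,K)\<in>p - ?q. y (Sup K) - y (Inf K)) \<le> M * (b - a) + e / 2"
    using \<epsilon>(2) by (simp add: algebra_simps)
  have "y b - y a = (\<Sum>(t,K)\<in>p. y (Sup K) - y (Inf K))"
    using additive_tagged_division_1[OF \<open>a \<le> b\<close> p, of y] by simp
  also have "\<dots> = (\<Sum>(t,K)\<in>p - ?q. y (Sup K) - y (Inf K)) + (\<Sum>(t,K)\<in>?q. y (Sup K) - y (Inf K))"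
    by (rule sum.subset_diff[OF _ fin]) auto
  finally show "norm (y b - y a) \<le> M * (b - a) + e"
    using norm_triangle_mono[OF gd bad] by simp
qed

text \<open>
  The polygon \<open>z\<close> runs through each interval of a fine division with the velocity of \<open>y\<close> at the tag. Its
  velocity therefore takes only values \<open>g t\<close> at nearby times. Comparing increments interval by interval,
  the error at tags outside \<open>E\<close> is linear approximation error, and the intervals with tags in \<open>E\<close>
  have small total length, which suffices since \<open>y\<close> and \<open>z\<close> have bounded speed. Writing \<open>z\<close> as a
  sum over the tagged division, with each interval cut off at the current time, avoids
  ordering the intervals.
\<close>
lemma polygonal_approximation:
  fixes y g :: "real \<Rightarrow> 'b::real_normed_vector"
  assumes "a \<le> b"
    and null: "E \<in> null_sets lebesgue"
    and der: "\<And>t. t \<in> {a..b} - E \<Longrightarrow> (y has_vector_derivative g t) (at t within {a..b})"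
    and lip: "\<And>s t. s \<in> {a..b} \<Longrightarrow> t \<in> {a..b} \<Longrightarrow> norm (y s - y t) \<le> M * \<bar>s - t\<bar>"
    and M: "\<And>t. t \<in> {a..b} \<Longrightarrow> norm (g t) \<le> M"
    and "\<eta> > 0"
  obtains z w S where "finite S" "steplike {a..b} w" "\<exists>C. C-lipschitz_on {a..b} z"
    "\<forall>t\<in>{a<..<b} - S. (z has_vector_derivative w t) (at t)"
    "\<forall>s\<in>{a..b}. norm (z s - y s) \<le> \<eta>"
    "\<forall>s\<in>{a..b}. \<exists>t\<in>{a..b}. w s = g t \<and> \<bar>s - t\<bar> \<le> \<eta>"
proof -
  have M0: "M \<ge> 0" using order_trans[OF norm_ge_zero M[of a]] assms(1) by auto
  define \<epsilon> where "\<epsilon> = min \<eta> (\<eta> / (4 * (b - a + 1)))"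
  have \<epsilon>: "\<epsilon> > 0" "\<epsilon> \<le> \<eta>" using \<open>\<eta> > 0\<close> \<open>a \<le> b\<close> by (auto simp: \<epsilon>_def)
  have "2 * \<epsilon> * (b - a) \<le> 2 * (\<eta> / (4 * (b - a + 1))) * (b - a)"
    using \<open>a \<le> b\<close> by (intro mult_right_mono mult_left_mono) (auto simp: \<epsilon>_def)
  also have "\<dots> \<le> \<eta> / 2" using \<open>\<eta> > 0\<close> \<open>a \<le> b\<close> by (simp add: field_simps)
  finally have \<epsilon>2: "2 * \<epsilon> * (b - a) \<le> \<eta> / 2" .
  define \<delta> where "\<delta> = \<eta> / (4 * (M + 1))"
  have \<delta>: "\<delta> > 0" "2 * M * \<delta> \<le> \<eta> / 2" using \<open>\<eta> > 0\<close> M0 by (auto simp: \<delta>_def field_simps)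
  obtain p where p: "p tagged_division_of {a..b}"
    and fine: "\<forall>t K. (t, K) \<in> p \<longrightarrow> K \<subseteq> ball t \<epsilon>"
    and good: "\<forall>t K s. (t, K) \<in> p \<longrightarrow> t \<notin> E \<longrightarrow> s \<in> K \<longrightarrow> norm (y s - y t - (s - t) *\<^sub>R g t) \<le> \<epsilon> * \<bar>s - t\<bar>"
    and D: "(snd ` {i\<in>p. fst i \<in> E}) division_of \<Union>(snd ` {i\<in>p. fst i \<in> E})"
    and small: "(\<Sum>k\<in>snd ` {i\<in>p. fst i \<in> E}. Sup k - Inf k) < \<delta>"
    and sums: "\<forall>f. (\<forall>u. f {u..u} = 0) \<longrightarrow> (\<Sum>(t,K)\<in>{i\<in>p. fst i \<in> E}. f K) = (\<Sum>k\<in>snd ` {i\<in>p. fst i \<in> E}. (f k :: real))"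
    by (rule fine_division_off_null_set[OF null der \<epsilon>(1) \<delta>(1)])
  let ?q = "{i\<in>p. fst i \<in> E}"
  have fin: "finite p" using p by blast
  have K: "t \<in> K" "K \<subseteq> {a..b}" "K = {Inf K..Sup K}" "Inf K \<le> t" "t \<le> Sup K" "a \<le> Inf K" "Sup K \<le> b" if "(t, K) \<in> p" for t K
  proof -
    show 1: "t \<in> K" "K \<subseteq> {a..b}" by (rule tagged_division_ofD(2,3)[OF p that])+
    have "\<exists>u v. K = cbox u v" by (rule tagged_division_ofD(4)[OF p that])
    then obtain u v where uv: "K = {u..v}" by (metis cbox_interval)
    then show "K = {Inf K..Sup K}" "Inf K \<le> t" "t \<le> Sup K" "a \<le> Inf K" "Sup K \<le> b" using 1 by auto
  qed
  define S where "S = (\<lambda>i. Inf (snd i)) ` p \<union> (\<lambda>i. Sup (snd i)) ` p"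
  define w0 where "w0 s = (\<Sum>i\<in>p. (if Inf (snd i) < s \<and> s < Sup (snd i) then g (fst i) else 0))" for s
  \<comment> \<open>at the division points \<open>w0\<close> vanishes, which need not be an admissible velocity\<close>
  define w where "w s = (if s \<in> S then g s else w0 s)" for s
  define z where "z s = y a + (\<Sum>i\<in>p. (min s (Sup (snd i)) - min s (Inf (snd i))) *\<^sub>R g (fst i))" for s
  have finS: "finite S" using fin unfolding S_def by simp
  have step: "steplike {a..b} w"
  proof (rule steplike_change_finite[OF finS])
    show "w s = w0 s" if "s \<notin> S" for s using that by (simp add: w_def)
    have "steplike {a..b} (\<lambda>s. if Inf (snd i) < s \<and> s < Sup (snd i) then g (fst i) else 0)" for i
    proof -
      have "steplike {a..b} (\<lambda>s. if \<not> s < Inf (snd i) \<and> s < Sup (snd i) then g (fst i) else 0)"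
        by (rule steplike_comp2[OF steplike_less steplike_less, where f = "\<lambda>c d. if \<not> c \<and> d then g (fst i) else 0"])
      then show ?thesis by (rule steplike_change_finite[of "{Inf (snd i)}", rotated 2]) auto
    qed
    then show "steplike {a..b} w0" unfolding w0_def by (intro steplike_sum fin)
  qed
  have contz: "\<exists>C. C-lipschitz_on {a..b} z"
  proof (intro exI lipschitz_onI)
    show "0 \<le> (\<Sum>i\<in>p. 2 * norm (g (fst i)))" by (intro sum_nonneg) auto
    fix s t
    have "z s - z t = (\<Sum>i\<in>p. (min s (Sup (snd i)) - min t (Sup (snd i)) - (min s (Inf (snd i)) - min t (Inf (snd i)))) *\<^sub>R g (fst i))"
      unfolding z_def by (simp add: sum_subtractf[symmetric] algebra_simps)
    also have "norm \<dots> \<le> (\<Sum>i\<in>p. 2 * \<bar>s - t\<bar> * norm (g (fst i)))"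
    proof (rule sum_norm_le)
      fix i assume "i \<in> p"
      have cut: "\<bar>min s c - min t c\<bar> \<le> \<bar>s - t\<bar>" for c :: real
        by (cases "s \<le> c"; cases "t \<le> c"; simp add: min_def)
      have "\<bar>min s (Sup (snd i)) - min t (Sup (snd i)) - (min s (Inf (snd i)) - min t (Inf (snd i)))\<bar> \<le> 2 * \<bar>s - t\<bar>"
        unfolding mult_2 by (rule order_trans[OF abs_triangle_ineq4 add_mono[OF cut cut]])
      then show "norm ((min s (Sup (snd i)) - min t (Sup (snd i)) - (min s (Inf (snd i)) - min t (Inf (snd i)))) *\<^sub>R g (fst i))
        \<le> 2 * \<bar>s - t\<bar> * norm (g (fst i))"
        by (simp add: mult_right_mono)
    qed
    also have "\<dots> = (\<Sum>i\<in>p. 2 * norm (g (fst i))) * \<bar>s - t\<bar>"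
      unfolding sum_distrib_right by (rule sum.cong) auto
    finally show "dist (z s) (z t) \<le> (\<Sum>i\<in>p. 2 * norm (g (fst i))) * dist s t"
      by (simp add: dist_norm)
  qed
  have derz: "(z has_vector_derivative w s) (at s)" if s: "s \<in> {a<..<b} - S" for s
  proof -
    have "((\<lambda>s. (min s (Sup (snd i)) - min s (Inf (snd i))) *\<^sub>R g (fst i)) has_vector_derivative
        (if Inf (snd i) < s \<and> s < Sup (snd i) then g (fst i) else 0)) (at s)" if i: "i \<in> p" for i
    proof -
      define u v c where "u = Inf (snd i)" and "v = Sup (snd i)" and "c = g (fst i)"
      have "u \<noteq> s" "v \<noteq> s" using s i unfolding S_def u_def v_def by auto
      have "u \<le> v" using K(4,5)[of "fst i" "snd i"] i unfolding u_def v_def by force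
      consider "s < u" | "u < s" "s < v" | "v < s" using \<open>u \<noteq> s\<close> \<open>v \<noteq> s\<close> by linarith
      then have "((\<lambda>s. (min s v - min s u) *\<^sub>R c) has_vector_derivative (if u < s \<and> s < v then c else 0)) (at s)"
      proof cases
        case 1
        have "((\<lambda>s. 0) has_vector_derivative (if u < s \<and> s < v then c else 0)) (at s)" using 1 by simp
        then show ?thesis
          by (rule has_vector_derivative_transform_within_open[of _ _ _ "{..<u}"])
             (use 1 \<open>u \<le> v\<close> in auto)
      next
        case 2
        have "((\<lambda>s. (s - u) *\<^sub>R c) has_vector_derivative (if u < s \<and> s < v then c else 0)) (at s)"
          using 2 by (auto intro!: derivative_eq_intros)
        then show ?thesis
          by (rule has_vector_derivative_transform_within_open[of _ _ _ "{u<..<v}"])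
             (use 2 in auto)
      next
        case 3
        have "((\<lambda>s. (v - u) *\<^sub>R c) has_vector_derivative (if u < s \<and> s < v then c else 0)) (at s)"
          using 3 by simp
        then show ?thesis
          by (rule has_vector_derivative_transform_within_open[of _ _ _ "{v<..}"])
             (use 3 \<open>u \<le> v\<close> in auto)
      qed
      then show ?thesis unfolding u_def v_def c_def .
    qed
    then have "((\<lambda>s. y a + (\<Sum>i\<in>p. (min s (Sup (snd i)) - min s (Inf (snd i))) *\<^sub>R g (fst i)))
        has_vector_derivative 0 + w0 s) (at s)" unfolding w0_def
      by (intro has_vector_derivative_add has_vector_derivative_const has_vector_derivative_sum)
    then show ?thesis using s unfolding z_def[abs_def] w_def by simp
  qed
  have wit: "\<exists>t\<in>{a..b}. w s = g t \<and> \<bar>s - t\<bar> \<le> \<eta>" if s: "s \<in> {a..b}" for s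
  proof (cases "s \<in> S")
    case True
    then show ?thesis using s \<open>\<eta> > 0\<close> unfolding w_def by (intro bexI[of _ s]) auto
  next
    case False
    obtain t K' where tK: "(t, K') \<in> p" "s \<in> K'" using s tagged_division_ofD(6)[OF p] by blast
    have "Inf K' \<noteq> s" "Sup K' \<noteq> s" using False tK unfolding S_def by force+
    then have sK: "Inf K' < s" "s < Sup K'" using K(3)[OF tK(1)] tK(2) by (metis atLeastAtMost_iff order_le_less)+
    have "w0 s = g t"
    proof -
      have "(\<Sum>i\<in>p - {(t, K')}. (if Inf (snd i) < s \<and> s < Sup (snd i) then g (fst i) else 0)) = 0"
      proof (rule sum.neutral, intro ballI)
        fix i assume i: "i \<in> p - {(t, K')}"
        obtain t' K'' where i': "i = (t', K'')" by fastforce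
        have "interior K'' \<inter> interior K' = {}"
          using tagged_division_ofD(5)[OF p _ tK(1), of t' K''] i i' by auto
        moreover have "interior K' = {Inf K'<..<Sup K'}" "interior K'' = {Inf K''<..<Sup K''}"
          using K(3)[OF tK(1)] K(3)[of t' K''] i i' interior_atLeastAtMost_real by (metis DiffD1)+
        ultimately show "(if Inf (snd i) < s \<and> s < Sup (snd i) then g (fst i) else 0) = 0"
          using sK i' by auto
      qed
      then show ?thesis unfolding w0_def sum.remove[OF fin tK(1)] using sK by simp
    qed
    moreover have "\<bar>s - t\<bar> \<le> \<eta>" using fine[rule_format, OF tK(1)] tK(2) \<epsilon>(2) by (force simp: dist_real_def abs_minus_commute)
    moreover have "t \<in> {a..b}" using K(1,2)[OF tK(1)] by blast
    ultimately show ?thesis using False unfolding w_def by auto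
  qed
  have close: "norm (z s - y s) \<le> \<eta>" if s: "s \<in> {a..b}" for s
  proof -
    define r where "r i = (y (min s (Sup (snd i))) - y (min s (Inf (snd i))))
        - (min s (Sup (snd i)) - min s (Inf (snd i))) *\<^sub>R g (fst i)" for i
    have "(\<Sum>(t,K)\<in>p. y (min s (Sup K)) - y (min s (Inf K))) = y (min s b) - y (min s a)"
      using additive_tagged_division_1[OF \<open>a \<le> b\<close> p, of "\<lambda>x. y (min s x)"] by simp
    then have "(\<Sum>i\<in>p. y (min s (Sup (snd i))) - y (min s (Inf (snd i)))) = y s - y a"
      using s by (simp add: case_prod_beta min_absorb1 min_absorb2)
    then have ys: "y s - z s = (\<Sum>i\<in>p. r i)" unfolding z_def r_def by (simp add: sum_subtractf)
    have main: "norm (r i) \<le> (if fst i \<in> E then 2 * M else 2 * \<epsilon>) * (Sup (snd i) - Inf (snd i))" if i: "i \<in> p" for i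
    proof -
      obtain t K' where tK: "i = (t, K')" "(t, K') \<in> p" using i by (cases i) auto
      define u v where "u = Inf K'" and "v = Sup K'"
      have uv: "u \<le> t" "t \<le> v" "K' = {u..v}" "a \<le> u" "v \<le> b" using K[OF tK(2)] unfolding u_def v_def by auto
      have r: "r i = (y (min s v) - y (min s u)) - (min s v - min s u) *\<^sub>R g t"
        unfolding r_def u_def v_def tK by simp
      have "norm (r i) \<le> (if t \<in> E then 2 * M else 2 * \<epsilon>) * (v - u)"
      proof (cases "s < u")
        case True
        then have "r i = 0" using uv r by simp
        then show ?thesis using uv M0 \<epsilon>(1) by simp
      next
        case False
        define v' where "v' = min s v"
        have v': "u \<le> v'" "v' \<le> v" using False uv unfolding v'_def by auto
        have r': "r i = (y v' - y u) - (v' - u) *\<^sub>R g t" using r False unfolding v'_def by simp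
        show ?thesis
        proof (cases "t \<in> E")
          case True
          have "norm (y v' - y u) \<le> M * (v' - u)" using lip[of v' u] v' uv by auto
          moreover have "norm ((v' - u) *\<^sub>R g t) \<le> M * (v' - u)"
            using M[of t] uv v' by (simp add: mult.commute[of M] mult_left_mono)
          ultimately have "norm (r i) \<le> M * (v' - u) + M * (v' - u)"
            unfolding r' by (rule order_trans[OF norm_triangle_ineq4 add_mono])
          also have "\<dots> \<le> 2 * M * (v - u)" using v' M0 mult_left_mono[of "v' - u" "v - u" "2 * M"] by simp
          finally show ?thesis using True by simp
        next
          case False
          have 1: "norm (y v' - y t - (v' - t) *\<^sub>R g t) \<le> \<epsilon> * \<bar>v' - t\<bar>"
            "norm (y u - y t - (u - t) *\<^sub>R g t) \<le> \<epsilon> * \<bar>u - t\<bar>"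
            using good[rule_format, OF tK(2) False, of v'] good[rule_format, OF tK(2) False, of u] v' uv by auto
          have "r i = (y v' - y t - (v' - t) *\<^sub>R g t) - (y u - y t - (u - t) *\<^sub>R g t)"
            unfolding r' by (simp add: algebra_simps)
          then have "norm (r i) \<le> \<epsilon> * \<bar>v' - t\<bar> + \<epsilon> * \<bar>u - t\<bar>"
            using order_trans[OF norm_triangle_ineq4 add_mono[OF 1]] by (simp only:)
          also have "\<dots> \<le> \<epsilon> * (v - u) + \<epsilon> * (v - u)"
            using \<epsilon>(1) v' uv by (intro add_mono mult_left_mono) auto
          finally show ?thesis using False by simp
        qed
      qed
      then show ?thesis unfolding u_def v_def tK by simp
    qed
    have len: "Inf (snd i) \<le> Sup (snd i)" if "i \<in> p" for i
      using K(4,5)[of "fst i" "snd i"] that by force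
    have tot: "(\<Sum>i\<in>p. Sup (snd i) - Inf (snd i)) = b - a"
      using additive_tagged_division_1[OF \<open>a \<le> b\<close> p, of "\<lambda>x. x"] by (simp add: case_prod_beta)
    have badsum: "(\<Sum>i\<in>?q. Sup (snd i) - Inf (snd i)) \<le> \<delta>"
      using sums[rule_format, of "\<lambda>K. Sup K - Inf K"] small by (simp add: case_prod_beta)
    have "norm (y s - z s) \<le> (\<Sum>i\<in>p. (if fst i \<in> E then 2 * M else 2 * \<epsilon>) * (Sup (snd i) - Inf (snd i)))"
      unfolding ys by (rule sum_norm_le[OF main])
    also have "\<dots> = (\<Sum>i\<in>p - ?q. (if fst i \<in> E then 2 * M else 2 * \<epsilon>) * (Sup (snd i) - Inf (snd i)))
        + (\<Sum>i\<in>?q. (if fst i \<in> E then 2 * M else 2 * \<epsilon>) * (Sup (snd i) - Inf (snd i)))"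
      by (rule sum.subset_diff[OF _ fin]) auto
    also have "\<dots> = (\<Sum>i\<in>p - ?q. 2 * \<epsilon> * (Sup (snd i) - Inf (snd i)))
        + (\<Sum>i\<in>?q. 2 * M * (Sup (snd i) - Inf (snd i)))"
      by (intro arg_cong2[of _ _ _ _ "(+)"] sum.cong) auto
    also have "\<dots> \<le> (\<Sum>i\<in>p. 2 * \<epsilon> * (Sup (snd i) - Inf (snd i))) + 2 * M * \<delta>"
    proof (rule add_mono)
      show "(\<Sum>i\<in>p - ?q. 2 * \<epsilon> * (Sup (snd i) - Inf (snd i))) \<le> (\<Sum>i\<in>p. 2 * \<epsilon> * (Sup (snd i) - Inf (snd i)))"
        using len \<epsilon>(1) by (intro sum_mono2[OF fin]) auto
      show "(\<Sum>i\<in>?q. 2 * M * (Sup (snd i) - Inf (snd i))) \<le> 2 * M * \<delta>"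
        unfolding sum_distrib_left[symmetric] using badsum M0 by (intro mult_left_mono) auto
    qed
    also have "\<dots> = 2 * \<epsilon> * (b - a) + 2 * M * \<delta>" by (simp add: sum_distrib_left[symmetric] tot)
    also have "\<dots> \<le> \<eta>" using \<epsilon>2 \<delta>(2) by simp
    finally show ?thesis by (simp add: norm_minus_commute)
  qed
  show ?thesis by (rule that[OF finS step contz]) (use derz close wit in blast)+
qed

section \<open>Solutions of the inclusion\<close>

lemma lipschitz_imp_AC:
  fixes x :: "real \<Rightarrow> 'b::real_normed_vector"
  assumes lip: "\<And>s t. s \<in> {a..b} \<Longrightarrow> t \<in> {a..b} \<Longrightarrow> norm (x s - x t) \<le> M * \<bar>s - t\<bar>"
  shows "abs_continuous_on_interval a b x"
  unfolding abs_continuous_on_interval_def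
proof (intro allI impI)
  fix \<epsilon> :: real assume "\<epsilon> > 0"
  show "\<exists>\<delta>>0. \<forall>\<D> S. \<D> division_of S \<and> S \<subseteq> {a..b} \<and> (\<Sum>k\<in>\<D>. Sup k - Inf k) < \<delta>
        \<longrightarrow> (\<Sum>k\<in>\<D>. norm (x (Sup k) - x (Inf k))) < \<epsilon>"
  proof (intro exI conjI allI impI)
    show "\<epsilon> / (\<bar>M\<bar> + 1) > 0" using \<open>\<epsilon> > 0\<close> by simp
    fix \<D> S assume D: "\<D> division_of S \<and> S \<subseteq> {a..b} \<and> (\<Sum>k\<in>\<D>. Sup k - Inf k) < \<epsilon> / (\<bar>M\<bar> + 1)"
    have "norm (x (Sup k) - x (Inf k)) \<le> (\<bar>M\<bar> + 1) * (Sup k - Inf k)" if k: "k \<in> \<D>" for k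
    proof -
      obtain u v where uv: "k = {u..v}" "u \<le> v"
        using division_ofD(3,4)[of \<D> S k] D k by (metis atLeastatMost_empty_iff cbox_interval)
      have "k \<subseteq> {a..b}" using division_ofD(2)[of \<D> S k] D k by blast
      then have "norm (x v - x u) \<le> M * (v - u)" using lip[of v u] uv by auto
      also have "\<dots> \<le> (\<bar>M\<bar> + 1) * (v - u)" using uv by (intro mult_right_mono) auto
      finally show ?thesis using uv by simp
    qed
    then have "(\<Sum>k\<in>\<D>. norm (x (Sup k) - x (Inf k))) \<le> (\<Sum>k\<in>\<D>. (\<bar>M\<bar> + 1) * (Sup k - Inf k))"
      by (rule sum_mono)
    also have "\<dots> = (\<bar>M\<bar> + 1) * (\<Sum>k\<in>\<D>. Sup k - Inf k)" by (simp add: sum_distrib_left)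
    also have "\<dots> < \<epsilon>" using D by (simp add: field_simps)
    finally show "(\<Sum>k\<in>\<D>. norm (x (Sup k) - x (Inf k))) < \<epsilon>" .
  qed
qed

lemma AC_imp_continuous_on:
  fixes x :: "real \<Rightarrow> 'b::real_normed_vector"
  assumes "abs_continuous_on_interval a b x"
  shows "continuous_on {a..b} x"
  unfolding continuous_on_iff
proof (intro ballI allI impI)
  fix t and e :: real assume t: "t \<in> {a..b}" and "e > 0"
  obtain \<delta> where \<delta>: "\<delta> > 0" "\<And>\<D> S. \<D> division_of S \<Longrightarrow> S \<subseteq> {a..b} \<Longrightarrow> (\<Sum>k\<in>\<D>. Sup k - Inf k) < \<delta>
      \<Longrightarrow> (\<Sum>k\<in>\<D>. norm (x (Sup k) - x (Inf k))) < e"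
    using assms \<open>e > 0\<close> unfolding abs_continuous_on_interval_def by meson
  have 1: "norm (x v - x u) < e" if "u \<le> v" "a \<le> u" "v \<le> b" "v - u < \<delta>" for u v
  proof -
    have "{cbox u v} division_of cbox u v" using that by (intro division_of_self) auto
    from \<delta>(2)[OF this] show ?thesis using that by (auto simp: cbox_interval)
  qed
  show "\<exists>d>0. \<forall>s\<in>{a..b}. dist s t < d \<longrightarrow> dist (x s) (x t) < e"
  proof (intro exI conjI ballI impI)
    fix s assume s: "s \<in> {a..b}" "dist s t < \<delta>"
    show "dist (x s) (x t) < e"
      using 1[of s t] 1[of t s] s t by (cases "s \<le> t") (auto simp: dist_norm norm_minus_commute)
  qed (rule \<delta>(1))
qed

context lipschitz_inclusion
begin

text \<open>
  Isolates the null set and extends the velocity by arbitrary admissible values, so that \<open>g\<close> obeys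
  the speed bounds of \<open>F\<close> at every time.
\<close>
lemma solution_velocity:
  assumes sol: "solution_on F I x" and "{a..b} \<subseteq> I"
  obtains E g where "E \<in> null_sets lebesgue" "\<And>t. g t \<in> F (x t)"
    "\<And>t. t \<in> {a..b} - E \<Longrightarrow> (x has_vector_derivative g t) (at t within {a..b})"
proof -
  have "AE t in lebesgue. t \<in> I \<longrightarrow> (\<exists>v\<in>F (x t). (x has_vector_derivative v) (at t within I))"
    using sol unfolding solution_on_def by blast
  then obtain E where E: "{t \<in> space lebesgue. \<not> (t \<in> I \<longrightarrow> (\<exists>v\<in>F (x t). (x has_vector_derivative v) (at t within I)))} \<subseteq> E"
      "emeasure lebesgue E = 0" "E \<in> sets lebesgue"
    by (rule AE_E)
  have "\<exists>v\<in>F (x t). t \<in> {a..b} - E \<longrightarrow> (x has_vector_derivative v) (at t within {a..b})" for t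
  proof (cases "t \<in> {a..b} - E")
    case True
    then have "t \<in> I" "t \<notin> E" using assms(2) by auto
    then obtain v where "v \<in> F (x t)" "(x has_vector_derivative v) (at t within I)" using E(1) by fastforce
    then show ?thesis using has_vector_derivative_within_subset[OF _ assms(2)] by blast
  next
    case False
    obtain v where "v \<in> F (x t)" using nonempty by blast
    then show ?thesis using False by blast
  qed
  then obtain g where "\<And>t. g t \<in> F (x t) \<and> (t \<in> {a..b} - E \<longrightarrow> (x has_vector_derivative g t) (at t within {a..b}))"
    by metis
  moreover have "E \<in> null_sets lebesgue" using E(2,3) by (rule null_setsI)
  ultimately show ?thesis using that[of E g] by blast
qed

lemma solution_AC: "solution_on F I x \<Longrightarrow> {a..b} \<subseteq> I \<Longrightarrow> a \<le> b \<Longrightarrow> abs_continuous_on_interval a b x"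
  unfolding solution_on_def by blast

lemma solution_lipschitz:
  assumes sol: "solution_on F I x" and "{a..b} \<subseteq> I"
    and R: "\<And>t. t \<in> {a..b} \<Longrightarrow> norm (x t) \<le> R" and L: "lip_bound R L"
    and st: "s \<in> {a..b}" "t \<in> {a..b}"
  shows "norm (x s - x t) \<le> L * \<bar>s - t\<bar>"
proof -
  have *: "norm (x v - x u) \<le> L * (v - u)" if "u \<le> v" "u \<in> {a..b}" "v \<in> {a..b}" for u v
  proof -
    have sub: "{u..v} \<subseteq> I" using that assms(2) by auto
    obtain E g where g: "E \<in> null_sets lebesgue" "\<And>t. g t \<in> F (x t)"
      "\<And>t. t \<in> {u..v} - E \<Longrightarrow> (x has_vector_derivative g t) (at t within {u..v})"
      using solution_velocity[OF sol sub] by metis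
    show ?thesis
    proof (rule AC_increment_le_derivative_bound[OF that(1) solution_AC[OF sol sub that(1)] g(1,3)])
      fix t assume "t \<in> {u..v} - E"
      then have "norm (x t) \<le> R" using that R by auto
      then show "norm (g t) \<le> L" using L g(2)[of t] unfolding lip_bound_def by blast
    next
      show "0 \<le> L" using L unfolding lip_bound_def by simp
    qed 
  qed
  show ?thesis
    using *[of s t] *[of t s] st by (cases "s \<le> t") (auto simp: norm_minus_commute)
qed

text \<open>
  Up to the first time at which the distance from \<open>\<xi>\<close> reaches \<open>2\<close>, the speed is at most \<open>L\<close>, so the
  distance covered is less than \<open>1\<close>.
\<close>
lemma solution_stays_close:
  assumes sol: "solution_on F I x" and sub: "{a..b} \<subseteq> I"
    and start: "norm (x a - \<xi>) \<le> 1" and L: "lip_bound (norm \<xi> + 3) L" "L * (b - a) < 1"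
    and t: "t \<in> {a..b}"
  shows "norm (x t - \<xi>) \<le> 2"
proof (rule ccontr)
  assume "\<not> ?thesis"
  then have t2: "norm (x t - \<xi>) > 2" by simp
  have cont: "continuous_on {a..b} (\<lambda>s. norm (x s - \<xi>))"
    using AC_imp_continuous_on[OF solution_AC[OF sol sub]] t by (intro continuous_intros) auto
  define Z where "Z = {s\<in>{a..t}. norm (x s - \<xi>) = 2}"
  have "continuous_on {a..t} (\<lambda>s. norm (x s - \<xi>))" using t by (intro continuous_on_subset[OF cont]) auto
  then have "\<exists>s\<ge>a. s \<le> t \<and> norm (x s - \<xi>) = 2" using start t2 t by (intro IVT') auto
  then have "Z \<noteq> {}" unfolding Z_def by auto
  moreover have "compact Z"
  proof -
    have "closed {s \<in> {a..t}. norm (x s - \<xi>) = 2}"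
      by (rule continuous_closed_preimage_constant) (use \<open>continuous_on {a..t} _\<close> in auto)
    moreover have "bounded Z" unfolding Z_def by (rule bounded_subset[of "{a..t}"]) auto
    ultimately show ?thesis unfolding Z_def by (simp add: compact_eq_bounded_closed)
  qed
  ultimately obtain m where m: "m \<in> Z" "\<And>s. s \<in> Z \<Longrightarrow> m \<le> s" using compact_attains_inf by metis
  have m': "a \<le> m" "m \<le> t" "norm (x m - \<xi>) = 2" using m(1) unfolding Z_def by auto
  have before: "norm (x s - \<xi>) \<le> 2" if s: "s \<in> {a..m}" for s
  proof (rule ccontr)
    assume far: "\<not> ?thesis"
    moreover have "continuous_on {a..s} (\<lambda>s. norm (x s - \<xi>))" using t s m' by (intro continuous_on_subset[OF cont]) auto
    ultimately have "\<exists>r\<ge>a. r \<le> s \<and> norm (x r - \<xi>) = 2" using start s by (intro IVT') auto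
    then obtain r where r: "a \<le> r" "r \<le> s" "norm (x r - \<xi>) = 2" by blast
    then have "r \<in> Z" using s m' unfolding Z_def by auto
    then have "m \<le> r" by (rule m(2))
    then have "r = m" "s = m" using r s by auto
    then show False using far m' by simp
  qed
  have "norm (x m - x a) \<le> L * \<bar>m - a\<bar>"
  proof (rule solution_lipschitz[OF sol _ _ L(1)])
    show "{a..m} \<subseteq> I" using sub m' t by auto
    fix s assume "s \<in> {a..m}"
    then show "norm (x s) \<le> norm \<xi> + 3" using before[of s] norm_triangle_sub[of "x s" \<xi>] by simp
  qed (use m' in auto)
  also have "\<dots> \<le> L * (b - a)" using L(1) m' t unfolding lip_bound_def by (intro mult_left_mono) auto
  finally have "norm (x m - x a) < 1" using L(2) by simp
  then have "norm (x m - \<xi>) < 2" using norm_triangle_ineq[of "x m - x a" "x a - \<xi>"] start by simp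
  then show False using m' by simp
qed

lemma locally_lipschitz_solutionI:
  assumes "is_interval I" "I \<subseteq> {0..}"
    and "\<And>a b. a \<le> b \<Longrightarrow> {a..b} \<subseteq> I \<Longrightarrow> \<exists>M. \<forall>s\<in>{a..b}. \<forall>t\<in>{a..b}. norm (x s - x t) \<le> M * \<bar>s - t\<bar>"
    and "negligible N"
    and "\<And>t. t \<in> I - N \<Longrightarrow> \<exists>v\<in>F (x t). (x has_vector_derivative v) (at t within I)"
  shows "solution_on F I x"
  unfolding solution_on_def
proof (intro conjI assms(1,2) allI impI)
  fix a b :: real assume "a \<le> b \<and> {a..b} \<subseteq> I"
  then obtain M where "\<forall>s\<in>{a..b}. \<forall>t\<in>{a..b}. norm (x s - x t) \<le> M * \<bar>s - t\<bar>" using assms(3) by blast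
  then show "abs_continuous_on_interval a b x" by (intro lipschitz_imp_AC[of _ _ _ M]) auto
next
  show "AE t in lebesgue. t \<in> I \<longrightarrow> (\<exists>v\<in>F (x t). (x has_vector_derivative v) (at t within I))"
  proof (rule AE_I')
    show "N \<in> null_sets lebesgue" using assms(4) negligible_iff_null_sets by blast
  qed (use assms(5) in auto)
qed

lemma solution_on_compact_lipschitz:
  assumes sol: "solution_on F I x" and sub: "{a..b} \<subseteq> I" "a \<le> b"
  shows "\<exists>M. \<forall>s\<in>{a..b}. \<forall>t\<in>{a..b}. norm (x s - x t) \<le> M * \<bar>s - t\<bar>"
proof -
  have "compact (x ` {a..b})"
    by (intro compact_continuous_image AC_imp_continuous_on solution_AC[OF sol sub]) auto
  then obtain R where R: "\<And>t. t \<in> {a..b} \<Longrightarrow> norm (x t) \<le> R"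
    using compact_imp_bounded bounded_iff by (metis imageI)
  obtain L where L: "lip_bound R L" using lip_bound_exists by blast
  show ?thesis using solution_lipschitz[OF sol sub(1) R L] by blast
qed

text \<open>
  Absolute continuity is transported through local Lipschitz bounds, which solutions have because
  their speed is bounded on compact intervals.
\<close>
lemma solution_shift:
  assumes sol: "solution_on F {0..} x" and "c \<ge> 0"
  shows "solution_on F {0..} (\<lambda>t. x (t + c))"
proof -
  have "AE t in lebesgue. t \<in> {0..} \<longrightarrow> (\<exists>v\<in>F (x t). (x has_vector_derivative v) (at t within {0..}))"
    using sol unfolding solution_on_def by blast
  then obtain E where E: "{t \<in> space lebesgue. \<not> (t \<in> {0..} \<longrightarrow> (\<exists>v\<in>F (x t). (x has_vector_derivative v) (at t within {0..})))} \<subseteq> E"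
      "emeasure lebesgue E = 0" "E \<in> sets lebesgue"
    by (rule AE_E)
  then have "negligible E" by (simp add: negligible_iff_null_sets null_setsI)
  then have neg: "negligible ((+) (- c) ` E)" by (rule negligible_translation)
  show ?thesis
  proof (rule locally_lipschitz_solutionI[OF _ _ _ neg])
    fix a b :: real assume ab: "a \<le> b" "{a..b} \<subseteq> {0..}"
    then have "{a + c..b + c} \<subseteq> {0..}" using \<open>c \<ge> 0\<close> by auto
    then obtain M where M: "\<forall>s\<in>{a + c..b + c}. \<forall>t\<in>{a + c..b + c}. norm (x s - x t) \<le> M * \<bar>s - t\<bar>"
      using solution_on_compact_lipschitz[OF sol, of "a + c" "b + c"] ab by auto
    have "norm (x (s + c) - x (t + c)) \<le> M * \<bar>s - t\<bar>" if "s \<in> {a..b}" "t \<in> {a..b}" for s t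
      using M[rule_format, of "s + c" "t + c"] that by simp
    then show "\<exists>M. \<forall>s\<in>{a..b}. \<forall>t\<in>{a..b}. norm (x (s + c) - x (t + c)) \<le> M * \<bar>s - t\<bar>" by blast
  next
    fix t assume t: "t \<in> {0..} - (+) (- c) ` E"
    have "t + c \<notin> E"
    proof
      assume "t + c \<in> E"
      then have "- c + (t + c) \<in> (+) (- c) ` E" by blast
      then show False using t by simp
    qed
    moreover have "t + c \<in> {0..}" using t \<open>c \<ge> 0\<close> by auto
    ultimately obtain v where v: "v \<in> F (x (t + c))" "(x has_vector_derivative v) (at (t + c) within {0..})"
      using E(1) by fastforce
    have "((\<lambda>t. t + c) has_vector_derivative 1) (at t within {0..})" by (auto intro!: derivative_eq_intros)
    moreover have "(x has_vector_derivative v) (at (t + c) within (\<lambda>t. t + c) ` {0..})"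
      by (rule has_vector_derivative_within_subset[OF v(2)]) (use \<open>c \<ge> 0\<close> in auto)
    ultimately have "((x \<circ> (\<lambda>t. t + c)) has_vector_derivative 1 *\<^sub>R v) (at t within {0..})"
      by (rule vector_diff_chain_within)
    then show "\<exists>v\<in>F (x (t + c)). ((\<lambda>t. x (t + c)) has_vector_derivative v) (at t within {0..})"
      using v(1) by (auto simp: o_def)
  qed (auto simp: is_interval_ci)
qed

text \<open>
  Adding an affine function to the polygon of \<open>polygonal_approximation\<close> moves its end points to \<open>p\<close> and
  \<open>q\<close> and changes its velocity by at most \<open>4 * \<eta> / (b - a)\<close>. The tolerance \<open>\<eta>\<close> does not depend on the
  solution \<open>y\<close>, so the solution can be chosen after \<open>\<eta>\<close>.
\<close>
lemma near_solution_piece: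
  assumes "a < b" and L: "lip_bound (norm \<xi> + 3) L" and \<theta>: "0 < \<theta>" "\<theta> \<le> 1"
  shows "\<exists>\<eta>>0. \<forall>I y p q. solution_on F I y \<longrightarrow> {a..b} \<subseteq> I \<longrightarrow> (\<forall>t\<in>{a..b}. norm (y t - \<xi>) \<le> 2) \<longrightarrow>
     norm (y a - p) \<le> \<eta> \<longrightarrow> norm (y b - q) \<le> \<eta> \<longrightarrow>
     (\<exists>z w S. finite S \<and> steplike {a..b} w \<and> (\<exists>C. C-lipschitz_on {a..b} z) \<and>
        (\<forall>t\<in>{a<..<b} - S. (z has_vector_derivative w t) (at t)) \<and> z a = p \<and> z b = q \<and>
        (\<forall>t\<in>{a..b}. norm (z t - y t) \<le> \<theta> \<and> infdist (w t) (F (z t)) \<le> \<theta>))"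
proof -
  \<comment> \<open>collects the three uses of \<open>\<eta>\<close>: distance of \<open>z t\<close> from the point where \<open>w0 t\<close> is admissible, change of velocity, distance from \<open>y\<close>\<close>
  define C where "C = L * (L + 5) + 4 / (b - a) + 5"
  have L1: "L \<ge> 1" using L unfolding lip_bound_def by simp
  have "L * (L + 5) \<ge> 0" "4 / (b - a) \<ge> 0" using L1 \<open>a < b\<close> by auto
  then have C: "C \<ge> 5" "C > 0" unfolding C_def by linarith+
  define \<eta> where "\<eta> = \<theta> / C"
  have \<eta>: "\<eta> > 0" "C * \<eta> = \<theta>" using \<theta> C by (auto simp: \<eta>_def)
  have \<eta>5: "5 * \<eta> \<le> \<theta>" using C(1) \<eta> mult_right_mono[of 5 C \<eta>] by simp
  show ?thesis
  proof (rule exI[of _ \<eta>], intro conjI allI impI \<eta>(1))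
    fix I y p q
    assume sol: "solution_on F I y" and sub: "{a..b} \<subseteq> I" and near: "\<forall>t\<in>{a..b}. norm (y t - \<xi>) \<le> 2"
      and p: "norm (y a - p) \<le> \<eta>" and q: "norm (y b - q) \<le> \<eta>"
    have bnd: "norm (y t) \<le> norm \<xi> + 3" if "t \<in> {a..b}" for t
      using near that norm_triangle_sub[of "y t" \<xi>] by fastforce
    have lip: "norm (y s - y t) \<le> L * \<bar>s - t\<bar>" if "s \<in> {a..b}" "t \<in> {a..b}" for s t
      by (rule solution_lipschitz[OF sol sub bnd L that])
    obtain E g where g: "E \<in> null_sets lebesgue" "\<And>t. g t \<in> F (y t)"
      "\<And>t. t \<in> {a..b} - E \<Longrightarrow> (y has_vector_derivative g t) (at t within {a..b})"
      using solution_velocity[OF sol sub] by metis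
    have gL: "norm (g t) \<le> L" if "t \<in> {a..b}" for t
      using g(2)[of t] bnd[OF that] L unfolding lip_bound_def by blast
    have ab: "a \<le> b" using \<open>a < b\<close> by simp
    obtain z0 w0 S where z0: "finite S" "steplike {a..b} w0" "\<exists>C. C-lipschitz_on {a..b} z0"
      "\<forall>t\<in>{a<..<b} - S. (z0 has_vector_derivative w0 t) (at t)"
      "\<forall>s\<in>{a..b}. norm (z0 s - y s) \<le> \<eta>"
      "\<forall>s\<in>{a..b}. \<exists>t\<in>{a..b}. w0 s = g t \<and> \<bar>s - t\<bar> \<le> \<eta>"
      by (rule polygonal_approximation[OF ab g(1,3) lip gL \<eta>(1)])
    define P Q where "P = p - z0 a" and "Q = q - z0 b"
    have PQ: "norm P \<le> 2 * \<eta>" "norm Q \<le> 2 * \<eta>"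
      using z0(5)[rule_format, of a] z0(5)[rule_format, of b] p q ab norm_triangle_ineq[of "p - y a" "y a - z0 a"]
        norm_triangle_ineq[of "q - y b" "y b - z0 b"]
      unfolding P_def Q_def by (auto simp: norm_minus_commute)
    define z where "z s = z0 s + ((b - s) / (b - a)) *\<^sub>R P + ((s - a) / (b - a)) *\<^sub>R Q" for s
    define w where "w s = w0 s + (1 / (b - a)) *\<^sub>R (Q - P)" for s
    have "steplike {a..b} w" unfolding w_def[abs_def]
      using steplike_comp2[OF z0(2) z0(2), of "\<lambda>c d. c + (1 / (b - a)) *\<^sub>R (Q - P)"] .
    moreover have "\<exists>C. C-lipschitz_on {a..b} z"
    proof -
      obtain C where C: "C-lipschitz_on {a..b} z0" using z0(3) by blast
      define V where "V = (1 / (b - a)) *\<^sub>R (Q - P)"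
      have "(C + (norm V))-lipschitz_on {a..b} z"
      proof (rule lipschitz_onI)
        fix s t assume st: "s \<in> {a..b}" "t \<in> {a..b}"
        have eq: "(b - s) / (b - a) - (b - t) / (b - a) = - ((s - t) * (1 / (b - a)))"
          "(s - a) / (b - a) - (t - a) / (b - a) = (s - t) * (1 / (b - a))"
          by (simp_all add: diff_divide_distrib left_diff_distrib)
        then have "((b - s) / (b - a)) *\<^sub>R P - ((b - t) / (b - a)) *\<^sub>R P
            + (((s - a) / (b - a)) *\<^sub>R Q - ((t - a) / (b - a)) *\<^sub>R Q) = (s - t) *\<^sub>R V"
          unfolding scaleR_diff_left[symmetric] eq V_def by (simp add: scaleR_diff_right)
        then have "z s - z t = (z0 s - z0 t) + (s - t) *\<^sub>R V"
          unfolding z_def by (simp add: algebra_simps)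
        moreover have "norm (z0 s - z0 t) \<le> C * \<bar>s - t\<bar>"
          using lipschitz_onD[OF C st] by (simp add: dist_norm)
        ultimately have "norm (z s - z t) \<le> C * \<bar>s - t\<bar> + norm ((s - t) *\<^sub>R V)"
          using norm_triangle_mono[OF _ order_refl] by metis
        then show "dist (z s) (z t) \<le> (C + (norm V)) * dist s t"
          unfolding norm_scaleR
          by (simp add: dist_norm distrib_left mult.commute)
      qed (use lipschitz_on_nonneg[OF C] in auto)
      then show ?thesis by blast
    qed
    moreover have "(z has_vector_derivative w t) (at t)" if "t \<in> {a<..<b} - S" for t
    proof -
      have "((\<lambda>s. z0 s + ((b - s) / (b - a)) *\<^sub>R P + ((s - a) / (b - a)) *\<^sub>R Q) has_vector_derivative
         w0 t + (- 1 / (b - a)) *\<^sub>R P + (1 / (b - a)) *\<^sub>R Q) (at t)"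
      proof (intro has_vector_derivative_add z0(4)[rule_format, OF that])
        have lin: "((\<lambda>s. (b - s) *\<^sub>R c) has_vector_derivative - c) (at t)"
          "((\<lambda>s. (s - a) *\<^sub>R c) has_vector_derivative c) (at t)" for c :: 'a
          by (auto intro!: derivative_eq_intros)
        show "((\<lambda>s. ((b - s) / (b - a)) *\<^sub>R P) has_vector_derivative (- 1 / (b - a)) *\<^sub>R P) (at t)"
          using lin(1)[of "(1 / (b - a)) *\<^sub>R P"] by simp
        show "((\<lambda>s. ((s - a) / (b - a)) *\<^sub>R Q) has_vector_derivative (1 / (b - a)) *\<^sub>R Q) (at t)"
          using lin(2)[of "(1 / (b - a)) *\<^sub>R Q"] by simp
      qed
      then show ?thesis unfolding z_def[abs_def] w_def by (simp add: algebra_simps)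
    qed
    moreover have "z a = p" "z b = q" using \<open>a < b\<close> by (auto simp: z_def P_def Q_def)
    moreover have "norm (z t - y t) \<le> \<theta> \<and> infdist (w t) (F (z t)) \<le> \<theta>" if t: "t \<in> {a..b}" for t
    proof
      have "norm (((b - t) / (b - a)) *\<^sub>R P) \<le> 1 * (2 * \<eta>)"
        "norm (((t - a) / (b - a)) *\<^sub>R Q) \<le> 1 * (2 * \<eta>)"
        unfolding norm_scaleR using PQ t \<open>a < b\<close> by (intro mult_mono; auto simp: field_simps)+
      then have "norm ((z0 t - y t) + ((b - t) / (b - a)) *\<^sub>R P + ((t - a) / (b - a)) *\<^sub>R Q) \<le> \<eta> + 1 * (2 * \<eta>) + 1 * (2 * \<eta>)"
        by (intro norm_triangle_mono z0(5)[rule_format, OF t])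
      then have zy: "norm (z t - y t) \<le> 5 * \<eta>" unfolding z_def by (simp add: algebra_simps)
      then show "norm (z t - y t) \<le> \<theta>" using \<eta>5 by simp
      obtain s where s: "s \<in> {a..b}" "w0 t = g s" "\<bar>t - s\<bar> \<le> \<eta>" using z0(6) t by blast
      have "norm (y s - z t) \<le> norm (y s - y t) + norm (z t - y t)"
        using norm_triangle_ineq4[of "y s - y t" "z t - y t"] by simp
      also have "\<dots> \<le> L * \<eta> + 5 * \<eta>"
      proof (rule add_mono[OF order_trans[OF lip[OF s(1) t]] zy])
        show "L * \<bar>s - t\<bar> \<le> L * \<eta>" using s(3) L1 by (intro mult_left_mono) (auto simp: abs_minus_commute)
      qed
      finally have d: "dist (y s) (z t) \<le> (L + 5) * \<eta>" by (simp add: dist_norm algebra_simps)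
      have zb: "norm (z t) \<le> norm \<xi> + 3"
        using zy \<eta>5 \<theta>(2) near t norm_triangle_ineq[of "z t - y t" "y t - \<xi>"] norm_triangle_sub[of "z t" \<xi>]
        by fastforce
      have "infdist (w0 t) (F (z t)) \<le> L * dist (y s) (z t)"
        using L g(2)[of s] bnd[OF s(1)] zb unfolding lip_bound_def s(2) by blast
      also have "\<dots> \<le> L * ((L + 5) * \<eta>)" using d L1 by (intro mult_left_mono) auto
      finally have 1: "infdist (w0 t) (F (z t)) \<le> L * ((L + 5) * \<eta>)" .
      have "norm (w t - w0 t) = (1 / (b - a)) * norm (Q - P)" using \<open>a < b\<close> by (simp add: w_def)
      also have "\<dots> \<le> (1 / (b - a)) * (4 * \<eta>)"
        using PQ norm_triangle_ineq4[of Q P] \<open>a < b\<close> by (intro mult_left_mono) auto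
      finally have 2: "dist (w t) (w0 t) \<le> 4 / (b - a) * \<eta>" by (simp add: dist_norm)
      have "infdist (w t) (F (z t)) \<le> infdist (w0 t) (F (z t)) + dist (w t) (w0 t)" by (rule infdist_triangle)
      also have "\<dots> \<le> L * ((L + 5) * \<eta>) + 4 / (b - a) * \<eta>" using 1 2 by (rule add_mono)
      also have "\<dots> \<le> C * \<eta>" using \<eta>(1) by (simp add: C_def algebra_simps)
      finally show "infdist (w t) (F (z t)) \<le> \<theta>" using \<eta>(2) by simp
    qed
    ultimately show "\<exists>z w S. finite S \<and> steplike {a..b} w \<and> (\<exists>C. C-lipschitz_on {a..b} z) \<and>
        (\<forall>t\<in>{a<..<b} - S. (z has_vector_derivative w t) (at t)) \<and> z a = p \<and> z b = q \<and>
        (\<forall>t\<in>{a..b}. norm (z t - y t) \<le> \<theta> \<and> infdist (w t) (F (z t)) \<le> \<theta>)"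
      using z0(1) by (intro exI[of _ z] exI[of _ w] exI[of _ S]) blast
  qed
qed

end

section \<open>Correcting an approximate solution backwards in time\<close>

definition step_curve :: "real \<Rightarrow> real \<Rightarrow> (real \<Rightarrow> 'b::real_normed_vector) \<Rightarrow> (real \<Rightarrow> 'b) \<Rightarrow> bool" where
  "step_curve a b x v \<longleftrightarrow> steplike {a..b} v \<and> (\<exists>C. C-lipschitz_on {a..b} x) \<and>
     (\<exists>S. finite S \<and> (\<forall>t\<in>{a<..<b} - S. (x has_vector_derivative v t) (at t)))"

context lipschitz_inclusion
begin

text \<open>
  \<open>\<omega> k\<close> is the sum of \<open>q j\<close> over \<open>j \<ge> k\<close>. In the iteration \<open>q j\<close> is the displacement produced on the
  \<open>j\<close>-th piece, and \<open>\<omega> (Suc k)\<close> is the shift that all later pieces together impose on the \<open>k\<close>-th.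
\<close>
lemma tail_sums:
  fixes q :: "nat \<Rightarrow> 'a"
  assumes q: "\<And>k. norm (q k) \<le> c k" and c: "\<And>k. c (Suc k) \<le> c k / 2"
  shows "\<exists>\<omega>. \<forall>k. \<omega> k = q k + \<omega> (Suc k) \<and> norm (\<omega> k) \<le> 2 * c k"
proof -
  have c0: "c k \<ge> 0" for k using order_trans[OF norm_ge_zero q[of k]] .
  define s where "s n = (\<Sum>j<n. q j)" for n
  have diff: "norm (s m - s n) \<le> 2 * c n - 2 * c m" if "n \<le> m" for n m
    using that
  proof (induction m rule: dec_induct)
    case (step m)
    have "norm ((s m - s n) + q m) \<le> (2 * c n - 2 * c m) + c m" by (rule norm_triangle_mono[OF step.IH q])
    then show ?case using c[of m] by (simp add: s_def algebra_simps)
  qed simp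
  have cpow: "c n \<le> c 0 / 2 ^ n" for n
  proof (induction n)
    case (Suc n) then show ?case using c[of n] divide_right_mono[OF Suc, of 2] by simp
  qed simp
  have "(\<lambda>n. c 0 / 2 ^ n) \<longlonglongrightarrow> 0"
    using tendsto_mult_right_zero[OF LIMSEQ_power_zero[of "1/2::real"], of "c 0"] by (simp add: power_divide)
  then have lim0: "(\<lambda>n. 2 * (c 0 / 2 ^ n)) \<longlonglongrightarrow> 0" by (intro tendsto_mult_right_zero)
  have "Cauchy s"
  proof (rule metric_CauchyI)
    fix e :: real assume "e > 0"
    then obtain M' where M': "2 * (c 0 / 2 ^ M') < e / 2"
      using order_tendstoD(2)[OF lim0, of "e/2"] unfolding eventually_sequentially by auto
    have "dist (s m) (s M') < e / 2" if "m \<ge> M'" for m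
      using diff[OF that] cpow[of M'] c0[of m] M' by (simp add: dist_norm)
    then show "\<exists>M. \<forall>m\<ge>M. \<forall>n\<ge>M. dist (s m) (s n) < e"
      using dist_triangle_half_l by (metis dist_commute)
  qed
  then obtain l where l: "s \<longlonglongrightarrow> l" by (rule Cauchy_limit)
  show ?thesis
  proof (rule exI[of _ "\<lambda>k. l - s k"], intro allI conjI)
    fix k
    show "l - s k = q k + (l - s (Suc k))" by (simp add: s_def)
    have "(\<lambda>m. norm (s m - s k)) \<longlonglongrightarrow> norm (l - s k)" by (intro tendsto_intros l)
    then show "norm (l - s k) \<le> 2 * c k"
    proof (rule Lim_bounded)
      show "\<forall>m\<ge>k. norm (s m - s k) \<le> 2 * c k"
      proof (intro allI impI)
        fix m assume "m \<ge> k"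
        then show "norm (s m - s k) \<le> 2 * c k" using diff[of k m] c0[of m] by simp
      qed
    qed
  qed
qed

lemma geometric_convergence:
  fixes X :: "nat \<Rightarrow> 'a"
  assumes "\<And>i. norm (X (Suc i) - X i) \<le> c / 2 ^ i"
  shows "\<exists>l. X \<longlonglongrightarrow> l \<and> (\<forall>i. norm (l - X i) \<le> 2 * c / 2 ^ i)"
proof -
  have "\<exists>\<omega>. \<forall>k. \<omega> k = (X (Suc k) - X k) + \<omega> (Suc k) \<and> norm (\<omega> k) \<le> 2 * (c / 2 ^ k)"
    by (rule tail_sums) (use assms in auto)
  then obtain \<omega> where \<omega>: "\<And>k. \<omega> k = (X (Suc k) - X k) + \<omega> (Suc k)" "\<And>k. norm (\<omega> k) \<le> 2 * (c / 2 ^ k)"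
    by blast
  define l where "l = X 0 + \<omega> 0"
  have "X i + \<omega> i = l" for i
  proof (induction i)
    case (Suc i)
    then show ?case using \<omega>(1)[of i] by (simp add: algebra_simps)
  qed (simp add: l_def)
  then have l: "l - X i = \<omega> i" for i by (metis add_diff_cancel_left')
  have "(\<lambda>i. 2 * (c / 2 ^ i)) \<longlonglongrightarrow> 0"
    using tendsto_mult_right_zero[OF LIMSEQ_power_zero[of "1/2::real"], of "2 * c"] by (simp add: power_divide)
  then have "(\<lambda>i. l - X i) \<longlonglongrightarrow> 0"
    by (rule Lim_null_comparison[rotated]) (use l \<omega>(2) in auto)
  then have "(\<lambda>i. l - (l - X i)) \<longlonglongrightarrow> l - 0" by (intro tendsto_intros)
  then have "X \<longlonglongrightarrow> l" by simp
  then show ?thesis using l \<omega>(2) by (intro exI[of _ l]) simp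
qed

text \<open>
  The new velocity \<open>v' s\<close> is a nearest point to \<open>v s\<close> in the value of \<open>F\<close> not at \<open>x s\<close> but at the value of
  \<open>x\<close> at the last point of a fine grid up to \<open>s\<close>. This makes \<open>v'\<close> a function of two step functions, hence again a step
  function, at the price of the extra error \<open>\<sigma>\<close>.
\<close>
lemma nearby_velocity_selection:
  assumes "a < b" and C: "step_curve a b x v" and L: "lip_bound \<rho> L"
    and \<rho>: "\<And>s. s \<in> {a..b} \<Longrightarrow> norm (x s) \<le> \<rho>"
    and D: "\<And>s. s \<in> {a..b} \<Longrightarrow> infdist (v s) (F (x s)) \<le> D" and "\<sigma> > 0"
  shows "\<exists>v' e. step_curve a b e (\<lambda>s. v' s - v s) \<and> steplike {a..b} v' \<and> (D + L * \<sigma>)-lipschitz_on {a..b} e \<and>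
    (\<forall>s\<in>{a..b}. norm (v' s - v s) \<le> D + L * \<sigma> \<and> (\<exists>r\<in>{a..b}. v' s \<in> F (x r) \<and> norm (x r - x s) \<le> \<sigma>))"
proof -
  obtain M where "M-lipschitz_on {a..b} x" using C unfolding step_curve_def by blast
  then obtain \<delta> where \<delta>: "\<delta> > 0" "\<And>s r. s \<in> {a..b} \<Longrightarrow> r \<in> {a..b} \<Longrightarrow> dist r s < \<delta> \<Longrightarrow> dist (x r) (x s) < \<sigma>"
    using lipschitz_on_uniformly_continuous \<open>\<sigma> > 0\<close> unfolding uniformly_continuous_on_def by metis
  \<comment> \<open>the grid width; \<open>m s\<close> is the last grid point up to \<open>s\<close>\<close>
  define g where "g = \<delta> / 2"
  define m where "m s = a + of_int \<lfloor>(s - a) / g\<rfloor> * g" for s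
  have g: "g > 0" "g < \<delta>" using \<delta>(1) by (auto simp: g_def)
  have m: "m s \<in> {a..b}" "dist (m s) s < \<delta>" if "s \<in> {a..b}" for s
  proof -
    have 1: "of_int \<lfloor>(s - a) / g\<rfloor> * g \<le> s - a" "s - a < (of_int \<lfloor>(s - a) / g\<rfloor> + 1) * g"
      using floor_divide_lower[OF g(1)] floor_divide_upper[OF g(1)] by auto
    have "of_int \<lfloor>(s - a) / g\<rfloor> * g \<ge> 0" using that g by auto
    then show "m s \<in> {a..b}" "dist (m s) s < \<delta>"
      using 1 that g unfolding m_def by (auto simp: dist_real_def algebra_simps)
  qed
  define sel where "sel u p = (SOME w. w \<in> F p \<and> dist u w = infdist u (F p))" for u p
  have sel: "sel u p \<in> F p" "dist u (sel u p) = infdist u (F p)" for u p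
    using someI_ex[of "\<lambda>w. w \<in> F p \<and> dist u w = infdist u (F p)"] nearest_point_exists[OF compact nonempty]
    unfolding sel_def by blast+
  define v' where "v' s = sel (v s) (x (m s))" for s
  have v: "steplike {a..b} v" using C unfolding step_curve_def by blast
  have v': "steplike {a..b} v'" unfolding v'_def m_def
    by (rule steplike_comp2[OF v steplike_floor[OF g(1), of _ a], of "\<lambda>u n. sel u (x (a + of_int n * g))"])
  have dv: "steplike {a..b} (\<lambda>s. v' s - v s)" by (rule steplike_comp2[OF v' v])
  have bnd: "norm (v' s - v s) \<le> D + L * \<sigma>" if s: "s \<in> {a..b}" for s
  proof -
    have "norm (v' s - v s) = infdist (v s) (F (x (m s)))"
      using sel(2)[of "v s" "x (m s)"] unfolding v'_def by (simp add: dist_norm norm_minus_commute)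
    also have "\<dots> \<le> infdist (v s) (F (x s)) + L * dist (x s) (x (m s))"
      by (rule lip_bound_infdist[OF L \<rho>[OF s] \<rho>[OF m(1)[OF s]]])
    also have "\<dots> \<le> D + L * \<sigma>"
      using D[OF s] \<delta>(2)[OF s m(1)[OF s] m(2)[OF s]] L unfolding lip_bound_def
      by (intro add_mono mult_left_mono) (auto simp: dist_commute)
    finally show ?thesis .
  qed
  obtain e S where e: "finite S" "\<forall>t\<in>{a<..<b} - S. (e has_vector_derivative v' t - v t) (at t)"
     "\<forall>s\<in>{a..b}. \<forall>t\<in>{a..b}. norm (e s - e t) \<le> (D + L * \<sigma>) * \<bar>s - t\<bar>"
    using steplike_primitive[OF less_imp_le[OF \<open>a < b\<close>] dv bnd] by blast
  have "D + L * \<sigma> \<ge> 0" using order_trans[OF norm_ge_zero bnd[of a]] \<open>a < b\<close> by simp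
  then have "(D + L * \<sigma>)-lipschitz_on {a..b} e" using e(3) by (auto intro!: lipschitz_onI simp: dist_norm)
  moreover have "\<exists>r\<in>{a..b}. v' s \<in> F (x r) \<and> norm (x r - x s) \<le> \<sigma>" if "s \<in> {a..b}" for s
    using sel(1) m[OF that] \<delta>(2)[OF that m(1)[OF that]] unfolding v'_def by (intro bexI[of _ "m s"]) (auto simp: dist_norm)
  ultimately show ?thesis using e(1,2) v' dv bnd unfolding step_curve_def by (intro exI[of _ v'] exI[of _ e]) blast
qed

lemma step_curve_add_const_correction:
  assumes "step_curve a b x v" "step_curve a b e (\<lambda>s. v' s - v s)" "steplike {a..b} v'"
  shows "step_curve a b (\<lambda>s. x s + (e s - c)) v'"
proof -
  obtain C1 S1 where 1: "C1-lipschitz_on {a..b} x" "finite S1" "\<forall>t\<in>{a<..<b} - S1. (x has_vector_derivative v t) (at t)"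
    using assms(1) unfolding step_curve_def by blast
  obtain C2 S2 where 2: "C2-lipschitz_on {a..b} e" "finite S2" "\<forall>t\<in>{a<..<b} - S2. (e has_vector_derivative v' t - v t) (at t)"
    using assms(2) unfolding step_curve_def by blast
  have "(C1 + (C2 + 0))-lipschitz_on {a..b} (\<lambda>s. x s + (e s - c))"
    by (intro lipschitz_intros 1 2)
  moreover have "((\<lambda>s. x s + (e s - c)) has_vector_derivative v' t) (at t)" if "t \<in> {a<..<b} - (S1 \<union> S2)" for t
    using has_vector_derivative_add[OF 1(3)[rule_format, of t] has_vector_derivative_diff[OF 2(3)[rule_format, of t] has_vector_derivative_const]] that
    by simp
  ultimately show ?thesis using assms(3) 1(2) 2(2) unfolding step_curve_def by (metis finite_Un)
qed

end

text \<open>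
  A curve on the union of the intervals \<open>[t k, t (Suc k)]\<close>, given piece by piece with matching ends, that
  solves the inclusion up to the error \<open>L k * \<gamma> k\<close> in the velocity. The tolerances \<open>\<gamma>\<close> halve so that the
  effect of all later pieces on a piece is a geometric series, and \<open>short\<close> makes the displacement caused by a
  velocity error \<open>L k * \<gamma> k\<close> on a piece a small fraction of \<open>\<gamma> k\<close>.
\<close>
locale chained_pieces = lipschitz_inclusion F for F :: "'a::real_normed_vector \<Rightarrow> 'a set" +
  fixes t :: "nat \<Rightarrow> real" and \<rho> L \<gamma> :: "nat \<Rightarrow> real" and x0 v0 :: "nat \<Rightarrow> real \<Rightarrow> 'a"
  assumes inc: "t k < t (Suc k)"
    and L: "lip_bound (\<rho> k) (L k)"
    and short: "L k * (t (Suc k) - t k) \<le> 1/16"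
    and \<gamma>_pos: "\<gamma> k > 0"
    and \<gamma>_half: "\<gamma> (Suc k) \<le> \<gamma> k / 2"
    and curve0: "step_curve (t k) (t (Suc k)) (x0 k) (v0 k)"
    and match0: "x0 k (t (Suc k)) = x0 (Suc k) (t (Suc k))"
    and inside: "s \<in> {t k..t (Suc k)} \<Longrightarrow> norm (x0 k s) + \<gamma> k \<le> \<rho> k"
    and near0: "s \<in> {t k..t (Suc k)} \<Longrightarrow> infdist (v0 k s) (F (x0 k s)) \<le> L k * \<gamma> k"
begin

lemma L_ge_1: "L k \<ge> 1" using L unfolding lip_bound_def by blast

text \<open>
  The factor \<open>1 - 1 / 2 ^ i\<close> is the part of the tolerance \<open>\<gamma> k\<close> that \<open>i\<close> corrections may use up; it keeps all
  approximants in the balls where the constants \<open>L k\<close> are valid.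
\<close>
definition approximant :: "nat \<Rightarrow> (nat \<Rightarrow> real \<Rightarrow> 'a) \<times> (nat \<Rightarrow> real \<Rightarrow> 'a) \<Rightarrow> bool" where
  "approximant i = (\<lambda>(x, v). \<forall>k. step_curve (t k) (t (Suc k)) (x k) (v k) \<and>
     x k (t (Suc k)) = x (Suc k) (t (Suc k)) \<and>
     (\<forall>s\<in>{t k..t (Suc k)}. infdist (v k s) (F (x k s)) \<le> L k * \<gamma> k / 2 ^ i \<and>
        norm (x k s - x0 k s) \<le> \<gamma> k * (1 - 1 / 2 ^ i)))"

text \<open>
  The last clause, a Lipschitz bound for the difference of two successive curves, expresses the
  closeness of their velocities in a form that survives the limit.
\<close>
definition correction :: "nat \<Rightarrow> (nat \<Rightarrow> real \<Rightarrow> 'a) \<times> (nat \<Rightarrow> real \<Rightarrow> 'a) \<Rightarrow>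
    (nat \<Rightarrow> real \<Rightarrow> 'a) \<times> (nat \<Rightarrow> real \<Rightarrow> 'a) \<Rightarrow> bool" where
  "correction i = (\<lambda>(x, v) (x', v'). \<forall>k. \<forall>s\<in>{t k..t (Suc k)}.
     norm (x' k s - x k s) \<le> \<gamma> k / 4 / 2 ^ i \<and> norm (v' k s - v k s) \<le> 2 * L k * \<gamma> k / 2 ^ i \<and>
     (\<forall>r\<in>{t k..t (Suc k)}. norm ((x' k s - x' k r) - (x k s - x k r)) \<le> 2 * L k * \<gamma> k * \<bar>s - r\<bar> / 2 ^ i))"

lemma inside_ball:
  assumes "norm (z - x0 k s) \<le> \<gamma> k" "s \<in> {t k..t (Suc k)}"
  shows "norm z \<le> \<rho> k"
  using assms inside[of s k] norm_triangle_sub[of z "x0 k s"] by simp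

lemma approximant_inside:
  assumes "approximant i (x, v)" "s \<in> {t k..t (Suc k)}"
  shows "norm (x k s) \<le> \<rho> k"
proof (rule inside_ball[OF _ assms(2)])
  have "norm (x k s - x0 k s) \<le> \<gamma> k * (1 - 1 / 2 ^ i)" using assms unfolding approximant_def by auto
  also have "\<dots> \<le> \<gamma> k * 1" using \<gamma>_pos[of k] by (intro mult_left_mono) auto
  finally show "norm (x k s - x0 k s) \<le> \<gamma> k" by simp
qed

text \<open>
  Replacing velocities by admissible ones changes the \<open>k\<close>-th piece by a primitive \<open>e k\<close> with total
  displacement at most \<open>c k\<close>. Shifting it by the tail sum \<open>\<omega> k\<close> of the displacements from \<open>k\<close> on makes the
  pieces match again. As \<open>c\<close> halves from piece to piece, the \<open>k\<close>-th piece moves by no more than \<open>3 * c k\<close>,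
  less than a quarter of \<open>\<gamma> k / 2 ^ i\<close>, and the velocity error after the move is at most \<open>L k\<close> times
  this distance plus the grid error \<open>\<sigma> k\<close>, less than half of the error before.
\<close>
lemma correction_exists:
  assumes X: "approximant i (x, v)"
  shows "\<exists>x' v'. approximant (Suc i) (x', v') \<and> correction i (x, v) (x', v')"
proof -
  define \<sigma> where "\<sigma> k = \<gamma> k / 2 ^ i / 16" for k
  define B where "B k = 17/16 * (L k * \<gamma> k / 2 ^ i)" for k
  have \<sigma>: "\<sigma> k > 0" for k using \<gamma>_pos by (simp add: \<sigma>_def)
  have curve: "step_curve (t k) (t (Suc k)) (x k) (v k)" for k using X unfolding approximant_def by auto
  have B: "L k * \<gamma> k / 2 ^ i + L k * \<sigma> k = B k" for k by (simp add: B_def \<sigma>_def field_simps)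
  define selects where "selects k v' e \<longleftrightarrow> step_curve (t k) (t (Suc k)) e (\<lambda>s. v' s - v k s) \<and>
       steplike {t k..t (Suc k)} v' \<and> (B k)-lipschitz_on {t k..t (Suc k)} e \<and>
       (\<forall>s\<in>{t k..t (Suc k)}. norm (v' s - v k s) \<le> B k \<and>
           (\<exists>r\<in>{t k..t (Suc k)}. v' s \<in> F (x k r) \<and> norm (x k r - x k s) \<le> \<sigma> k))" for k v' e
  have "\<exists>v' e. selects k v' e" for k
    unfolding selects_def B[symmetric]
    by (rule nearby_velocity_selection[OF inc curve L approximant_inside[OF X] _ \<sigma>])
       (use X in \<open>auto simp: approximant_def\<close>)
  then obtain v' e where sel: "\<And>k. selects k (v' k) (e k)" by metis
  have e: "step_curve (t k) (t (Suc k)) (e k) (\<lambda>s. v' k s - v k s)" "steplike {t k..t (Suc k)} (v' k)"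
      "(B k)-lipschitz_on {t k..t (Suc k)} (e k)" for k
    using sel[of k] unfolding selects_def by auto
  have v': "norm (v' k s - v k s) \<le> B k"
      "\<exists>r\<in>{t k..t (Suc k)}. v' k s \<in> F (x k r) \<and> norm (x k r - x k s) \<le> \<sigma> k"
    if "s \<in> {t k..t (Suc k)}" for k s
    using sel[of k] that unfolding selects_def by auto
  define c where "c k = 17/256 * (\<gamma> k / 2 ^ i)" for k
  have Bc: "B k * (t (Suc k) - t k) \<le> c k" for k
  proof -
    have "B k * (t (Suc k) - t k) = 17/16 * (\<gamma> k / 2 ^ i) * (L k * (t (Suc k) - t k))" by (simp add: B_def)
    also have "\<dots> \<le> 17/16 * (\<gamma> k / 2 ^ i) * (1/16)"
      using short[of k] \<gamma>_pos[of k] by (intro mult_left_mono) auto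
    finally show ?thesis by (simp add: c_def)
  qed
  have B0: "B k \<ge> 0" for k using L_ge_1[of k] \<gamma>_pos[of k] by (simp add: B_def)
  have elip: "norm (e k s - e k r) \<le> B k * \<bar>s - r\<bar>" if "s \<in> {t k..t (Suc k)}" "r \<in> {t k..t (Suc k)}" for k s r
    using lipschitz_onD[OF e(3) that] by (simp add: dist_norm)
  have ec: "norm (e k s - e k (t k)) \<le> c k" if s: "s \<in> {t k..t (Suc k)}" for k s
  proof -
    have "norm (e k s - e k (t k)) \<le> B k * \<bar>s - t k\<bar>" using s inc[of k] by (intro elip) auto
    also have "\<dots> \<le> B k * (t (Suc k) - t k)" using s B0 by (intro mult_left_mono) auto
    finally show ?thesis using Bc[of k] by simp
  qed
  define q where "q k = e k (t (Suc k)) - e k (t k)" for k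
  have qc: "norm (q k) \<le> c k" for k unfolding q_def using inc[of k] by (intro ec) auto
  have ch: "c (Suc k) \<le> c k / 2" for k
    using divide_right_mono[OF \<gamma>_half[of k], of "2 ^ i"] by (simp add: c_def)
  obtain \<omega> where \<omega>: "\<And>k. \<omega> k = q k + \<omega> (Suc k)" "\<And>k. norm (\<omega> k) \<le> 2 * c k"
    using tail_sums[of q c, OF qc ch] by blast
  define x' where "x' k s = x k s + (e k s - (e k (t k) + \<omega> k))" for k s
  have dx: "norm (x' k s - x k s) \<le> \<gamma> k / 4 / 2 ^ i" if s: "s \<in> {t k..t (Suc k)}" for k s
  proof -
    have "norm (x' k s - x k s) \<le> norm (e k s - e k (t k)) + norm (\<omega> k)"
      using norm_triangle_ineq4[of "e k s - e k (t k)" "\<omega> k"] by (simp add: x'_def algebra_simps)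
    also have "\<dots> \<le> 3 * c k" using ec[OF s] \<omega>(2)[of k] by simp
    also have "\<dots> \<le> \<gamma> k / 4 / 2 ^ i" using \<gamma>_pos[of k] by (simp add: c_def field_simps)
    finally show ?thesis .
  qed
  have dx0: "norm (x' k s - x0 k s) \<le> \<gamma> k * (1 - 1 / 2 ^ Suc i)" if s: "s \<in> {t k..t (Suc k)}" for k s
  proof -
    have "norm (x k s - x0 k s) \<le> \<gamma> k * (1 - 1 / 2 ^ i)" using X s unfolding approximant_def by auto
    from norm_triangle_mono[OF dx[OF s] this]
    have "norm (x' k s - x0 k s) \<le> \<gamma> k / 4 / 2 ^ i + \<gamma> k * (1 - 1 / 2 ^ i)" by simp
    also have "\<dots> \<le> \<gamma> k * (1 - 1 / 2 ^ Suc i)" using \<gamma>_pos[of k] by (simp add: field_simps)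
    finally show ?thesis .
  qed
  have "approximant (Suc i) (x', v')"
    unfolding approximant_def
  proof (clarify, intro allI conjI ballI)
    fix k
    show "step_curve (t k) (t (Suc k)) (x' k) (v' k)" unfolding x'_def[abs_def]
      by (rule step_curve_add_const_correction[OF curve e(1,2)])
    have "x k (t (Suc k)) = x (Suc k) (t (Suc k))" using X unfolding approximant_def by auto
    then show "x' k (t (Suc k)) = x' (Suc k) (t (Suc k))"
      using \<omega>(1)[of k] by (simp add: x'_def q_def algebra_simps)
    fix s assume s: "s \<in> {t k..t (Suc k)}"
    show "norm (x' k s - x0 k s) \<le> \<gamma> k * (1 - 1 / 2 ^ Suc i)" by (rule dx0[OF s])
    also have "\<dots> \<le> \<gamma> k" using \<gamma>_pos[of k] mult_left_mono[of "1 - 1 / 2 ^ Suc i" 1 "\<gamma> k"] by simp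
    finally have x'\<rho>: "norm (x' k s) \<le> \<rho> k" using s by (rule inside_ball)
    obtain r where r: "r \<in> {t k..t (Suc k)}" "v' k s \<in> F (x k r)" "norm (x k r - x k s) \<le> \<sigma> k" using v'(2)[OF s] by blast
    have "norm ((x k r - x k s) - (x' k s - x k s)) \<le> \<sigma> k + \<gamma> k / 4 / 2 ^ i"
      using r(3) dx[OF s] norm_triangle_ineq4 by (meson add_mono order_trans)
    also have "\<dots> \<le> \<gamma> k / 2 ^ Suc i" using \<gamma>_pos[of k] by (simp add: \<sigma>_def field_simps)
    finally have "dist (x k r) (x' k s) \<le> \<gamma> k / 2 ^ Suc i" by (simp add: dist_norm)
    then have "L k * dist (x k r) (x' k s) \<le> L k * (\<gamma> k / 2 ^ Suc i)"
      using L_ge_1[of k] by (intro mult_left_mono) auto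
    moreover have "infdist (v' k s) (F (x' k s)) \<le> L k * dist (x k r) (x' k s)"
      using L[of k] approximant_inside[OF X r(1)] x'\<rho> r(2) unfolding lip_bound_def by blast
    ultimately show "infdist (v' k s) (F (x' k s)) \<le> L k * \<gamma> k / 2 ^ Suc i" by simp
  qed
  moreover have "correction i (x, v) (x', v')"
    unfolding correction_def
  proof (clarify, intro conjI ballI)
    fix k s assume s: "s \<in> {t k..t (Suc k)}"
    show "norm (x' k s - x k s) \<le> \<gamma> k / 4 / 2 ^ i" by (rule dx[OF s])
    have B2: "B k \<le> 2 * L k * \<gamma> k / 2 ^ i" using L_ge_1[of k] \<gamma>_pos[of k] by (simp add: B_def field_simps)
    then show "norm (v' k s - v k s) \<le> 2 * L k * \<gamma> k / 2 ^ i" using v'(1)[OF s] by simp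
    fix r assume r: "r \<in> {t k..t (Suc k)}"
    have "norm ((x' k s - x' k r) - (x k s - x k r)) = norm (e k s - e k r)" by (simp add: x'_def algebra_simps)
    also have "\<dots> \<le> B k * \<bar>s - r\<bar>" by (rule elip[OF s r])
    also have "\<dots> \<le> 2 * L k * \<gamma> k / 2 ^ i * \<bar>s - r\<bar>" using B2 by (intro mult_right_mono) auto
    finally show "norm ((x' k s - x' k r) - (x k s - x k r)) \<le> 2 * L k * \<gamma> k * \<bar>s - r\<bar> / 2 ^ i" by simp
  qed
  ultimately show ?thesis by blast
qed

text \<open>
  The limit of the corrections. Its velocity is found as in the theorem on differentiating a
  uniformly convergent sequence whose derivatives converge uniformly: the differences between the limit and
  the \<open>i\<close>-th approximant have Lipschitz constants tending to \<open>0\<close>. The points where some approximant has a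
  kink form a countable set.
\<close>
lemma exact_pieces:
  obtains x N where "\<And>k. x k (t (Suc k)) = x (Suc k) (t (Suc k))"
    "\<And>k s. s \<in> {t k..t (Suc k)} \<Longrightarrow> norm (x k s - x0 k s) \<le> \<gamma> k"
    "\<And>k. \<exists>C. C-lipschitz_on {t k..t (Suc k)} (x k)" "countable N"
    "\<And>k s. s \<in> {t k<..<t (Suc k)} - N \<Longrightarrow> \<exists>v\<in>F (x k s). (x k has_vector_derivative v) (at s)"
proof -
  have "\<exists>X. \<forall>i. approximant i (X i) \<and> correction i (X i) (X (Suc i))"
  proof (rule dependent_nat_choice)
    have "approximant 0 (x0, v0)" using curve0 match0 near0 by (auto simp: approximant_def)
    then show "\<exists>X. approximant 0 X" by blast
    fix X :: "(nat \<Rightarrow> real \<Rightarrow> 'a) \<times> (nat \<Rightarrow> real \<Rightarrow> 'a)" and i assume "approximant i X"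
    then show "\<exists>X'. approximant (Suc i) X' \<and> correction i X X'"
      using correction_exists[of i "fst X" "snd X"] by auto
  qed
  then obtain X where X: "\<And>i. approximant i (X i)" "\<And>i. correction i (X i) (X (Suc i))" by blast
  define y where "y i = fst (X i)" for i
  define w where "w i = snd (X i)" for i
  have A: "approximant i (y i, w i)" "correction i (y i, w i) (y (Suc i), w (Suc i))" for i
    using X by (auto simp: y_def w_def)
  have "\<exists>l. (\<lambda>i. y i k s) \<longlonglongrightarrow> l \<and> (\<forall>i. norm (l - y i k s) \<le> 2 * (\<gamma> k / 4) / 2 ^ i)"
    if "s \<in> {t k..t (Suc k)}" for k s
    by (rule geometric_convergence[of "\<lambda>i. y i k s" "\<gamma> k / 4"])
       (use A(2) that in \<open>auto simp: correction_def\<close>)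
  note ex_x = this
  define x where "x k s = (SOME l. (\<lambda>i. y i k s) \<longlonglongrightarrow> l \<and> (\<forall>i. norm (l - y i k s) \<le> 2 * (\<gamma> k / 4) / 2 ^ i))" for k s
  have x: "(\<lambda>i. y i k s) \<longlonglongrightarrow> x k s" "norm (x k s - y i k s) \<le> 2 * (\<gamma> k / 4) / 2 ^ i"
    if "s \<in> {t k..t (Suc k)}" for k s i
    using someI_ex[OF ex_x[OF that]] unfolding x_def by blast+
  have "\<exists>l. (\<lambda>i. w i k s) \<longlonglongrightarrow> l \<and> (\<forall>i. norm (l - w i k s) \<le> 2 * (2 * L k * \<gamma> k) / 2 ^ i)"
    if "s \<in> {t k..t (Suc k)}" for k s
    by (rule geometric_convergence[of "\<lambda>i. w i k s" "2 * L k * \<gamma> k"])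
       (use A(2) that in \<open>auto simp: correction_def\<close>)
  note ex_v = this
  define v where "v k s = (SOME l. (\<lambda>i. w i k s) \<longlonglongrightarrow> l \<and> (\<forall>i. norm (l - w i k s) \<le> 2 * (2 * L k * \<gamma> k) / 2 ^ i))" for k s
  have v: "norm (v k s - w i k s) \<le> 2 * (2 * L k * \<gamma> k) / 2 ^ i" if "s \<in> {t k..t (Suc k)}" for k s i
    using someI_ex[OF ex_v[OF that]] unfolding v_def by blast
  have incr: "norm ((x k s - x k r) - (y i k s - y i k r)) \<le> 4 * L k * \<gamma> k / 2 ^ i * \<bar>s - r\<bar>"
    if sr: "s \<in> {t k..t (Suc k)}" "r \<in> {t k..t (Suc k)}" for k s r i
  proof -
    have "\<exists>l. (\<lambda>i. y i k s - y i k r) \<longlonglongrightarrow> l \<and>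
        (\<forall>i. norm (l - (y i k s - y i k r)) \<le> 2 * (2 * L k * \<gamma> k * \<bar>s - r\<bar>) / 2 ^ i)"
      by (rule geometric_convergence) (use A(2) sr in \<open>auto simp: correction_def\<close>)
    then obtain l where l: "(\<lambda>i. y i k s - y i k r) \<longlonglongrightarrow> l"
        "\<And>i. norm (l - (y i k s - y i k r)) \<le> 2 * (2 * L k * \<gamma> k * \<bar>s - r\<bar>) / 2 ^ i" by blast
    have l_eq: "l = x k s - x k r" by (rule LIMSEQ_unique[OF l(1)]) (intro tendsto_intros x(1) sr)
    have "2 * (2 * L k * \<gamma> k * \<bar>s - r\<bar>) / 2 ^ i = 4 * L k * \<gamma> k / 2 ^ i * \<bar>s - r\<bar>" by simp
    then show ?thesis using l(2)[of i] unfolding l_eq by (simp only:)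
  qed
  define breaks where "breaks i k S \<longleftrightarrow> finite S \<and>
      (\<forall>s\<in>{t k<..<t (Suc k)} - S. (y i k has_vector_derivative w i k s) (at s))" for i k S
  have "\<exists>S. breaks i k S" for i k
    using A(1)[of i] unfolding approximant_def step_curve_def breaks_def by blast
  then obtain S where S: "\<And>i k. breaks i k (S i k)" by metis
  define N where "N = (\<Union>i k. S i k)"
  have small: "\<exists>i. K / 2 ^ i < e" if "e > 0" for K e :: real
  proof -
    have "(\<lambda>i. K * (1/2) ^ i) \<longlonglongrightarrow> 0" by (intro tendsto_mult_right_zero LIMSEQ_power_zero) auto
    then have "\<forall>\<^sub>F i in sequentially. K * (1/2) ^ i < e" using that by (rule order_tendstoD)
    then show ?thesis by (auto simp: eventually_sequentially power_divide)
  qed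
  show ?thesis
  proof (rule that[of x N])
    fix k
    have pts: "t (Suc k) \<in> {t k..t (Suc k)}" "t (Suc k) \<in> {t (Suc k)..t (Suc (Suc k))}"
      using inc[of k] inc[of "Suc k"] by auto
    have "y i k (t (Suc k)) = y i (Suc k) (t (Suc k))" for i using A(1)[of i] unfolding approximant_def by auto
    then show "x k (t (Suc k)) = x (Suc k) (t (Suc k))"
      using LIMSEQ_unique[OF x(1)[OF pts(1)]] x(1)[OF pts(2)] by simp
    have "approximant 0 (y 0, w 0)" by (rule A)
    then have start: "norm (y 0 k s - x0 k s) \<le> 0" if "s \<in> {t k..t (Suc k)}" for s
      using that unfolding approximant_def by force
    show "norm (x k s - x0 k s) \<le> \<gamma> k" if s: "s \<in> {t k..t (Suc k)}" for s
      using x(2)[OF s, of 0] start[OF s] \<gamma>_pos[of k] by simp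
    obtain C where C: "C-lipschitz_on {t k..t (Suc k)} (y 0 k)"
      using A(1)[of 0] unfolding approximant_def step_curve_def by blast
    have "(C + 4 * L k * \<gamma> k)-lipschitz_on {t k..t (Suc k)} (x k)"
    proof (rule lipschitz_onI)
      fix s r assume sr: "s \<in> {t k..t (Suc k)}" "r \<in> {t k..t (Suc k)}"
      have "norm (y 0 k s - y 0 k r) \<le> C * \<bar>s - r\<bar>" using lipschitz_onD[OF C sr] by (simp add: dist_norm)
      from norm_triangle_mono[OF incr[OF sr, of 0] this]
      show "dist (x k s) (x k r) \<le> (C + 4 * L k * \<gamma> k) * dist s r" by (simp add: dist_norm algebra_simps)
    qed (use lipschitz_on_nonneg[OF C] L_ge_1[of k] \<gamma>_pos[of k] in auto)
    then show "\<exists>C. C-lipschitz_on {t k..t (Suc k)} (x k)" by blast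
    show "countable N" 
    proof -
      have "finite (S i k)" for i k using S[of i k] unfolding breaks_def by blast
      then show ?thesis unfolding N_def by (intro countable_UN[OF countableI_type] countable_finite)
    qed
    fix s assume s: "s \<in> {t k<..<t (Suc k)} - N"
    then have s': "s \<in> {t k..t (Suc k)}" by auto
    have "(x k has_vector_derivative v k s) (at s)"
      unfolding has_vector_derivative_def has_derivative_at_alt
    proof (intro conjI allI impI)
      show "bounded_linear (\<lambda>r. r *\<^sub>R v k s)" by (rule bounded_linear_scaleR_left)
      fix e :: real assume "e > 0"
      then have "\<exists>i. 4 * L k * \<gamma> k / 2 ^ i < e / 3" by (intro small) simp
      then obtain i where i: "4 * L k * \<gamma> k / 2 ^ i < e / 3" by blast
      have "(y i k has_vector_derivative w i k s) (at s)" using S[of i k] s unfolding N_def breaks_def by blast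
      moreover have "e / 3 > 0" using \<open>e > 0\<close> by simp
      ultimately obtain d where d: "d > 0"
        "\<forall>r. norm (r - s) < d \<longrightarrow> norm (y i k r - y i k s - (r - s) *\<^sub>R w i k s) \<le> e / 3 * norm (r - s)"
        unfolding has_vector_derivative_def has_derivative_at_alt by blast
      define d' where "d' = min d (min (s - t k) (t (Suc k) - s))"
      show "\<exists>d>0. \<forall>r. norm (r - s) < d \<longrightarrow> norm (x k r - x k s - (r - s) *\<^sub>R v k s) \<le> e * norm (r - s)"
      proof (intro exI conjI allI impI)
        show "d' > 0" using d(1) s by (auto simp: d'_def)
        fix r assume r: "norm (r - s) < d'"
        then have r': "r \<in> {t k..t (Suc k)}" by (auto simp: d'_def)
        have 1: "norm ((x k r - x k s) - (y i k r - y i k s)) \<le> e / 3 * \<bar>r - s\<bar>"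
          using incr[OF r' s', of i] mult_right_mono[OF less_imp_le[OF i], of "\<bar>r - s\<bar>"] by simp
        have 2: "norm (y i k r - y i k s - (r - s) *\<^sub>R w i k s) \<le> e / 3 * \<bar>r - s\<bar>"
          using d(2)[rule_format, of r] r by (simp add: d'_def)
        have "norm (w i k s - v k s) \<le> e / 3" using v[OF s', of i] i by (simp add: norm_minus_commute)
        then have 3: "norm ((r - s) *\<^sub>R (w i k s - v k s)) \<le> e / 3 * \<bar>r - s\<bar>"
          by (simp add: mult.commute[of "e/3"] mult_left_mono del: times_divide_eq_left times_divide_eq_right)
        have "norm (((x k r - x k s) - (y i k r - y i k s)) + (y i k r - y i k s - (r - s) *\<^sub>R w i k s)
           + (r - s) *\<^sub>R (w i k s - v k s)) \<le> e / 3 * \<bar>r - s\<bar> + e / 3 * \<bar>r - s\<bar> + e / 3 * \<bar>r - s\<bar>"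
          by (intro norm_triangle_mono 1 2 3)
        then show "norm (x k r - x k s - (r - s) *\<^sub>R v k s) \<le> e * norm (r - s)" by (simp add: algebra_simps)
      qed
    qed
    moreover have "v k s \<in> F (x k s)"
    proof -
      have "infdist (v k s) (F (x k s)) \<le> 0"
      proof (rule field_le_epsilon)
        fix e :: real assume "e > 0"
        then obtain i where i: "6 * L k * \<gamma> k / 2 ^ i < e" using small by blast
        have ys: "norm (y i k s) \<le> \<rho> k" using approximant_inside[OF A(1) s'] .
        have xs: "norm (x k s) \<le> \<rho> k"
          using x(2)[OF s', of 0] start[OF s'] \<gamma>_pos[of k] by (intro inside_ball[OF _ s']) simp
        have "infdist (v k s) (F (x k s)) \<le> infdist (w i k s) (F (x k s)) + dist (v k s) (w i k s)"
          by (rule infdist_triangle)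
        also have "\<dots> \<le> (infdist (w i k s) (F (y i k s)) + L k * dist (y i k s) (x k s)) + dist (v k s) (w i k s)"
          by (intro add_right_mono lip_bound_infdist[OF L ys xs])
        also have "\<dots> \<le> (L k * \<gamma> k / 2 ^ i + L k * (\<gamma> k / 2 ^ i)) + 4 * L k * \<gamma> k / 2 ^ i"
        proof (intro add_mono mult_left_mono)
          show "infdist (w i k s) (F (y i k s)) \<le> L k * \<gamma> k / 2 ^ i" using A(1)[of i] s' unfolding approximant_def by auto
          have "norm (x k s - y i k s) \<le> 2 * (\<gamma> k / 4) / 2 ^ i" by (rule x(2)[OF s'])
          also have "\<dots> \<le> \<gamma> k / 2 ^ i" using \<gamma>_pos[of k] by (simp add: field_simps)
          finally show "dist (y i k s) (x k s) \<le> \<gamma> k / 2 ^ i" by (simp add: dist_norm norm_minus_commute)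
          show "dist (v k s) (w i k s) \<le> 4 * L k * \<gamma> k / 2 ^ i" using v[OF s', of i] by (simp add: dist_norm)
          show "0 \<le> L k" using L_ge_1[of k] by simp
        qed
        also have "\<dots> = 6 * L k * \<gamma> k / 2 ^ i" by (simp add: field_simps)
        finally show "infdist (v k s) (F (x k s)) \<le> 0 + e" using i by simp
      qed
      then show ?thesis
        using in_closed_iff_infdist_zero[OF compact_imp_closed[OF compact] nonempty]
        by (metis infdist_nonneg order_antisym)
    qed
    ultimately show "\<exists>v\<in>F (x k s). (x k has_vector_derivative v) (at s)" by blast
  qed
qed

end

section \<open>Solutions shadowing a sequence of solutions\<close>

context chained_pieces
begin

lemma t_mono: "j \<le> k \<Longrightarrow> t j \<le> t k"
  by (rule lift_Suc_mono_le[of t]) (use inc less_imp_le in auto)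

lemma exact_solution:
  assumes t0: "t 0 = 0"
  shows "\<exists>X. solution_on F {s. 0 \<le> s \<and> (\<exists>k. s < t k)} X \<and>
     (\<forall>k. \<forall>s\<in>{t k..t (Suc k)}. norm (X s - x0 k s) \<le> \<gamma> k)"
proof -
  let ?J = "{s. 0 \<le> s \<and> (\<exists>k. s < t k)}"
  obtain x N where match: "\<And>k. x k (t (Suc k)) = x (Suc k) (t (Suc k))"
    and near: "\<And>k s. s \<in> {t k..t (Suc k)} \<Longrightarrow> norm (x k s - x0 k s) \<le> \<gamma> k"
    and lip: "\<And>k. \<exists>C. C-lipschitz_on {t k..t (Suc k)} (x k)" and "countable N"
    and der: "\<And>k s. s \<in> {t k<..<t (Suc k)} - N \<Longrightarrow> \<exists>v\<in>F (x k s). (x k has_vector_derivative v) (at s)"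
    using exact_pieces by blast
  define X where "X s = x (LEAST k. s < t (Suc k)) s" for s
  have X1: "X s = x k s" if s: "t k \<le> s" "s < t (Suc k)" for k s
  proof -
    have "(LEAST k. s < t (Suc k)) = k"
    proof (rule Least_equality)
      fix j assume "s < t (Suc j)"
      then have "t k < t (Suc j)" using s by simp
      then show "k \<le> j" using t_mono[of "Suc j" k] by (meson not_less not_less_eq_eq)
    qed (rule s(2))
    then show ?thesis by (simp add: X_def)
  qed
  have X: "X s = x k s" if s: "s \<in> {t k..t (Suc k)}" for k s
  proof (cases "s = t (Suc k)")
    case True
    then show ?thesis using X1[of "Suc k" s] inc[of "Suc k"] match[of k] by simp
  qed (use X1 s in auto)
  have lipX: "\<exists>C. C-lipschitz_on {t 0..t n} X" for n
  proof (induction n)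
    case 0
    have "0-lipschitz_on {t 0..t 0} X" by (intro lipschitz_onI) auto
    then show ?case by blast
  next
    case (Suc n)
    then obtain C where C: "C-lipschitz_on {t 0..t n} X" by blast
    obtain D where "D-lipschitz_on {t n..t (Suc n)} (x n)" using lip by blast
    then have D: "D-lipschitz_on {t n..t (Suc n)} X"
      by (rule lipschitz_on_transform) (use X in auto)
    have "(max C D)-lipschitz_on {t 0..t (Suc n)} (\<lambda>s. if s \<le> t n then X s else X s)"
      by (rule lipschitz_on_concat_max[OF C D]) simp
    then show ?case by auto
  qed
  have "solution_on F ?J X"
  proof (rule locally_lipschitz_solutionI)
    show "is_interval ?J" unfolding is_interval_1 by (auto intro: order_trans le_less_trans)
    show "?J \<subseteq> {0..}" by auto
    fix a b assume ab: "a \<le> b" "{a..b} \<subseteq> ?J"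
    then have "b \<in> ?J" "a \<in> ?J" by auto
    then obtain n where n: "b < t n" "0 \<le> a" by auto
    obtain C where C: "C-lipschitz_on {t 0..t n} X" using lipX by blast
    have "norm (X s - X r) \<le> C * \<bar>s - r\<bar>" if "s \<in> {a..b}" "r \<in> {a..b}" for s r
      using lipschitz_onD[OF C, of s r] that n t0 by (auto simp: dist_norm)
    then show "\<exists>M. \<forall>s\<in>{a..b}. \<forall>r\<in>{a..b}. norm (X s - X r) \<le> M * \<bar>s - r\<bar>" by blast
  next
    have "countable (N \<union> range t)" using \<open>countable N\<close> by simp
    then show "negligible (N \<union> range t)" 
      by (simp add: negligible_iff_null_sets null_sets_completionI countable_imp_null_set_lborel)
    fix s assume s: "s \<in> ?J - (N \<union> range t)"
    define k where "k = (LEAST k. s < t (Suc k))"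
    obtain j where j: "s < t j" using s by auto
    then have "s < t (Suc j)" using inc[of j] by simp
    then have k: "s < t (Suc k)" unfolding k_def by (rule LeastI)
    have "t k \<le> s"
    proof (cases k)
      case 0 then show ?thesis using s t0 by simp
    next
      case (Suc i)
      then have "\<not> s < t (Suc i)" using not_less_Least[of i "\<lambda>k. s < t (Suc k)"] unfolding k_def by simp
      then show ?thesis using Suc by simp
    qed
    then have sk: "s \<in> {t k<..<t (Suc k)} - N" using k s by (auto simp: order_le_less)
    then obtain v where v: "v \<in> F (x k s)" "(x k has_vector_derivative v) (at s)" using der by blast
    have eq: "x k r = X r" if "r \<in> {t k<..<t (Suc k)}" for r using that by (intro X[symmetric]) auto
    have "(X has_vector_derivative v) (at s)"
      by (rule has_vector_derivative_transform_within_open[OF v(2) open_greaterThanLessThan _ eq])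
         (use sk in auto)
    then have "(X has_vector_derivative v) (at s within ?J)" by (rule has_vector_derivative_at_within)
    moreover have "v \<in> F (X s)" using v(1) X[of s k] sk by auto
    ultimately show "\<exists>v\<in>F (X s). (X has_vector_derivative v) (at s within ?J)" by blast
  qed
  moreover have "norm (X s - x0 k s) \<le> \<gamma> k" if "s \<in> {t k..t (Suc k)}" for k s
    using near[OF that] X[OF that] by simp
  ultimately show ?thesis by blast
qed

end

context lipschitz_inclusion
begin

lemma lip_bound_mono: "lip_bound R L \<Longrightarrow> R' \<le> R \<Longrightarrow> L \<le> L' \<Longrightarrow> lip_bound R' L'"
  unfolding lip_bound_def by (meson mult_right_mono order_trans zero_le_dist)

text \<open>
  Monotonicity in the radius makes the step lengths derived from \<open>\<Lambda>\<close> bounded below as long as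
  the states stay bounded; hence the times can accumulate only if the states are unbounded.
\<close>
lemma uniform_lip_bound:
  "\<exists>\<Lambda>. mono \<Lambda> \<and> (\<forall>\<xi>::'a. lip_bound (norm \<xi> + 3) (\<Lambda> (nat \<lceil>norm \<xi>\<rceil>)))"
proof -
  have "\<exists>L. lip_bound (real m + 3) L" for m :: nat by (rule lip_bound_exists)
  then obtain l where l: "\<And>m::nat. lip_bound (real m + 3) (l m)" by metis
  have l1: "l m \<ge> 1" for m using l[of m] unfolding lip_bound_def by blast
  define \<Lambda> where "\<Lambda> m = (\<Sum>j\<le>m. l j)" for m
  have "mono \<Lambda>"
  proof (rule monoI)
    fix m n :: nat assume "m \<le> n"
    then show "\<Lambda> m \<le> \<Lambda> n" unfolding \<Lambda>_def
      by (intro sum_mono2) (auto intro: order_trans[OF _ l1])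
  qed
  moreover have "lip_bound (norm \<xi> + 3) (\<Lambda> (nat \<lceil>norm \<xi>\<rceil>))" for \<xi> :: 'a
  proof (rule lip_bound_mono[OF l])
    show "norm \<xi> + 3 \<le> real (nat \<lceil>norm \<xi>\<rceil>) + 3" by (simp add: real_nat_ceiling_ge)
    show "l (nat \<lceil>norm \<xi>\<rceil>) \<le> \<Lambda> (nat \<lceil>norm \<xi>\<rceil>)" unfolding \<Lambda>_def
      by (rule member_le_sum) (auto intro: order_trans[OF _ l1])
  qed
  ultimately show ?thesis by blast
qed

text \<open>
  Each stage of the construction records a time, a limit point and a subsequence of \<open>y\<close> converging to
  it at that time. Since the step \<open>c \<xi>\<close> is short enough for solutions to stay near \<open>\<xi>\<close>, the solutions of
  the subsequence are still bounded at the next time, and a further subsequence converges there.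
  That subsequence approximates both end points of the step.
\<close>
lemma limit_points_along_solutions:
  fixes y :: "nat \<Rightarrow> real \<Rightarrow> 'a"
  assumes sol: "\<And>n. solution_on F {0..} (y n)" and \<kappa>: "\<And>n. norm (y n 0) \<le> \<kappa>"
    and c: "\<And>\<xi>. c \<xi> > 0" and L: "\<And>\<xi>. lip_bound (norm \<xi> + 3) (L \<xi>)" "\<And>\<xi>. L \<xi> * c \<xi> < 1"
  shows "\<exists>t \<xi>. t 0 = 0 \<and> (\<forall>k. t (Suc k) = t k + c (\<xi> k) \<and>
    (\<forall>\<eta>>0. \<forall>n0. \<exists>n\<ge>n0. norm (y n (t k) - \<xi> k) \<le> \<eta> \<and> norm (y n (t (Suc k)) - \<xi> (Suc k)) \<le> \<eta>))"
proof -
  define P where "P k = (\<lambda>(\<tau>, \<zeta>, r). \<tau> \<ge> 0 \<and> (k = 0 \<longrightarrow> \<tau> = 0) \<and> strict_mono r \<and> (\<lambda>n. y (r n) \<tau>) \<longlonglongrightarrow> \<zeta>)"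
    for k :: nat
  define Q where "Q k = (\<lambda>(\<tau>, \<zeta>, r :: nat \<Rightarrow> nat) (\<tau>', \<zeta>' :: 'a, r' :: nat \<Rightarrow> nat). \<tau>' = \<tau> + c \<zeta> \<and> (\<exists>u. strict_mono u \<and> r' = r \<circ> u))"
    for k :: nat
  have "\<exists>S::nat \<Rightarrow> real \<times> 'a \<times> (nat \<Rightarrow> nat). \<forall>k. P k (S k) \<and> Q k (S k) (S (Suc k))"
  proof (rule dependent_nat_choice)
    have "bounded (range (\<lambda>n. y n 0))" using \<kappa> by (auto simp: bounded_iff)
    then obtain l r where "strict_mono (r::nat \<Rightarrow> nat)" "(\<lambda>n. y (r n) 0) \<longlonglongrightarrow> l" by (rule bounded_seq_subseq)
    then have "P 0 (0, l, r)" by (simp add: P_def)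
    then show "\<exists>S. P 0 S" by blast
  next
    fix S :: "real \<times> 'a \<times> (nat \<Rightarrow> nat)" and k assume PS: "P k S"
    obtain \<tau> \<zeta> r where S: "S = (\<tau>, \<zeta>, r)" by (cases S) auto
    have \<tau>: "\<tau> \<ge> 0" "strict_mono r" and lim: "(\<lambda>n. y (r n) \<tau>) \<longlonglongrightarrow> \<zeta>" using PS by (auto simp: S P_def)
    obtain n0 where n0: "\<And>n. n \<ge> n0 \<Longrightarrow> norm (y (r n) \<tau> - \<zeta>) < 1"
      using LIMSEQ_D[OF lim, of 1] by auto
    have "norm (y (r (n + n0)) (\<tau> + c \<zeta>)) \<le> norm \<zeta> + 2" for n
    proof -
      have "norm (y (r (n + n0)) (\<tau> + c \<zeta>) - \<zeta>) \<le> 2"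
      proof (rule solution_stays_close[OF sol _ _ L(1)])
        show "{\<tau>..\<tau> + c \<zeta>} \<subseteq> {0..}" using \<tau> by auto
        show "norm (y (r (n + n0)) \<tau> - \<zeta>) \<le> 1" using n0[of "n + n0"] by simp
      qed (use L(2) c[of \<zeta>] in \<open>auto simp: less_imp_le\<close>)
      then show ?thesis using norm_triangle_sub[of "y (r (n + n0)) (\<tau> + c \<zeta>)" \<zeta>] by simp
    qed
    then have "bounded (range (\<lambda>n. y (r (n + n0)) (\<tau> + c \<zeta>)))" by (auto simp: bounded_iff)
    then obtain \<zeta>' u where u: "strict_mono (u::nat \<Rightarrow> nat)" "(\<lambda>n. y (r (u n + n0)) (\<tau> + c \<zeta>)) \<longlonglongrightarrow> \<zeta>'"
      by (rule bounded_seq_subseq)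
    define u' where "u' n = u n + n0" for n
    have u': "strict_mono u'" using u(1) by (auto simp: u'_def strict_mono_def)
    have "P (Suc k) (\<tau> + c \<zeta>, \<zeta>', r \<circ> u')"
      using \<tau> c[of \<zeta>] u(2) strict_mono_o[OF \<tau>(2) u'] by (auto simp: P_def u'_def)
    moreover have "Q k S (\<tau> + c \<zeta>, \<zeta>', r \<circ> u')" using u' by (auto simp: Q_def S)
    ultimately show "\<exists>S'. P (Suc k) S' \<and> Q k S S'" by blast
  qed
  then obtain S where S: "\<And>k. P k (S k)" "\<And>k. Q k (S k) (S (Suc k))" by blast
  define t where "t k = fst (S k)" for k
  define \<xi> where "\<xi> k = fst (snd (S k))" for k
  define r where "r k = snd (snd (S k))" for k
  have P: "P k (t k, \<xi> k, r k)" and Q: "Q k (t k, \<xi> k, r k) (t (Suc k), \<xi> (Suc k), r (Suc k))" for k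
    using S by (auto simp: t_def \<xi>_def r_def)
  show ?thesis
  proof (rule exI[of _ t], rule exI[of _ \<xi>], intro conjI allI impI)
    show "t 0 = 0" using P[of 0] by (simp add: P_def)
    fix k
    show "t (Suc k) = t k + c (\<xi> k)" using Q[of k] by (simp add: Q_def)
    fix \<eta> :: real and n0 assume "\<eta> > 0"
    obtain u where u: "strict_mono u" "r (Suc k) = r k \<circ> u" using Q[of k] by (auto simp: Q_def)
    have r: "strict_mono (r (Suc k))" and 1: "(\<lambda>n. y (r (Suc k) n) (t (Suc k))) \<longlonglongrightarrow> \<xi> (Suc k)"
      using P[of "Suc k"] by (auto simp: P_def)
    have "(\<lambda>n. y (r k n) (t k)) \<longlonglongrightarrow> \<xi> k" using P[of k] by (auto simp: P_def)
    then have 2: "(\<lambda>n. y (r (Suc k) n) (t k)) \<longlonglongrightarrow> \<xi> k"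
      using LIMSEQ_subseq_LIMSEQ[OF _ u(1)] u(2) by (fastforce simp: o_def)
    obtain n1 where n1: "\<And>n. n \<ge> n1 \<Longrightarrow> norm (y (r (Suc k) n) (t (Suc k)) - \<xi> (Suc k)) < \<eta>"
      using LIMSEQ_D[OF 1 \<open>\<eta> > 0\<close>] by blast
    obtain n2 where n2: "\<And>n. n \<ge> n2 \<Longrightarrow> norm (y (r (Suc k) n) (t k) - \<xi> k) < \<eta>"
      using LIMSEQ_D[OF 2 \<open>\<eta> > 0\<close>] by blast
    define n where "n = n0 + n1 + n2"
    have "r (Suc k) n \<ge> n0" using seq_suble[OF r, of n] by (simp add: n_def)
    then show "\<exists>n\<ge>n0. norm (y n (t k) - \<xi> k) \<le> \<eta> \<and> norm (y n (t (Suc k)) - \<xi> (Suc k)) \<le> \<eta>"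
      using n1[of n] n2[of n] by (intro exI[of _ "r (Suc k) n"]) (auto simp: n_def)
  qed
qed

text \<open>
  The tolerances \<open>\<gamma>\<close> are chosen so small that the exact solution remains on each piece within the modulus of
  continuity of \<open>\<phi>\<close> for \<open>\<delta> / 2\<close> from a solution \<open>y n\<close> with \<open>n\<close> beyond that piece. Forward completeness
  shows that the pieces cover \<open>[0, \<infinity>)\<close>.
\<close>
lemma persistent_lower_bound_solution:
  fixes \<phi> :: "'a \<Rightarrow> real" and y :: "nat \<Rightarrow> real \<Rightarrow> 'a"
  assumes fc: "forward_complete F" and \<phi>: "continuous_on UNIV \<phi>" and "\<delta> > 0"
    and sol: "\<And>n. solution_on F {0..} (y n)" and \<kappa>: "\<And>n. norm (y n 0) \<le> \<kappa>"
    and low: "\<And>n. \<forall>s\<in>{0..real n}. \<phi> (y n s) \<ge> \<delta>"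
  shows "\<exists>X. solution_on F {0..} X \<and> (\<forall>s\<ge>0. \<phi> (X s) \<ge> \<delta> / 2)"
proof -
  obtain \<Lambda> where \<Lambda>: "mono \<Lambda>" "\<And>\<xi>::'a. lip_bound (norm \<xi> + 3) (\<Lambda> (nat \<lceil>norm \<xi>\<rceil>))"
    using uniform_lip_bound by blast
  define K where "K \<xi> = \<Lambda> (nat \<lceil>norm \<xi>\<rceil>)" for \<xi> :: 'a
  have K: "lip_bound (norm \<xi> + 3) (K \<xi>)" for \<xi> using \<Lambda>(2) by (simp add: K_def)
  have K1: "K \<xi> \<ge> 1" for \<xi> using K[of \<xi>] unfolding lip_bound_def by blast
  define c where "c \<xi> = 1 / (16 * K \<xi>)" for \<xi>
  have c: "c \<xi> > 0" for \<xi> using K1[of \<xi>] by (simp add: c_def)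
  have Kc: "K \<xi> * c \<xi> = 1/16" for \<xi> using K1[of \<xi>] by (simp add: c_def)
  have Kc1: "K \<xi> * c \<xi> < 1" for \<xi> by (simp add: Kc)
  obtain t \<xi> where t\<xi>: "t 0 = 0 \<and> (\<forall>k. t (Suc k) = t k + c (\<xi> k) \<and>
    (\<forall>\<eta>>0. \<forall>n0. \<exists>n\<ge>n0. norm (y n (t k) - \<xi> k) \<le> \<eta> \<and> norm (y n (t (Suc k)) - \<xi> (Suc k)) \<le> \<eta>))"
    using limit_points_along_solutions[where y = y, OF sol \<kappa> c K Kc1] by (elim exE)
  then have t: "t 0 = 0" "t (Suc k) = t k + c (\<xi> k)" for k by simp_all
  have ends: "\<exists>n\<ge>n0. norm (y n (t k) - \<xi> k) \<le> \<eta> \<and> norm (y n (t (Suc k)) - \<xi> (Suc k)) \<le> \<eta>"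
    if "\<eta> > 0" for k \<eta> n0
    using t\<xi> that by blast
  have inc: "t k < t (Suc k)" for k using t(2) c by simp
  have tpos: "t k \<ge> 0" for k
  proof (induction k)
    case (Suc k) then show ?case using inc[of k] by simp
  qed (simp add: t)
  have "\<exists>\<epsilon>>0. \<forall>p q. norm p \<le> norm (\<xi> k) + 3 \<longrightarrow> norm q \<le> norm (\<xi> k) + 3 \<longrightarrow> norm (p - q) < \<epsilon> \<longrightarrow> \<bar>\<phi> p - \<phi> q\<bar> < \<delta> / 2" for k
  proof -
    have "uniformly_continuous_on (cball 0 (norm (\<xi> k) + 3)) \<phi>"
      by (intro compact_uniformly_continuous compact_cball continuous_on_subset[OF \<phi>]) auto
    then show ?thesis using \<open>\<delta> > 0\<close> unfolding uniformly_continuous_on_def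
      by (fastforce simp: dist_norm dest: spec[of _ "\<delta> / 2"])
  qed
  then obtain \<epsilon> where \<epsilon>: "\<And>k. \<epsilon> k > 0"
    "\<And>k p q. norm p \<le> norm (\<xi> k) + 3 \<Longrightarrow> norm q \<le> norm (\<xi> k) + 3 \<Longrightarrow> norm (p - q) < \<epsilon> k \<Longrightarrow> \<bar>\<phi> p - \<phi> q\<bar> < \<delta> / 2"
    by metis
  \<comment> \<open>halving tolerances below both \<open>1/2\<close> and a quarter of the moduli of continuity \<open>\<epsilon> k\<close>\<close>
  define \<gamma> where "\<gamma> = rec_nat (min (1/2) (\<epsilon> 0 / 4)) (\<lambda>k g. min (g / 2) (\<epsilon> (Suc k) / 4))"
  have \<gamma>0: "\<gamma> 0 = min (1/2) (\<epsilon> 0 / 4)" and \<gamma>S: "\<gamma> (Suc k) = min (\<gamma> k / 2) (\<epsilon> (Suc k) / 4)" for k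
    by (simp_all add: \<gamma>_def)
  have \<gamma>: "\<gamma> k > 0" "\<gamma> k \<le> 1/2" "\<gamma> k \<le> \<epsilon> k / 4" "\<gamma> (Suc k) \<le> \<gamma> k / 2" for k
  proof -
    show "\<gamma> k > 0" by (induction k) (auto simp: \<gamma>0 \<gamma>S \<epsilon>)
    have "\<gamma> k > 0 \<and> \<gamma> k \<le> 1/2" by (induction k) (auto simp: \<gamma>0 \<gamma>S \<epsilon>)
    then show "\<gamma> k \<le> 1/2" by blast
    show "\<gamma> k \<le> \<epsilon> k / 4" by (cases k) (auto simp: \<gamma>0 \<gamma>S)
    show "\<gamma> (Suc k) \<le> \<gamma> k / 2" by (simp add: \<gamma>S)
  qed
  define piece where "piece k n z w \<longleftrightarrow> t (Suc k) \<le> real n \<and> step_curve (t k) (t (Suc k)) z w \<and>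
      z (t k) = \<xi> k \<and> z (t (Suc k)) = \<xi> (Suc k) \<and>
      (\<forall>s\<in>{t k..t (Suc k)}. norm (y n s - \<xi> k) \<le> 2 \<and> norm (z s - y n s) \<le> \<gamma> k \<and> infdist (w s) (F (z s)) \<le> \<gamma> k)"
    for k n z w
  have "\<exists>n z w. piece k n z w" for k
  proof -
    have "\<gamma> k \<le> 1" using \<gamma>(2)[of k] by simp
    from near_solution_piece[where \<xi> = "\<xi> k", OF inc[of k] K \<gamma>(1) this]
    obtain \<eta> where \<eta>: "\<eta> > 0 \<and> (\<forall>I y p q. solution_on F I y \<longrightarrow> {t k..t (Suc k)} \<subseteq> I \<longrightarrow>
     (\<forall>s\<in>{t k..t (Suc k)}. norm (y s - \<xi> k) \<le> 2) \<longrightarrow>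
     norm (y (t k) - p) \<le> \<eta> \<longrightarrow> norm (y (t (Suc k)) - q) \<le> \<eta> \<longrightarrow>
     (\<exists>z w S. finite S \<and> steplike {t k..t (Suc k)} w \<and> (\<exists>C. C-lipschitz_on {t k..t (Suc k)} z) \<and>
        (\<forall>s\<in>{t k<..<t (Suc k)} - S. (z has_vector_derivative w s) (at s)) \<and> z (t k) = p \<and> z (t (Suc k)) = q \<and>
        (\<forall>s\<in>{t k..t (Suc k)}. norm (z s - y s) \<le> \<gamma> k \<and> infdist (w s) (F (z s)) \<le> \<gamma> k)))"
      by (elim exE)
    obtain n where n: "n \<ge> nat \<lceil>t (Suc k)\<rceil>" "norm (y n (t k) - \<xi> k) \<le> min \<eta> 1"
      "norm (y n (t (Suc k)) - \<xi> (Suc k)) \<le> min \<eta> 1"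
      using ends[of "min \<eta> 1" "nat \<lceil>t (Suc k)\<rceil>" k] \<eta> by auto
    have sub: "{t k..t (Suc k)} \<subseteq> {0..}" using tpos[of k] by auto
    have stay: "\<forall>s\<in>{t k..t (Suc k)}. norm (y n s - \<xi> k) \<le> 2"
    proof
      fix s assume s: "s \<in> {t k..t (Suc k)}"
      show "norm (y n s - \<xi> k) \<le> 2"
        by (rule solution_stays_close[OF sol sub _ K _ s]) (use n Kc1 t(2) in auto)
    qed
    have "real n \<ge> t (Suc k)" using n(1) by linarith
    have close: "norm (y n (t k) - \<xi> k) \<le> \<eta>" "norm (y n (t (Suc k)) - \<xi> (Suc k)) \<le> \<eta>" using n by auto
    from \<eta>[THEN conjunct2, THEN spec, THEN spec, THEN spec, THEN spec, THEN mp, OF sol, THEN mp, OF sub,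
        THEN mp, OF stay, THEN mp, OF close(1), THEN mp, OF close(2)]
    obtain z w S where "finite S \<and> steplike {t k..t (Suc k)} w \<and> (\<exists>C. C-lipschitz_on {t k..t (Suc k)} z) \<and>
        (\<forall>s\<in>{t k<..<t (Suc k)} - S. (z has_vector_derivative w s) (at s)) \<and> z (t k) = \<xi> k \<and> z (t (Suc k)) = \<xi> (Suc k) \<and>
        (\<forall>s\<in>{t k..t (Suc k)}. norm (z s - y n s) \<le> \<gamma> k \<and> infdist (w s) (F (z s)) \<le> \<gamma> k)"
      by (elim exE)
    then have "piece k n z w" using stay \<open>real n \<ge> t (Suc k)\<close> unfolding piece_def step_curve_def by blast
    then show ?thesis by blast
  qed
  then obtain n z w where piece: "\<And>k. piece k (n k) (z k) (w k)" by metis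
  have yz: "norm (y (n k) s - \<xi> k) \<le> 2" "norm (z k s - y (n k) s) \<le> \<gamma> k"
      "infdist (w k s) (F (z k s)) \<le> \<gamma> k" if "s \<in> {t k..t (Suc k)}" for k s
    using piece[of k] that unfolding piece_def by auto
  interpret chained_pieces F t "\<lambda>k. norm (\<xi> k) + 3" "\<lambda>k. K (\<xi> k)" \<gamma> z w
  proof
    fix k s
    show "t k < t (Suc k)" "\<gamma> k > 0" "\<gamma> (Suc k) \<le> \<gamma> k / 2" "lip_bound (norm (\<xi> k) + 3) (K (\<xi> k))"
      by (rule inc \<gamma> K)+
    show "K (\<xi> k) * (t (Suc k) - t k) \<le> 1 / 16" using Kc t(2) by simp
    show "step_curve (t k) (t (Suc k)) (z k) (w k)" "z k (t (Suc k)) = z (Suc k) (t (Suc k))"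
      using piece[of k] piece[of "Suc k"] unfolding piece_def by auto
    assume s: "s \<in> {t k..t (Suc k)}"
    show "norm (z k s) + \<gamma> k \<le> norm (\<xi> k) + 3"
      using yz[OF s] \<gamma>(2)[of k] norm_triangle_sub[of "z k s" "y (n k) s"] norm_triangle_sub[of "y (n k) s" "\<xi> k"] by simp
    have "\<gamma> k \<le> K (\<xi> k) * \<gamma> k" using K1[of "\<xi> k"] \<gamma>(1)[of k] by simp
    then show "infdist (w k s) (F (z k s)) \<le> K (\<xi> k) * \<gamma> k" using yz(3)[OF s] by simp
  qed
  obtain X where X: "solution_on F {s. 0 \<le> s \<and> (\<exists>k. s < t k)} X"
    "\<And>k s. s \<in> {t k..t (Suc k)} \<Longrightarrow> norm (X s - z k s) \<le> \<gamma> k"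
    using exact_solution[OF t(1)] by blast
  have low': "\<phi> (X s) \<ge> \<delta> / 2" if s: "s \<in> {t k..t (Suc k)}" for k s
  proof -
    have "norm ((X s - z k s) + (z k s - y (n k) s)) \<le> \<gamma> k + \<gamma> k"
      by (rule norm_triangle_mono[OF X(2)[OF s] yz(2)[OF s]])
    then have d: "norm (X s - y (n k) s) \<le> 2 * \<gamma> k" by simp
    have 1: "norm (y (n k) s) \<le> norm (\<xi> k) + 3" using yz(1)[OF s] norm_triangle_sub[of "y (n k) s" "\<xi> k"] by simp
    have 2: "norm (X s) \<le> norm (\<xi> k) + 3"
      using d \<gamma>(2)[of k] yz(1)[OF s] norm_triangle_sub[of "y (n k) s" "\<xi> k"] norm_triangle_sub[of "X s" "y (n k) s"] by simp
    have "norm (X s - y (n k) s) < \<epsilon> k" using d \<gamma>(3)[of k] \<epsilon>(1)[of k] by simp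
    then have "\<bar>\<phi> (X s) - \<phi> (y (n k) s)\<bar> < \<delta> / 2" by (rule \<epsilon>(2)[OF 2 1])
    moreover have "\<phi> (y (n k) s) \<ge> \<delta>"
      using piece[of k] s tpos[of k] unfolding piece_def by (intro low[rule_format]) auto
    ultimately show ?thesis by linarith
  qed
  \<comment> \<open>otherwise \<open>X\<close> is maximal on \<open>[0, \<tau>)\<close>: an extension would bound \<open>\<xi>\<close> and hence the steps \<open>c (\<xi> k)\<close> from below\<close>
  have unbounded: "\<exists>k. s < t k" for s
  proof (rule ccontr)
    assume "\<not> ?thesis"
    then have bdd: "bdd_above (range t)" by (intro bdd_aboveI2[of _ _ s]) (simp add: not_less)
    define \<tau> where "\<tau> = (SUP k. t k)"
    have lt: "t k < \<tau>" for k
      using inc[of k] cSUP_upper[OF UNIV_I bdd, of "Suc k"] unfolding \<tau>_def by simp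
    have J: "{s. 0 \<le> s \<and> (\<exists>k. s < t k)} = {s. 0 \<le> s \<and> ereal s < ereal \<tau>}"
      using less_cSUP_iff[OF _ bdd] unfolding \<tau>_def by auto
    have "\<not> (\<exists>T' y'. ereal \<tau> < ereal T' \<and> solution_on F {0..T'} y' \<and> (\<forall>s. 0 \<le> s \<and> ereal s < ereal \<tau> \<longrightarrow> y' s = X s))"
    proof
      assume "\<exists>T' y'. ereal \<tau> < ereal T' \<and> solution_on F {0..T'} y' \<and> (\<forall>s. 0 \<le> s \<and> ereal s < ereal \<tau> \<longrightarrow> y' s = X s)"
      then obtain T' y' where T': "\<tau> < T'" "solution_on F {0..T'} y'" "\<And>s. 0 \<le> s \<Longrightarrow> s < \<tau> \<Longrightarrow> y' s = X s"
        by auto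
      have "0 \<le> T'" using T'(1) lt[of 0] t(1) by simp
      then have "compact (y' ` {0..T'})"
        by (intro compact_continuous_image AC_imp_continuous_on solution_AC[OF T'(2)]) auto
      then obtain R where R: "\<And>s. s \<in> {0..T'} \<Longrightarrow> norm (y' s) \<le> R"
        using compact_imp_bounded bounded_iff by (metis imageI)
      \<comment> \<open>\<open>X (t k)\<close> is within \<open>1/2\<close> of \<open>\<xi> k\<close>, so all \<open>\<xi> k\<close> lie in the ball of radius \<open>R + 1\<close>\<close>
      define M where "M = \<Lambda> (nat \<lceil>R + 1\<rceil>)"
      have KM: "K (\<xi> k) \<le> M" for k
      proof -
        have "norm (X (t k)) \<le> R" using R[of "t k"] T'(3)[OF tpos lt] tpos[of k] lt[of k] T'(1) by simp
        moreover have "norm (X (t k) - \<xi> k) \<le> 1/2"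
          using X(2)[of "t k" k] inc[of k] \<gamma>(2)[of k] piece[of k] unfolding piece_def by simp
        ultimately have "norm (\<xi> k) \<le> R + 1"
          using norm_triangle_sub[of "\<xi> k" "X (t k)"] by (simp add: norm_minus_commute)
        then show ?thesis unfolding K_def M_def by (intro monoD[OF \<Lambda>(1)] nat_mono ceiling_mono)
      qed
      have M0: "M > 0" using KM[of 0] K1[of "\<xi> 0"] by simp
      have "t k \<ge> real k * (1 / (16 * M))" for k
      proof (induction k)
        case (Suc k)
        have "c (\<xi> k) \<ge> 1 / (16 * M)" unfolding c_def using KM[of k] K1[of "\<xi> k"] by (intro divide_left_mono) auto
        then show ?case using Suc t(2)[of k] by (simp add: algebra_simps add_divide_distrib)
      qed (simp add: t)
      moreover obtain k where "real k > \<tau> * (16 * M)" using reals_Archimedean2 by blast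
      then have "real k * (1 / (16 * M)) > \<tau>" using M0 by (simp add: field_simps)
      ultimately show False using lt[of k] by (meson less_le_trans not_less_iff_gr_or_eq)
    qed
    then have "maximal_solution F (ereal \<tau>) X"
      using X(1) lt[of 0] t(1) unfolding maximal_solution_def J by auto
    then show False using fc unfolding forward_complete_def by fastforce
  qed
  then have J: "{s. 0 \<le> s \<and> (\<exists>k. s < t k)} = {0..}" by auto
  have "\<phi> (X s) \<ge> \<delta> / 2" if s0: "s \<ge> 0" for s
  proof -
    define k where "k = (LEAST k. s < t k)"
    have k: "s < t k" unfolding k_def by (rule LeastI_ex[OF unbounded])
    then obtain j where j: "k = Suc j" using s0 t(1) by (cases k) auto
    then have "\<not> s < t j" using not_less_Least[of j "\<lambda>k. s < t k"] unfolding k_def by simp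
    then show ?thesis using k j by (intro low'[of s j]) auto
  qed
  then show ?thesis using X(1) unfolding J by blast
qed

lemma max_solutions_forward_complete:
  assumes "forward_complete F"
  shows "x \<in> max_solutions F C \<longleftrightarrow> solution_on F {0..} x \<and> x 0 \<in> C"
proof -
  have J: "{t. 0 \<le> t \<and> ereal t < \<infinity>} = {0..}" by auto
  show ?thesis
  proof
    assume "x \<in> max_solutions F C"
    then obtain T where T: "maximal_solution F T x" "x 0 \<in> C" unfolding max_solutions_def by blast
    then have "T = \<infinity>" using assms unfolding forward_complete_def by blast
    then show "solution_on F {0..} x \<and> x 0 \<in> C" using T J unfolding maximal_solution_def by simp
  next
    assume x: "solution_on F {0..} x \<and> x 0 \<in> C"
    then have "maximal_solution F \<infinity> x" unfolding maximal_solution_def J by simp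
    then show "x \<in> max_solutions F C" using x unfolding max_solutions_def by blast
  qed
qed

text \<open>
  Solutions that stay at or above \<open>\<delta>\<close> on \<open>[0, n]\<close> for every \<open>n\<close> would yield one that never
  falls below \<open>\<delta> / 2\<close>.
\<close>
lemma uniform_hitting_time:
  fixes \<phi> :: "'a \<Rightarrow> real"
  assumes fc: "forward_complete F" and \<phi>: "continuous_on UNIV \<phi>" and "\<delta> > 0"
    and lim: "\<And>x. solution_on F {0..} x \<Longrightarrow> ((\<lambda>t. \<phi> (x t)) \<longlongrightarrow> 0) at_top"
  obtains n :: nat where "\<And>x. solution_on F {0..} x \<Longrightarrow> norm (x 0) \<le> \<kappa> \<Longrightarrow> \<exists>s\<in>{0..real n}. \<phi> (x s) < \<delta>"
proof (rule ccontr)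
  assume "\<not> thesis"
  then have "\<forall>n::nat. \<exists>x. solution_on F {0..} x \<and> norm (x 0) \<le> \<kappa> \<and> (\<forall>s\<in>{0..real n}. \<phi> (x s) \<ge> \<delta>)"
    using that by (meson not_le)
  then obtain y where y: "\<And>n. solution_on F {0..} (y n)" "\<And>n. norm (y n 0) \<le> \<kappa>"
    "\<And>n. \<forall>s\<in>{0..real n}. \<phi> (y n s) \<ge> \<delta>" by metis
  obtain X where X: "solution_on F {0..} X" "\<And>s. s \<ge> 0 \<Longrightarrow> \<phi> (X s) \<ge> \<delta> / 2"
    using persistent_lower_bound_solution[where y = y, OF fc \<phi> \<open>\<delta> > 0\<close> y] by blast
  have "\<forall>\<^sub>F s in at_top. \<phi> (X s) < \<delta> / 2" using lim[OF X(1)] \<open>\<delta> > 0\<close> by (intro order_tendstoD(2)) auto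
  then obtain s where "\<And>r. r \<ge> s \<Longrightarrow> \<phi> (X r) < \<delta> / 2" unfolding eventually_at_top_linorder by blast
  then show False using X(2)[of "max s 0"] by (metis max.cobounded1 max.cobounded2 not_less)
qed

end

section \<open>Uniform and non-uniform output-global asymptotic stability\<close>

lemma is_norm_continuous:
  fixes N :: "'b::euclidean_space \<Rightarrow> real"
  assumes "is_norm N"
  shows "continuous_on UNIV N"
proof -
  have N: "N (c *\<^sub>R y) = \<bar>c\<bar> * N y" "N (y + z) \<le> N y + N z" for c y z
    using assms unfolding is_norm_def by auto
  have "convex_on UNIV N"
  proof (rule convex_onI)
    fix t :: real and x y :: 'b assume "0 < t" "t < 1"
    then show "N ((1 - t) *\<^sub>R x + t *\<^sub>R y) \<le> (1 - t) * N x + t * N y"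
      using N(2)[of "(1 - t) *\<^sub>R x" "t *\<^sub>R y"] by (simp add: N(1))
  qed simp
  then show ?thesis by (intro convex_on_continuous) auto
qed

theorem proposition5p3:
  fixes F :: "'a::real_normed_vector \<Rightarrow> 'a set"
    and h :: "'a \<Rightarrow> real ^ 'p"
    and N :: "real ^ 'p \<Rightarrow> real"
  assumes "\<exists>B::'a set. finite B \<and> span B = UNIV"
    and "is_norm N"
    and "\<And>\<xi>. F \<xi> \<noteq> {} \<and> compact (F \<xi>)"
    and "locally_lipschitz_map F"
    and "continuous_on UNIV h"
    and "forward_complete F"
  shows "oGAS N F h \<longleftrightarrow> oUGAS N F h"
proof -
  interpret lipschitz_inclusion F using assms by unfold_locales auto
  note max_sol = max_solutions_forward_complete[OF assms(6)]
  have N0: "N y \<ge> 0" for y using assms(2) unfolding is_norm_def by blast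
  show ?thesis
  proof
    assume G: "oGAS N F h"
    then have stable: "output_stable N F h"
      and lim: "((\<lambda>t. N (h (x t))) \<longlongrightarrow> 0) at_top" if "solution_on F {0..} x" for x
      using that unfolding oGAS_def by (auto simp: max_sol)
    have \<phi>: "continuous_on UNIV (\<lambda>\<xi>. N (h \<xi>))"
      using continuous_on_compose2[OF is_norm_continuous[OF assms(2)] assms(5)] by simp
    show "oUGAS N F h"
      unfolding oUGAS_def
    proof (intro conjI allI impI)
      show "output_stable N F h" using G unfolding oGAS_def by blast
      fix \<kappa> \<epsilon> :: real assume "\<kappa> > 0" "\<epsilon> > 0"
      then obtain \<delta> where \<delta>: "\<delta> > 0"
        "\<And>\<xi> x t. N (h \<xi>) \<le> \<delta> \<Longrightarrow> x \<in> max_solutions F {\<xi>} \<Longrightarrow> t \<ge> 0 \<Longrightarrow> N (h (x t)) \<le> \<epsilon>"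
        using G unfolding oGAS_def output_stable_def by meson
      obtain n :: nat where n: "\<And>x. solution_on F {0..} x \<Longrightarrow> norm (x 0) \<le> \<kappa> \<Longrightarrow> \<exists>s\<in>{0..real n}. N (h (x s)) < \<delta>"
        using uniform_hitting_time[OF assms(6) \<phi> \<delta>(1) lim] by blast
      show "\<exists>T>0. \<forall>x\<in>max_solutions F (cball 0 \<kappa>). \<forall>t\<ge>T. N (h (x t)) \<le> \<epsilon>"
      proof (intro exI conjI ballI allI impI)
        show "real n + 1 > 0" by simp
        fix x t assume x: "x \<in> max_solutions F (cball 0 \<kappa>)" and t: "t \<ge> real n + 1"
        then have sol: "solution_on F {0..} x" and "norm (x 0) \<le> \<kappa>" by (auto simp: max_sol)
        then obtain s where s: "0 \<le> s" "s \<le> real n" "N (h (x s)) < \<delta>" using n by force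
        have "(\<lambda>r. x (r + s)) \<in> max_solutions F {x s}"
          using solution_shift[OF sol s(1)] by (simp add: max_sol)
        then have "N (h (x ((t - s) + s))) \<le> \<epsilon>"
          using \<delta>(2)[of "x s" "\<lambda>r. x (r + s)" "t - s"] s t by simp
        then show "N (h (x t)) \<le> \<epsilon>" by simp
      qed
    qed
  next
    assume U: "oUGAS N F h"
    show "oGAS N F h"
      unfolding oGAS_def
    proof (intro conjI ballI)
      show "output_stable N F h" using U unfolding oUGAS_def by blast
      fix x assume x: "x \<in> max_solutions F UNIV"
      show "((\<lambda>t. N (h (x t))) \<longlongrightarrow> 0) at_top"
      proof (rule tendstoI)
        fix e :: real assume "e > 0"
        have "x \<in> max_solutions F (cball 0 (norm (x 0) + 1))" using x by (simp add: max_sol)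
        moreover obtain T where "\<forall>x\<in>max_solutions F (cball 0 (norm (x 0) + 1)). \<forall>t\<ge>T. N (h (x t)) \<le> e / 2"
          using U \<open>e > 0\<close> unfolding oUGAS_def by (meson add_nonneg_pos half_gt_zero norm_ge_zero zero_less_one)
        ultimately have "\<forall>t\<ge>T. dist (N (h (x t))) 0 < e" using \<open>e > 0\<close> N0 by fastforce
        then show "\<forall>\<^sub>F t in at_top. dist (N (h (x t))) 0 < e" unfolding eventually_at_top_linorder by blast
      qed
    qed
  qed
qed

end
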